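(* Let $r\in[1,3]$ and $T>0$. Suppose that $u$ is a strong solution on the time interval $[0,T]$ of the convective Brinkman--Forchheimer equations $$\partial_t u-\Delta u+(u\cdot\nabla)u+\nabla p+|u|^{r-1}u=0,\qquad\nabla\cdot u=0,$$ on $\mathbb{T}^3$, and that $v$ is any weak solution of the same equations on $[0,T]$ arising from the same initial condition $v(0)=u(0)\in V^1$ that satisfies the energy inequality $$\frac12\|v(t)\|^2+\int_0^t\|\nabla v(s)\|^2\,\mathrm{d}s+\int_0^t\|v(s)\|_{L^{r+1}}^{r+1}\,\mathrm{d}s\le\frac12\|v(0)\|^2$$ for $t\in[0,T]$. Then $u\equiv v$ on $[0,T]$.
   Context: All functions are defined on the three-dimensional torus $\mathbb{T}^3$ (period $2\pi$ in each direction) with values in $\mathbb{R}^3$; no zero-mean condition is imposed. The Sobolev norm is $\|u\|_{H^s}^2:=|\mathbb{T}^3|\sum_{k\in\mathbb{Z}^3}(1+|k|^{2s})|\hat u_k|^2$, with $\hat u_k$ the Fourier coefficients. $\mathcal{D}_\sigma$ is the set of divergence-free fields in $[C^\infty(\mathbb{T}^3)]^3$; $L^p_\sigma$ is its closure in the $L^p$-norm, $H:=L^2_\sigma$, and $V^s$ is its closure in the $H^s$-norm. $\langle\cdot,\cdot\rangle$ and $\|\cdot\|$ denote the $L^2(\mathbb{T}^3)$ inner product (or the corresponding integral pairing) and norm. A weak solution on $[0,T)$ with initial condition $u_0\in H$ is a function $u\in L^\infty(0,T;H)\cap L^{r+1}(0,T;L^{r+1}_\sigma)\cap L^2(0,T;V^1)$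 such that $$-\int_0^t\langle u,\partial_t\varphi\rangle\,\mathrm{d}s+\int_0^t\langle\nabla u,\nabla\varphi\rangle\,\mathrm{d}s+\int_0^t\langle(u\cdot\nabla)u,\varphi\rangle\,\mathrm{d}s+\int_0^t\langle|u|^{r-1}u,\varphi\rangle\,\mathrm{d}s=-\langle u(t),\varphi(t)\rangle+\langle u_0,\varphi(0)\rangle$$ for almost every $t\in(0,T)$ and all smooth, compactly supported test functions $\varphi$ on $[0,T)\times\mathbb{T}^3$ that are divergence-free in the space variables; then $u(0)$ means $u_0$. For $u_0\in V^1$, a strong solution on $[0,T]$ is a weak solution that additionally belongs to $L^\infty(0,T;V^1)\cap L^2(0,T;V^2)$. Values of weak solutions at individual times refer to the representative that is weakly continuous from $[0,T]$ into $H$. *)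

theory Defs
  imports "HOL-Analysis.Analysis"
begin

text \<open>
  Functions on the torus are represented by functions on \<open>\<real>\<^sup>3\<close> that are \<open>2\<pi>\<close>-periodic in each
  direction; integrals over the torus are Lebesgue integrals over one period cell.  Elements of
  Lebesgue and Sobolev spaces are represented by functions, so that their equality is
  equality almost everywhere.
\<close>

type_synonym vfield = "real^3 \<Rightarrow> real^3"

definition periodic :: "(real^3 \<Rightarrow> 'a) \<Rightarrow> bool" where
  "periodic f \<longleftrightarrow> (\<forall>x i. f (x + axis i (2 * pi)) = f x)"

definition torus_measure :: "(real^3) measure" where
  "torus_measure = lebesgue_on (cbox 0 (\<chi> i. 2 * pi))"

text \<open>
  \<open>C\<^sup>k\<close> and \<open>C\<^sup>\<infinity>\<close> functions on a whole Euclidean space, through continuity of all iterated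
  directional derivatives of a Frechet differentiable function.
\<close>

primrec C_diff :: "nat \<Rightarrow> ('a::euclidean_space \<Rightarrow> 'b::real_normed_vector) \<Rightarrow> bool" where
  "C_diff 0 f \<longleftrightarrow> continuous_on UNIV f"
| "C_diff (Suc k) f \<longleftrightarrow>
     (\<forall>x. f differentiable (at x)) \<and> (\<forall>v. C_diff k (\<lambda>x. frechet_derivative f (at x) v))"

definition smooth :: "('a::euclidean_space \<Rightarrow> 'b::real_normed_vector) \<Rightarrow> bool" where
  "smooth f \<longleftrightarrow> (\<forall>k. C_diff k f)"

text \<open>The entry \<open>grad f x $ i $ j\<close> is the partial derivative \<open>\<partial>\<^sub>j f\<^sub>i\<close> at \<open>x\<close>.\<close>

definition grad :: "vfield \<Rightarrow> real^3 \<Rightarrow> real^3^3" where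
  "grad f x = jacobian f (at x)"

definition divergence :: "vfield \<Rightarrow> real^3 \<Rightarrow> real" where
  "divergence f x = trace (grad f x)"

definition D_sigma :: "vfield set" where
  "D_sigma = {f. smooth f \<and> periodic f \<and> (\<forall>x. divergence f x = 0)}"


section \<open>Function spaces on the torus\<close>

definition pairing :: "(real^3 \<Rightarrow> 'a::euclidean_space) \<Rightarrow> (real^3 \<Rightarrow> 'a) \<Rightarrow> real" where
  "pairing f g = (\<integral>x. f x \<bullet> g x \<partial>torus_measure)"

definition Lp_space :: "real \<Rightarrow> vfield set" where
  "Lp_space p = {f. periodic f \<and> f \<in> borel_measurable torus_measure \<and>
     integrable torus_measure (\<lambda>x. norm (f x) powr p)}"

definition Lp_norm :: "real \<Rightarrow> (real^3 \<Rightarrow> 'a::euclidean_space) \<Rightarrow> real" where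
  "Lp_norm p f = (\<integral>x. norm (f x) powr p \<partial>torus_measure) powr (1 / p)"

definition Lp_sigma :: "real \<Rightarrow> vfield set" where
  "Lp_sigma p = {f \<in> Lp_space p.
     \<exists>\<phi>. (\<forall>n. \<phi> n \<in> D_sigma) \<and> (\<lambda>n::nat. Lp_norm p (\<lambda>x. \<phi> n x - f x)) \<longlonglongrightarrow> 0}"

abbreviation H_sigma :: "vfield set" where
  "H_sigma \<equiv> Lp_sigma 2"

text \<open>
  Fourier coefficients \<open>c\<^sub>k\<close> are normalised by \<open>f = \<Sum>\<^sub>k c\<^sub>k e\<^bsup>ik\<cdot>x\<^esup>\<close>.
\<close>

definition fourier_coeff :: "vfield \<Rightarrow> int^3 \<Rightarrow> complex^3" where
  "fourier_coeff f k = (\<chi> i. complex_of_real (1 / (2 * pi)^3) *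
     (\<integral>x. complex_of_real (f x $ i) *
        cis (- (\<Sum>j\<in>UNIV. real_of_int (k $ j) * x $ j)) \<partial>torus_measure))"

text \<open>
  \<open>(1 + |k|\<^sup>2\<^sup>s)|c\<^sub>k|\<^sup>2\<close>; only \<open>s > 0\<close> is used, where \<open>0 powr (2 * s) = 0\<close> is the right value
  for \<open>k = 0\<close>.
\<close>

definition Hs_weight :: "real \<Rightarrow> vfield \<Rightarrow> int^3 \<Rightarrow> real" where
  "Hs_weight s f k =
     (1 + norm (\<chi> j. real_of_int (k $ j)) powr (2 * s)) * (norm (fourier_coeff f k))\<^sup>2"

definition Hs_space :: "real \<Rightarrow> vfield set" where
  "Hs_space s = {f \<in> Lp_space 2. Hs_weight s f summable_on UNIV}"

definition Hs_norm :: "real \<Rightarrow> vfield \<Rightarrow> real" where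
  "Hs_norm s f = sqrt ((2 * pi)^3 * (\<Sum>\<^sub>\<infinity>k. Hs_weight s f k))"

definition V_space :: "real \<Rightarrow> vfield set" where
  "V_space s = {f \<in> Hs_space s.
     \<exists>\<phi>. (\<forall>n. \<phi> n \<in> D_sigma) \<and> (\<lambda>n::nat. Hs_norm s (\<lambda>x. \<phi> n x - f x)) \<longlonglongrightarrow> 0}"

text \<open>
  Distributional gradient.  It is determined almost everywhere, so the choice in
  \<open>weak_grad\<close> does not affect any integral.
\<close>

definition has_weak_grad :: "vfield \<Rightarrow> (real^3 \<Rightarrow> real^3^3) \<Rightarrow> bool" where
  "has_weak_grad f G \<longleftrightarrow> periodic G \<and> integrable torus_measure G \<and>
     (\<forall>\<psi> :: real^3 \<Rightarrow> real. smooth \<psi> \<longrightarrow> periodic \<psi> \<longrightarrow> (\<forall>i j.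
        (\<integral>x. f x $ i * frechet_derivative \<psi> (at x) (axis j 1) \<partial>torus_measure) =
        - (\<integral>x. G x $ i $ j * \<psi> x \<partial>torus_measure)))"

definition weak_grad :: "vfield \<Rightarrow> real^3 \<Rightarrow> real^3^3" where
  "weak_grad f = (SOME G. has_weak_grad f G)"

definition convection :: "vfield \<Rightarrow> vfield \<Rightarrow> vfield" where
  "convection f g x = weak_grad g x *v f x"

definition absorption :: "real \<Rightarrow> vfield \<Rightarrow> vfield" where
  "absorption r f x = (norm (f x) powr (r - 1)) *\<^sub>R f x"


section \<open>Bochner spaces\<close>

text \<open>
  \<open>X\<close> is a set of functions on which \<open>N\<close> is the (real-valued) norm.  Measurability is
  strong measurability: almost everywhere limit in norm of \<open>X\<close>-valued simple functions.
\<close>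

definition Bochner_measurable ::
    "real \<Rightarrow> vfield set \<Rightarrow> (vfield \<Rightarrow> real) \<Rightarrow> (real \<Rightarrow> vfield) \<Rightarrow> bool" where
  "Bochner_measurable T X N f \<longleftrightarrow>
     (AE t in lebesgue_on {0<..<T}. f t \<in> X) \<and>
     (\<exists>S. (\<forall>n. simple_function (lebesgue_on {0<..<T}) (S n) \<and> (\<forall>t\<in>{0<..<T}. S n t \<in> X)) \<and>
        (AE t in lebesgue_on {0<..<T}. (\<lambda>n::nat. N (\<lambda>x. S n t x - f t x)) \<longlonglongrightarrow> 0))"

definition Bochner_Lq ::
    "real \<Rightarrow> real \<Rightarrow> vfield set \<Rightarrow> (vfield \<Rightarrow> real) \<Rightarrow> (real \<Rightarrow> vfield) set" where
  "Bochner_Lq q T X N = {f. Bochner_measurable T X N f \<and>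
     integrable (lebesgue_on {0<..<T}) (\<lambda>t. N (f t) powr q)}"

definition Bochner_Linf ::
    "real \<Rightarrow> vfield set \<Rightarrow> (vfield \<Rightarrow> real) \<Rightarrow> (real \<Rightarrow> vfield) set" where
  "Bochner_Linf T X N = {f. Bochner_measurable T X N f \<and>
     (\<exists>C. AE t in lebesgue_on {0<..<T}. N (f t) \<le> C)}"


section \<open>Solutions of the convective Brinkman--Forchheimer equations\<close>

text \<open>
  Smoothness up to the boundary \<open>t = 0\<close> means being the restriction of a function that is smooth
  on the whole space; the values of \<open>\<phi>\<close> at negative times are irrelevant.
\<close>

definition test_function :: "real \<Rightarrow> (real \<Rightarrow> vfield) \<Rightarrow> bool" where
  "test_function T \<phi> \<longleftrightarrow> smooth (\<lambda>(t, x). \<phi> t x) \<and>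
     (\<forall>t. periodic (\<phi> t)) \<and>
     (\<forall>t\<in>{0..<T}. \<forall>x. divergence (\<phi> t) x = 0) \<and>
     (\<exists>T'<T. \<forall>t\<ge>T'. \<forall>x. \<phi> t x = 0)"

definition time_deriv :: "(real \<Rightarrow> vfield) \<Rightarrow> real \<Rightarrow> vfield" where
  "time_deriv \<phi> t x = vector_derivative (\<lambda>s. \<phi> s x) (at t)"

definition weak_solution :: "real \<Rightarrow> real \<Rightarrow> vfield \<Rightarrow> (real \<Rightarrow> vfield) \<Rightarrow> bool" where
  "weak_solution r T u0 u \<longleftrightarrow>
     u0 \<in> H_sigma \<and>
     u \<in> Bochner_Linf T H_sigma (Lp_norm 2) \<and>
     u \<in> Bochner_Lq (r + 1) T (Lp_sigma (r + 1)) (Lp_norm (r + 1)) \<and>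
     u \<in> Bochner_Lq 2 T (V_space 1) (Hs_norm 1) \<and>
     (AE t in lebesgue_on {0<..<T}. \<forall>\<phi>. test_function T \<phi> \<longrightarrow>
        - (\<integral>s. pairing (u s) (time_deriv \<phi> s) \<partial>lebesgue_on {0..t})
        + (\<integral>s. pairing (weak_grad (u s)) (grad (\<phi> s)) \<partial>lebesgue_on {0..t})
        + (\<integral>s. pairing (convection (u s) (u s)) (\<phi> s) \<partial>lebesgue_on {0..t})
        + (\<integral>s. pairing (absorption r (u s)) (\<phi> s) \<partial>lebesgue_on {0..t})
        = - pairing (u t) (\<phi> t) + pairing u0 (\<phi> 0))"

definition strong_solution :: "real \<Rightarrow> real \<Rightarrow> vfield \<Rightarrow> (real \<Rightarrow> vfield) \<Rightarrow> bool" where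
  "strong_solution r T u0 u \<longleftrightarrow>
     u0 \<in> V_space 1 \<and>
     weak_solution r T u0 u \<and>
     u \<in> Bochner_Linf T (V_space 1) (Hs_norm 1) \<and>
     u \<in> Bochner_Lq 2 T (V_space 2) (Hs_norm 2)"

text \<open>
  This selects the representative in time of a weak solution; for it, \<open>u 0\<close> is
  the initial condition (almost everywhere).
\<close>

definition weakly_continuous :: "real \<Rightarrow> (real \<Rightarrow> vfield) \<Rightarrow> bool" where
  "weakly_continuous T u \<longleftrightarrow>
     (\<forall>t\<in>{0..T}. u t \<in> H_sigma) \<and>
     (\<forall>h\<in>H_sigma. continuous_on {0..T} (\<lambda>t. pairing (u t) h))"

definition energy_inequality :: "real \<Rightarrow> real \<Rightarrow> (real \<Rightarrow> vfield) \<Rightarrow> bool" where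
  "energy_inequality r T v \<longleftrightarrow> (\<forall>t\<in>{0..T}.
     1/2 * (Lp_norm 2 (v t))\<^sup>2
     + (\<integral>s. (Lp_norm 2 (weak_grad (v s)))\<^sup>2 \<partial>lebesgue_on {0..t})
     + (\<integral>s. Lp_norm (r + 1) (v s) powr (r + 1) \<partial>lebesgue_on {0..t})
     \<le> 1/2 * (Lp_norm 2 (v 0))\<^sup>2)"

end

theory Submission
  imports Defs
begin

text \<open>
  Let \<open>w = v - u\<close>.  Expanding \<open>1/2 \<parallel>w(t)\<parallel>\<^sup>2 = 1/2 \<parallel>u(t)\<parallel>\<^sup>2 + 1/2 \<parallel>v(t)\<parallel>\<^sup>2 - \<langle>u(t), v(t)\<rangle>\<close>, one
  inserts the energy equality for \<open>u\<close>, the energy inequality for \<open>v\<close> and the evolution equation of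
  \<open>\<langle>u, v\<rangle>\<close>.  The convective terms collapse to \<open>\<langle>(w \<cdot> \<nabla>) w, u\<rangle>\<close>, because the advecting fields are
  divergence free, and the absorption terms have a good sign, because \<open>a \<mapsto> |a|\<^bsup>r-1\<^esup> a\<close> is monotone.
  What is left is
    \<open>1/2 \<parallel>w(t)\<parallel>\<^sup>2 + \<integral> \<parallel>\<nabla>w\<parallel>\<^sup>2 \<le> \<integral> sup |u| \<parallel>\<nabla>w\<parallel> \<parallel>w\<parallel>\<close>,
  where the gradient is absorbed on the left (\<open>cross_form_inequality\<close>).  Since \<open>H\<^sup>2\<close> embeds into
  \<open>L\<^sup>\<infinity>\<close> in three dimensions, \<open>sup |u|\<close> is square integrable in time, and Gronwall's inequality
  (\<open>gronwall_zero\<close>) gives \<open>w = 0\<close>.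

  The difficulty is the equation for \<open>\<langle>u, v\<rangle>\<close>, since neither solution is an admissible test
  function.  Here both are tested only with fixed divergence-free waves \<open>e\<^sub>j\<close>, multiplied by a
  cutoff in time.  Thus \<open>\<langle>u, e\<^sub>j\<rangle>\<close> and \<open>\<langle>v, e\<^sub>j\<rangle>\<close> are absolutely continuous
  (\<open>pairing_frame_equation\<close>), the product rule applies to each \<open>j\<close>, and a finite sum over \<open>j\<close> is the
  equation for \<open>\<langle>trunc N u, v\<rangle>\<close>, with \<open>trunc N\<close> the Fourier partial sum.  No regularisation in time
  is involved.  As \<open>N\<close> grows the terms converge at almost every time (\<open>cross_form_tendsto\<close>) under an
  integrable bound (\<open>cbf_form_trunc_bound\<close>), because the partial sums of \<open>u\<close> converge uniformly
  in space and are bounded by its \<open>H\<^sup>2\<close> norm.  The restriction \<open>r \<le> 3\<close> makes \<open>|u|\<^bsup>r-1\<^esup> \<le> 1 + |u|\<^sup>2\<close>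
  integrable in time and puts \<open>|v|\<^sup>r\<close> into \<open>L\<^sup>2(0,T; L\<^sup>1)\<close>.  The result is \<open>inner_product_evolution\<close>; for
  \<open>v = u\<close> it is the energy equality.

  The Fourier analysis rests on one density statement: bounded measurable functions are bounded
  almost everywhere limits of trigonometric polynomials (\<open>bounded_measurable_limit_trig\<close>).  It yields
  uniqueness of Fourier coefficients in \<open>L\<^sup>1\<close>, hence of weak gradients, and convergence of partial
  sums in \<open>L\<^sup>2\<close>.  The truncation commutes with the weak gradient, so it converges in \<open>H\<^sup>1\<close> as well.
\<close>

section \<open>Smooth functions\<close>

lemma has_derivative_imp_differentiable: "(f has_derivative D) F \<Longrightarrow> f differentiable F"
  by (auto simp: differentiable_def)

lemma C_diff_Suc_imp: "C_diff (Suc k) f \<Longrightarrow> C_diff k f"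
proof (induction k arbitrary: f)
  case 0
  then show ?case
    by (simp add: continuous_on_eq_continuous_at differentiable_imp_continuous_within)
next
  case (Suc k)
  then show ?case by (metis C_diff.simps(2))
qed

lemma C_diff_add:
  "C_diff k f \<Longrightarrow> C_diff k g \<Longrightarrow> C_diff k (\<lambda>x. f x + g x)"
proof (induction k arbitrary: f g)
  case 0
  then show ?case by (simp add: continuous_on_add)
next
  case (Suc k)
  have "frechet_derivative (\<lambda>x. f x + g x) (at x) v =
      frechet_derivative f (at x) v + frechet_derivative g (at x) v" for x v
  proof -
    have d: "((\<lambda>x. f x + g x) has_derivative
        (\<lambda>v. frechet_derivative f (at x) v + frechet_derivative g (at x) v)) (at x)"
      using Suc.prems by (intro has_derivative_add) (auto simp: frechet_derivative_works)
    show ?thesis by (simp add: frechet_derivative_at[OF d, symmetric])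
  qed
  then show ?case using Suc by (auto intro: differentiable_add)
qed

lemma C_diff_scaleR:
  fixes f :: "'a::euclidean_space \<Rightarrow> real"
  shows "C_diff k f \<Longrightarrow> C_diff k g \<Longrightarrow> C_diff k (\<lambda>x. f x *\<^sub>R g x)"
proof (induction k arbitrary: f g)
  case 0
  then show ?case by (simp add: continuous_on_scaleR)
next
  case (Suc k)
  have der: "((\<lambda>x. f x *\<^sub>R g x) has_derivative
        (\<lambda>v. f x *\<^sub>R frechet_derivative g (at x) v + frechet_derivative f (at x) v *\<^sub>R g x)) (at x)" for x
    using Suc.prems by (intro has_derivative_scaleR) (auto simp: frechet_derivative_works)
  have "frechet_derivative (\<lambda>x. f x *\<^sub>R g x) (at x) v =
      f x *\<^sub>R frechet_derivative g (at x) v + frechet_derivative f (at x) v *\<^sub>R g x" for x v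
    by (simp add: frechet_derivative_at[OF der, symmetric])
  moreover have "C_diff k f" "C_diff k g" using Suc.prems C_diff_Suc_imp by blast+
  ultimately show ?case using Suc has_derivative_imp_differentiable[OF der]
    by (auto intro!: C_diff_add)
qed

text \<open>
  A directional derivative of such a function has the same form, with the sequence \<open>D\<close> of derivatives
  shifted and the vector \<open>a\<close> rescaled; so the induction on the order closes within this family.
\<close>

lemma smooth_linear_compose:
  fixes L :: "'a::euclidean_space \<Rightarrow> real" and a :: "'b::real_normed_vector"
  assumes D: "\<And>n x. (D n has_real_derivative D (Suc n) x) (at x)" and L: "bounded_linear L"
  shows "smooth (\<lambda>x. D 0 (L x + c) *\<^sub>R a)"
proof -
  have der: "((\<lambda>x. D n (L x + c) *\<^sub>R a) has_derivative (\<lambda>v. D (Suc n) (L x + c) *\<^sub>R (L v *\<^sub>R a))) (at x)"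
    for n x and a :: 'b
  proof -
    have "((\<lambda>x. L x + c) has_derivative L) (at x)"
      using bounded_linear_imp_has_derivative[OF L] by (auto intro!: derivative_eq_intros)
    from has_derivative_scaleR_left[OF has_derivative_compose[OF this
          D[of n "L x + c", unfolded has_field_derivative_def]], of a]
    show ?thesis by (simp add: mult.commute)
  qed
  then have fd: "frechet_derivative (\<lambda>x. D n (L x + c) *\<^sub>R a) (at x) v = D (Suc n) (L x + c) *\<^sub>R (L v *\<^sub>R a)"
    for n x v and a :: 'b
    by (simp add: frechet_derivative_at[OF der, symmetric])
  have "C_diff k (\<lambda>x. D n (L x + c) *\<^sub>R a)" for k n and a :: 'b
  proof (induction k arbitrary: n a)
    case 0
    then show ?case using der
      by (auto simp: continuous_on_eq_continuous_at intro: has_derivative_continuous)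
  next
    case (Suc k)
    show ?case using Suc has_derivative_imp_differentiable[OF der] by (simp add: fd del: scaleR_scaleR)
  qed
  then show ?thesis by (simp add: smooth_def)
qed

lemma smooth_scaleR:
  fixes f :: "'a::euclidean_space \<Rightarrow> real"
  shows "smooth f \<Longrightarrow> smooth g \<Longrightarrow> smooth (\<lambda>x. f x *\<^sub>R g x)"
  by (simp add: smooth_def C_diff_scaleR)

lemma smooth_add: "smooth f \<Longrightarrow> smooth g \<Longrightarrow> smooth (\<lambda>x. f x + g x)"
  by (simp add: smooth_def C_diff_add)

lemma smooth_const: "smooth (\<lambda>x :: 'a::euclidean_space. c :: 'b::real_normed_vector)"
proof -
  have "C_diff k (\<lambda>x :: 'a. c)" for k and c :: 'b by (induction k arbitrary: c) auto
  then show ?thesis by (simp add: smooth_def)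
qed

lemma smooth_sum: "(\<And>i. i \<in> I \<Longrightarrow> smooth (f i)) \<Longrightarrow> smooth (\<lambda>x. \<Sum>i\<in>I. f i x)"
  by (induction I rule: infinite_finite_induct) (auto intro: smooth_const smooth_add)

lemma smooth_frechet:
  assumes "smooth f"
  shows "(f has_derivative frechet_derivative f (at x)) (at x)"
    and "continuous_on UNIV (\<lambda>x. frechet_derivative f (at x) v)"
    and "continuous_on UNIV f"
proof -
  have "C_diff 1 f" "C_diff 0 f" using assms by (auto simp: smooth_def)
  then show "(f has_derivative frechet_derivative f (at x)) (at x)"
    "continuous_on UNIV (\<lambda>x. frechet_derivative f (at x) v)" "continuous_on UNIV f"
    by (auto simp: frechet_derivative_works)
qed

section \<open>Integration over the torus\<close>

abbreviation TM :: "(real^3) measure" where "TM \<equiv> torus_measure"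

interpretation TM: finite_measure torus_measure
  unfolding torus_measure_def by (rule finite_measure_lebesgue_on) simp

lemma measure_TM: "measure TM (space TM) = (2 * pi) ^ 3"
proof -
  have "measure TM (space TM) = measure lborel (cbox 0 ((\<chi> i. 2 * pi) :: real^3))"
    by (simp add: torus_measure_def measure_restrict_space)
  also have "\<dots> = (2 * pi) ^ 3"
    by (subst content_cbox_cart) (auto simp: cbox_interval less_eq_vec_def interval_eq_empty_cart)
  finally show ?thesis .
qed

lemma continuous_measurable_TM:
  fixes f :: "real^3 \<Rightarrow> 'a::euclidean_space"
  shows "continuous_on UNIV f \<Longrightarrow> f \<in> borel_measurable TM"
  unfolding torus_measure_def
  by (meson continuous_imp_measurable_on_sets_lebesgue continuous_on_subset lmeasurable_cbox
      fmeasurableD subset_UNIV)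

lemma continuous_integrable_TM:
  fixes f :: "real^3 \<Rightarrow> 'a::euclidean_space"
  shows "continuous_on UNIV f \<Longrightarrow> integrable TM f"
  unfolding torus_measure_def
  by (meson continuous_imp_integrable continuous_on_subset subset_UNIV)

lemma integral_TM_eq:
  fixes f :: "real^3 \<Rightarrow> 'a::euclidean_space"
  shows "integrable TM f \<Longrightarrow> integral\<^sup>L TM f = integral (cbox 0 (\<chi> i. 2 * pi)) f"
  unfolding torus_measure_def by (simp add: lebesgue_integral_eq_integral)

text \<open>
  Moving the cell by \<open>s\<close> along an axis adds a slab on one side and removes its
  \<open>2\<pi>\<close>-translate on the other.
\<close>

lemma integral_translate_periodic:
  fixes h :: "real^3 \<Rightarrow> real"
  assumes per: "periodic h" and cont: "continuous_on UNIV h" and s: "0 \<le> s" "s \<le> 2 * pi"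
  shows "integral (cbox 0 (\<chi> i. 2 * pi)) (\<lambda>x. h (x + axis j s)) = integral (cbox 0 (\<chi> i. 2 * pi)) h"
proof -
  define c :: "real^3" where "c = (\<chi> i. 2 * pi)"
  define B where "B = cbox 0 (c + axis j s)"
  define L where "L = cbox 0 ((\<chi> i. if i = j then s else 2 * pi) :: real^3)"
  have int: "h integrable_on cbox a b" for a b
    by (meson cont continuous_on_subset integrable_continuous subset_UNIV)
  have ax: "axis j 1 \<in> (Basis :: (real^3) set)" by simp
  have split: "integral B h = integral (B \<inter> {x. x \<bullet> axis j 1 \<le> d}) h + integral (B \<inter> {x. x \<bullet> axis j 1 \<ge> d}) h" for d
    unfolding B_def by (rule integral_split[OF int ax])
  have ev: "axis j s $ i = (if i = j then s else 0)" for i :: 3 and s :: real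
    by (auto simp: axis_def)
  have mem: "x \<in> cbox a b \<longleftrightarrow> (a $ j \<le> x $ j \<and> x $ j \<le> b $ j) \<and> (\<forall>i. i \<noteq> j \<longrightarrow> a $ i \<le> x $ i \<and> x $ i \<le> b $ i)"
    for x a b :: "real^3"
    unfolding mem_box_cart by metis
  have 1: "B \<inter> {x. x \<bullet> axis j 1 \<le> 2 * pi} = cbox 0 c"
    and 2: "B \<inter> {x. x \<bullet> axis j 1 \<ge> 2 * pi} = cbox (axis j (2 * pi)) (c + axis j s)"
    and 3: "B \<inter> {x. x \<bullet> axis j 1 \<le> s} = L"
    and 4: "B \<inter> {x. x \<bullet> axis j 1 \<ge> s} = cbox (axis j s) (c + axis j s)"
    using s pi_gt_zero
    by (auto simp: B_def c_def L_def mem ev inner_axis)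
  have "integral (cbox (axis j (2 * pi)) (c + axis j s)) h =
      integral (cbox (axis j (2 * pi) - axis j (2 * pi)) (c + axis j s - axis j (2 * pi))) (\<lambda>x. h (x + axis j (2 * pi)))"
    by (rule integral_shift_cbox[symmetric])
  also have "(\<lambda>x. h (x + axis j (2 * pi))) = h"
    using per by (auto simp: periodic_def)
  also have "cbox (axis j (2 * pi) - axis j (2 * pi)) (c + axis j s - axis j (2 * pi)) = L"
  proof -
    have "c + axis j s - axis j (2 * pi) = (\<chi> i. if i = j then s else 2 * pi)"
      by (auto simp: c_def vec_eq_iff ev)
    then show ?thesis by (simp add: L_def)
  qed
  finally have "integral (cbox (axis j s) (c + axis j s)) h = integral (cbox 0 c) h"
    using split[of "2 * pi"] split[of s] by (simp add: 1 2 3 4)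
  moreover have "integral (cbox (axis j s - axis j s) (c + axis j s - axis j s)) (\<lambda>x. h (x + axis j s)) =
      integral (cbox (axis j s) (c + axis j s)) h"
    by (rule integral_shift_cbox)
  ultimately show ?thesis by (simp add: c_def)
qed

text \<open>
  The integral of \<open>h(x + s e\<^sub>j)\<close> over the cell does not depend on \<open>s\<close>, so its derivative in \<open>s\<close>
  vanishes.
\<close>

lemma integral_partial_derivative_zero:
  fixes h :: "real^3 \<Rightarrow> real"
  assumes per: "periodic h" and der: "\<And>x. (h has_derivative D x) (at x)"
    and cont: "continuous_on UNIV (\<lambda>x. D x (axis j 1))"
  shows "(\<integral>x. D x (axis j 1) \<partial>TM) = 0"
proof -
  let ?c = "(\<chi> i. 2 * pi) :: real^3"
  have ch: "continuous_on UNIV h"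
    using der by (auto simp: continuous_on_eq_continuous_at intro: has_derivative_continuous)
  have axs: "axis j s = s *\<^sub>R axis j 1" for s :: real
    by (auto simp: axis_def vec_eq_iff)
  have "((\<lambda>s. h (x + axis j s)) has_vector_derivative D (x + axis j s) (axis j 1)) (at s within {0..2*pi})" for x s
  proof -
    have "((\<lambda>s. x + axis j s) has_derivative (\<lambda>s. s *\<^sub>R axis j 1)) (at s within {0..2*pi})"
      by (subst axs) (auto intro!: derivative_eq_intros)
    from has_derivative_compose[OF this der]
    have "((\<lambda>s. h (x + axis j s)) has_derivative (\<lambda>s'. D (x + axis j s) (s' *\<^sub>R axis j 1))) (at s within {0..2*pi})" .
    moreover have "linear (D (x + axis j s))"
      using der has_derivative_linear by blast
    ultimately show ?thesis
      by (simp add: has_vector_derivative_def linear_cmul)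
  qed
  moreover have "(\<lambda>x. h (x + axis j s)) integrable_on cbox 0 ?c" for s
    by (intro integrable_continuous continuous_on_compose2[OF ch]) (auto intro!: continuous_intros)
  moreover have "continuous_on ({0..2*pi} \<times> cbox 0 ?c) (\<lambda>(s, x). D (x + axis j s) (axis j 1))"
    unfolding case_prod_unfold
    by (subst axs, intro continuous_on_compose2[OF cont]) (auto intro!: continuous_intros)
  ultimately have "((\<lambda>s. integral (cbox 0 ?c) (\<lambda>x. h (x + axis j s))) has_vector_derivative
      integral (cbox 0 ?c) (\<lambda>x. D (x + axis j 0) (axis j 1))) (at 0 within {0..2*pi})"
    by (intro leibniz_rule_vector_derivative) auto
  then have 1: "((\<lambda>s. integral (cbox 0 ?c) h) has_vector_derivative
      integral (cbox 0 ?c) (\<lambda>x. D (x + axis j 0) (axis j 1))) (at 0 within cbox 0 (2*pi))"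
    unfolding box_real by (rule has_vector_derivative_transform[rotated 2])
      (auto simp: integral_translate_periodic[OF per ch])
  have 2: "((\<lambda>s. integral (cbox 0 ?c) h) has_vector_derivative 0) (at 0 within cbox 0 (2*pi))"
    by (rule has_vector_derivative_const)
  have "integral (cbox 0 ?c) (\<lambda>x. D (x + axis j 0) (axis j 1)) = 0"
    by (rule vector_derivative_unique_within_closed_interval[OF _ _ 1 2]) auto
  moreover have "axis j 0 = (0 :: real^3)" by (simp add: axis_def vec_eq_iff)
  ultimately show ?thesis
    by (simp add: integral_TM_eq[OF continuous_integrable_TM[OF cont]])
qed

section \<open>Trigonometric waves\<close>

definition freq :: "int^3 \<Rightarrow> real^3" where
  "freq k = (\<chi> j. real_of_int (k $ j))"

text \<open>
  The phases \<open>0\<close> and \<open>\<pi>/2\<close> give \<open>cos (k \<bullet> x)\<close> and \<open>- sin (k \<bullet> x)\<close>; differentiation only shifts the phase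
  by \<open>\<pi>/2\<close>.
\<close>

definition wave :: "int^3 \<Rightarrow> real \<Rightarrow> real^3 \<Rightarrow> real" where
  "wave k \<theta> x = cos (freq k \<bullet> x + \<theta>)"

lemma freq_simps: "freq (k + m) = freq k + freq m" "freq (k - m) = freq k - freq m"
  "freq (- k) = - freq k" "freq 0 = 0" "freq k = 0 \<longleftrightarrow> k = 0"
  by (auto simp: freq_def vec_eq_iff)

lemma wave_shift: "wave k (\<theta> + pi / 2) x = - sin (freq k \<bullet> x + \<theta>)"
  by (simp add: wave_def cos_add sin_add)

lemma wave_has_derivative:
  "(wave k \<theta> has_derivative (\<lambda>v. (freq k \<bullet> v) * wave k (\<theta> + pi / 2) x)) (at x)"
proof -
  have "((\<lambda>x. cos (freq k \<bullet> x + \<theta>)) has_derivative (\<lambda>v. (freq k \<bullet> v) * wave k (\<theta> + pi / 2) x)) (at x)"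
    by (auto intro!: derivative_eq_intros simp: wave_shift)
  then show ?thesis by (simp add: wave_def[abs_def])
qed

lemma continuous_wave [continuous_intros]: "continuous_on S (wave k \<theta>)"
  unfolding wave_def[abs_def] by (intro continuous_intros)

lemma periodic_wave: "periodic (wave k \<theta>)"
proof -
  have "cos (freq k \<bullet> (x + axis i (2 * pi)) + \<theta>) = cos (freq k \<bullet> x + \<theta>)" for x i
    using cos.plus_of_int[of "freq k \<bullet> x + \<theta>" "k $ i"]
    by (simp add: inner_add_right inner_axis freq_def algebra_simps)
  then show ?thesis by (simp add: periodic_def wave_def)
qed

lemma abs_wave_le: "\<bar>wave k \<theta> x\<bar> \<le> 1"
  by (simp add: wave_def)

lemma smooth_cos_linear:
  assumes "bounded_linear L"
  shows "smooth (\<lambda>x :: 'a::euclidean_space. cos (L x + \<theta>) *\<^sub>R a)"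
proof -
  have "((\<lambda>z. cos (z + real n * (pi / 2))) has_real_derivative cos (x + real (Suc n) * (pi / 2))) (at x)" for n x
  proof -
    have "cos (x + real (Suc n) * (pi / 2)) = cos ((x + real n * (pi / 2)) + pi / 2)"
      by (simp add: field_simps)
    also have "\<dots> = - sin (x + real n * (pi / 2))"
      by (simp add: cos_add)
    finally have e: "cos (x + real (Suc n) * (pi / 2)) = - sin (x + real n * (pi / 2))" .
    show ?thesis unfolding e by (auto intro!: derivative_eq_intros)
  qed
  from smooth_linear_compose[of "\<lambda>n z. cos (z + real n * (pi / 2))", OF this assms]
  show ?thesis by simp
qed

lemma smooth_wave: "smooth (\<lambda>x. wave k \<theta> x *\<^sub>R a)"
  unfolding wave_def by (intro smooth_cos_linear bounded_linear_inner_right)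

text \<open>For \<open>k \<noteq> 0\<close> the wave is a multiple of a partial derivative of a wave, in any direction \<open>j\<close> with \<open>k\<^sub>j \<noteq> 0\<close>.\<close>

lemma integral_wave: "integral\<^sup>L TM (wave k \<theta>) = (if k = 0 then (2 * pi) ^ 3 * cos \<theta> else 0)"
proof (cases "k = 0")
  case True
  then show ?thesis by (simp add: wave_def[abs_def] freq_simps measure_TM)
next
  case False
  then obtain j where j: "k $ j \<noteq> 0" by (auto simp: vec_eq_iff)
  have "(\<integral>x. (freq k \<bullet> axis j 1) * wave k (\<theta> - pi / 2 + pi / 2) x \<partial>TM) = 0"
    by (rule integral_partial_derivative_zero[OF periodic_wave wave_has_derivative])
      (intro continuous_intros)
  then show ?thesis using j False by (simp add: inner_axis freq_def)
qed

lemma wave_mult: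
  "wave k \<theta> x * wave m \<phi> x = (wave (k + m) (\<theta> + \<phi>) x + wave (k - m) (\<theta> - \<phi>) x) / 2"
  by (simp add: wave_def freq_simps inner_add_left inner_diff_left cos_add cos_diff sin_add sin_diff)
    (simp add: algebra_simps)

lemma integral_wave_mult:
  "(\<integral>x. wave k \<theta> x * wave m \<phi> x \<partial>TM) = (2 * pi) ^ 3 / 2 *
     ((if k = - m then cos (\<theta> + \<phi>) else 0) + (if k = m then cos (\<theta> - \<phi>) else 0))"
proof -
  have *: "integrable TM (wave k \<theta>)" for k \<theta>
    by (intro continuous_integrable_TM continuous_intros)
  show ?thesis
    using eq_neg_iff_add_eq_0[of k m]
    by (simp add: wave_mult integral_wave * distrib_left)
qed

section \<open>Square integrable fields\<close>

definition sq_int :: "(real^3 \<Rightarrow> 'a::euclidean_space) \<Rightarrow> bool" where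
  "sq_int f \<longleftrightarrow> f \<in> borel_measurable TM \<and> integrable TM (\<lambda>x. (norm (f x))\<^sup>2)"

abbreviation N2 :: "(real^3 \<Rightarrow> 'a::euclidean_space) \<Rightarrow> real" where
  "N2 \<equiv> Lp_norm 2"

lemma powr_two: "0 \<le> x \<Longrightarrow> x powr 2 = x\<^sup>2" for x :: real
  by (metis powr_numeral order_le_less powr_0 power_zero_numeral zero_neq_numeral)

lemma N2_eq: "N2 f = sqrt (\<integral>x. (norm (f x))\<^sup>2 \<partial>TM)"
  by (simp add: Lp_norm_def powr_two powr_half_sqrt)

lemma N2_nonneg [simp]: "0 \<le> N2 f"
  by (simp add: N2_eq)

lemma N2_sq: "(N2 f)\<^sup>2 = (\<integral>x. (norm (f x))\<^sup>2 \<partial>TM)"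
  by (simp add: N2_eq)

lemma pairing_self: "pairing f f = (N2 f)\<^sup>2"
  by (simp add: pairing_def N2_sq power2_norm_eq_inner)

lemma pairing_commute: "pairing f g = pairing g f"
  by (simp add: pairing_def inner_commute)

lemma sq_int_measurable: "sq_int f \<Longrightarrow> f \<in> borel_measurable TM"
  by (simp add: sq_int_def)

lemma sq_int_norm_sq: "sq_int f \<Longrightarrow> integrable TM (\<lambda>x. (norm (f x))\<^sup>2)"
  by (simp add: sq_int_def)

lemma sq_int_norm_mult_integrable:
  assumes "sq_int f" "sq_int g"
  shows "integrable TM (\<lambda>x. norm (f x) * norm (g x))"
proof (rule Bochner_Integration.integrable_bound)
  show "integrable TM (\<lambda>x. (norm (f x))\<^sup>2 + (norm (g x))\<^sup>2)"
    using assms by (simp add: sq_int_def)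
  have [measurable]: "f \<in> borel_measurable TM" "g \<in> borel_measurable TM"
    using assms by (auto simp: sq_int_def)
  show "(\<lambda>x. norm (f x) * norm (g x)) \<in> borel_measurable TM" by measurable
  have "norm (f x) * norm (g x) \<le> (norm (f x))\<^sup>2 + (norm (g x))\<^sup>2" for x
    using sum_squares_bound[of "norm (f x)" "norm (g x)"]
      mult_nonneg_nonneg[OF norm_ge_zero[of "f x"] norm_ge_zero[of "g x"]] unfolding mult.assoc
    by linarith
  then show "AE x in TM. norm (norm (f x) * norm (g x)) \<le> norm ((norm (f x))\<^sup>2 + (norm (g x))\<^sup>2)"
    by simp
qed

lemma sq_int_inner_integrable:
  assumes "sq_int f" "sq_int g"
  shows "integrable TM (\<lambda>x. f x \<bullet> g x)"
proof (rule Bochner_Integration.integrable_bound[OF sq_int_norm_mult_integrable[OF assms]])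
  have [measurable]: "f \<in> borel_measurable TM" "g \<in> borel_measurable TM"
    using assms by (auto simp: sq_int_def)
  show "(\<lambda>x. f x \<bullet> g x) \<in> borel_measurable TM" by measurable
qed (auto simp: Cauchy_Schwarz_ineq2)

text \<open>Cauchy--Schwarz, from the discriminant of \<open>t \<mapsto> \<integral> (t |f| - |g|)\<^sup>2\<close>.\<close>

lemma integral_norm_mult_le:
  assumes f: "sq_int f" and g: "sq_int g"
  shows "(\<integral>x. norm (f x) * norm (g x) \<partial>TM) \<le> N2 f * N2 g"
proof -
  define A where "A = (\<integral>x. (norm (f x))\<^sup>2 \<partial>TM)"
  define B where "B = (\<integral>x. (norm (g x))\<^sup>2 \<partial>TM)"
  define C where "C = (\<integral>x. norm (f x) * norm (g x) \<partial>TM)"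
  note i = sq_int_norm_sq[OF f] sq_int_norm_sq[OF g] sq_int_norm_mult_integrable[OF f g]
  have nn: "0 \<le> A" "0 \<le> B" "0 \<le> C" by (auto simp: A_def B_def C_def)
  have q: "0 \<le> t\<^sup>2 * A - 2 * t * C + B" for t
  proof -
    have "0 \<le> (\<integral>x. (t * norm (f x) - norm (g x))\<^sup>2 \<partial>TM)" by simp
    also have "\<dots> = (\<integral>x. t\<^sup>2 * (norm (f x))\<^sup>2 - 2 * t * (norm (f x) * norm (g x)) + (norm (g x))\<^sup>2 \<partial>TM)"
      by (intro Bochner_Integration.integral_cong) (auto simp: power2_eq_square algebra_simps)
    also have "\<dots> = t\<^sup>2 * A - 2 * t * C + B"
      using i by (simp add: A_def B_def C_def)
    finally show ?thesis .
  qed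
  have "C\<^sup>2 \<le> A * B"
  proof (cases "A = 0")
    case True
    then have "C = 0" using q[of "(B + 1) / (2 * C)"] nn by (cases "C = 0") (auto simp: field_simps)
    then show ?thesis using nn by simp
  next
    case False
    have "0 \<le> A * ((C / A)\<^sup>2 * A - 2 * (C / A) * C + B)"
      using q[of "C / A"] nn by simp
    also have "\<dots> = A * B - C\<^sup>2" using False by (simp add: field_simps power2_eq_square)
    finally show ?thesis by simp
  qed
  then have "C \<le> sqrt (A * B)" using nn by (simp add: real_le_rsqrt)
  then show ?thesis by (simp add: N2_eq A_def B_def C_def real_sqrt_mult)
qed

lemma pairing_bound:
  assumes "sq_int f" "sq_int g"
  shows "\<bar>pairing f g\<bar> \<le> N2 f * N2 g"
proof -
  have "\<bar>pairing f g\<bar> \<le> (\<integral>x. \<bar>f x \<bullet> g x\<bar> \<partial>TM)"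
    unfolding pairing_def by (rule integral_abs_bound)
  also have "\<dots> \<le> (\<integral>x. norm (f x) * norm (g x) \<partial>TM)"
    using assms by (intro integral_mono integrable_abs sq_int_inner_integrable sq_int_norm_mult_integrable)
      (auto simp: Cauchy_Schwarz_ineq2)
  also have "\<dots> \<le> N2 f * N2 g" using assms by (rule integral_norm_mult_le)
  finally show ?thesis .
qed

lemma sq_int_bound:
  assumes "sq_int f" "g \<in> borel_measurable TM" "AE x in TM. norm (g x) \<le> norm (f x)"
  shows "sq_int g" and "N2 g \<le> N2 f"
proof -
  note [measurable] = assms(2)
  have le: "AE x in TM. (norm (g x))\<^sup>2 \<le> (norm (f x))\<^sup>2"
    using assms(3) by eventually_elim (simp add: power_mono)
  have i: "integrable TM (\<lambda>x. (norm (g x))\<^sup>2)"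
    by (rule Bochner_Integration.integrable_bound[OF sq_int_norm_sq[OF assms(1)]]) (use le in auto)
  then show "sq_int g" using assms(2) by (simp add: sq_int_def)
  show "N2 g \<le> N2 f" unfolding N2_eq
    using le i sq_int_norm_sq[OF assms(1)] by (auto intro!: integral_mono_AE)
qed

lemma sq_int_add:
  assumes "sq_int f" "sq_int g" shows "sq_int (\<lambda>x. f x + g x)"
proof -
  have [measurable]: "f \<in> borel_measurable TM" "g \<in> borel_measurable TM"
    using assms by (auto simp: sq_int_def)
  have "(norm (f x + g x))\<^sup>2 = (norm (f x))\<^sup>2 + 2 * (f x \<bullet> g x) + (norm (g x))\<^sup>2" for x
    by (simp add: power2_norm_eq_inner inner_add_left inner_add_right inner_commute)
  then show ?thesis using assms sq_int_inner_integrable[OF assms] by (simp add: sq_int_def)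
qed

lemma sq_int_scaleR: "sq_int f \<Longrightarrow> sq_int (\<lambda>x. c *\<^sub>R f x)"
  by (auto simp: sq_int_def power_mult_distrib)

lemma sq_int_minus: "sq_int f \<Longrightarrow> sq_int (\<lambda>x. - f x)"
  by (simp add: sq_int_def)

lemma sq_int_diff: "sq_int f \<Longrightarrow> sq_int g \<Longrightarrow> sq_int (\<lambda>x. f x - g x)"
  using sq_int_add[of f "\<lambda>x. - g x"] sq_int_minus[of g] by simp

lemma sq_int_zero: "sq_int (\<lambda>x. 0)"
  by (simp add: sq_int_def)

lemma sq_int_bounded:
  "f \<in> borel_measurable TM \<Longrightarrow> AE x in TM. norm (f x) \<le> B \<Longrightarrow> sq_int f"
  unfolding sq_int_def
  by (auto intro!: TM.integrable_const_bound[of _ "B\<^sup>2"] elim!: eventually_mono power_mono)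

lemma sq_int_continuous: "continuous_on UNIV f \<Longrightarrow> sq_int f"
  unfolding sq_int_def
  by (auto intro!: continuous_measurable_TM continuous_integrable_TM continuous_intros)

lemma sq_int_integrable:
  assumes "sq_int f" shows "integrable TM f"
proof (rule Bochner_Integration.integrable_bound)
  show "integrable TM (\<lambda>x. norm (f x) * norm (1::real))"
    using assms sq_int_continuous[of "\<lambda>x. 1 :: real"] by (intro sq_int_norm_mult_integrable) auto
qed (use assms in \<open>auto simp: sq_int_def\<close>)

lemma measurable_vec_nth [measurable (raw)]:
  fixes f :: "'b \<Rightarrow> 'a::euclidean_space^'n"
  assumes "f \<in> borel_measurable N" shows "(\<lambda>x. f x $ i) \<in> borel_measurable N"
  by (rule measurable_compose[OF assms borel_measurable_continuous_onI]) (intro continuous_intros)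

lemma sq_int_nth: "sq_int f \<Longrightarrow> sq_int (\<lambda>x. f x $ i)"
  by (rule sq_int_bound(1)) (auto simp: sq_int_def Finite_Cartesian_Product.norm_nth_le intro: measurable_vec_nth)

lemma pairing_add_left: "sq_int f \<Longrightarrow> sq_int g \<Longrightarrow> sq_int h \<Longrightarrow>
    pairing (\<lambda>x. f x + g x) h = pairing f h + pairing g h"
  by (simp add: pairing_def inner_add_left sq_int_inner_integrable)

lemma pairing_add_right: "sq_int f \<Longrightarrow> sq_int g \<Longrightarrow> sq_int h \<Longrightarrow>
    pairing h (\<lambda>x. f x + g x) = pairing h f + pairing h g"
  by (simp add: pairing_def inner_add_right sq_int_inner_integrable)

lemma pairing_diff_left: "sq_int f \<Longrightarrow> sq_int g \<Longrightarrow> sq_int h \<Longrightarrow>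
    pairing (\<lambda>x. f x - g x) h = pairing f h - pairing g h"
  by (simp add: pairing_def inner_diff_left sq_int_inner_integrable)

lemma pairing_diff_right: "sq_int f \<Longrightarrow> sq_int g \<Longrightarrow> sq_int h \<Longrightarrow>
    pairing h (\<lambda>x. f x - g x) = pairing h f - pairing h g"
  by (simp add: pairing_def inner_diff_right sq_int_inner_integrable)

lemma N2_diff_sq:
  assumes "sq_int f" "sq_int g"
  shows "(N2 (\<lambda>x. f x - g x))\<^sup>2 = (N2 f)\<^sup>2 - 2 * pairing f g + (N2 g)\<^sup>2"
  using assms pairing_commute[of f g]
  by (simp add: pairing_self[symmetric] pairing_diff_left pairing_diff_right sq_int_diff)

lemma N2_triangle:
  assumes "sq_int f" "sq_int g"
  shows "N2 (\<lambda>x. f x + g x) \<le> N2 f + N2 g"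
proof (rule power2_le_imp_le)
  have "(N2 (\<lambda>x. f x + g x))\<^sup>2 = (N2 f)\<^sup>2 + 2 * pairing f g + (N2 g)\<^sup>2"
    using assms pairing_commute[of f g]
    by (simp add: pairing_self[symmetric] pairing_add_left pairing_add_right sq_int_add)
  then show "(N2 (\<lambda>x. f x + g x))\<^sup>2 \<le> (N2 f + N2 g)\<^sup>2"
    using pairing_bound[OF assms] by (simp add: power2_sum)
qed simp

lemma N2_minus: "N2 (\<lambda>x. f x - g x) = N2 (\<lambda>x. g x - f x)"
  by (simp add: N2_eq norm_minus_commute)

lemma N2_triangle_diff:
  assumes "sq_int f" "sq_int g" "sq_int h"
  shows "N2 (\<lambda>x. f x - h x) \<le> N2 (\<lambda>x. f x - g x) + N2 (\<lambda>x. g x - h x)"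
  using N2_triangle[of "\<lambda>x. f x - g x" "\<lambda>x. g x - h x"] assms by (simp add: sq_int_diff)

lemma N2_scaleR: "N2 (\<lambda>x. c *\<^sub>R f x) = \<bar>c\<bar> * N2 f"
  by (simp add: N2_eq power_mult_distrib real_sqrt_mult)

lemma N2_cong_AE:
  "f \<in> borel_measurable TM \<Longrightarrow> g \<in> borel_measurable TM \<Longrightarrow> AE x in TM. f x = g x \<Longrightarrow> N2 f = N2 g"
  unfolding N2_eq by (intro arg_cong[of _ _ sqrt] integral_cong_AE) auto

lemma N2_zero_imp_AE:
  assumes "sq_int f" "N2 f = 0" shows "AE x in TM. f x = 0"
proof -
  have "(\<integral>x. (norm (f x))\<^sup>2 \<partial>TM) = 0" using assms by (simp add: N2_eq)
  then have "AE x in TM. (norm (f x))\<^sup>2 = 0"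
    using assms sq_int_norm_sq integral_nonneg_eq_0_iff_AE[of TM "\<lambda>x. (norm (f x))\<^sup>2"] by auto
  then show ?thesis by simp
qed

lemma pairing_diff_bound:
  assumes "sq_int f" "sq_int g" "sq_int f'" "sq_int g'"
  shows "\<bar>pairing f g - pairing f' g'\<bar> \<le>
    N2 (\<lambda>x. f x - f' x) * N2 g + N2 f' * N2 (\<lambda>x. g x - g' x)"
proof -
  have "pairing f g - pairing f' g' = pairing (\<lambda>x. f x - f' x) g + pairing f' (\<lambda>x. g x - g' x)"
    using assms by (simp add: pairing_diff_left pairing_diff_right)
  then show ?thesis
    using pairing_bound[of "\<lambda>x. f x - f' x" g] pairing_bound[of f' "\<lambda>x. g x - g' x"] assms
    by (simp add: sq_int_diff)
qed

lemma N2_bound_of_diff: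
  "sq_int f \<Longrightarrow> sq_int g \<Longrightarrow> \<bar>N2 f - N2 g\<bar> \<le> N2 (\<lambda>x. f x - g x)"
  using N2_triangle_diff[of f g "\<lambda>x. 0"] N2_triangle_diff[of g f "\<lambda>x. 0"] N2_minus[of f g]
  by (simp add: sq_int_zero)

lemma N2_tendsto:
  assumes "\<And>n. sq_int (F n)" "sq_int f" "(\<lambda>n. N2 (\<lambda>x. F n x - f x)) \<longlonglongrightarrow> 0"
  shows "(\<lambda>n. N2 (F n)) \<longlonglongrightarrow> N2 f"
  by (rule LIM_zero_cancel, rule Lim_null_comparison[OF _ assms(3)])
    (use N2_bound_of_diff[OF assms(1,2)] in auto)

lemma pairing_tendsto:
  assumes "\<And>n. sq_int (F n)" "sq_int f" "(\<lambda>n. N2 (\<lambda>x. F n x - f x)) \<longlonglongrightarrow> 0"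
    "\<And>n. sq_int (G n)" "sq_int g" "(\<lambda>n. N2 (\<lambda>x. G n x - g x)) \<longlonglongrightarrow> 0"
  shows "(\<lambda>n. pairing (F n) (G n)) \<longlonglongrightarrow> pairing f g"
proof (rule LIM_zero_cancel, rule Lim_null_comparison)
  show "\<forall>\<^sub>F n in sequentially. norm (pairing (F n) (G n) - pairing f g) \<le>
      N2 (\<lambda>x. F n x - f x) * N2 (G n) + N2 f * N2 (\<lambda>x. G n x - g x)"
    using pairing_diff_bound[OF assms(1,4,2,5)] by simp
  show "(\<lambda>n. N2 (\<lambda>x. F n x - f x) * N2 (G n) + N2 f * N2 (\<lambda>x. G n x - g x)) \<longlonglongrightarrow> 0"
    using tendsto_add[OF tendsto_mult[OF assms(3) N2_tendsto[OF assms(4-6)]]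
        tendsto_mult[OF tendsto_const assms(6), of "N2 f"]] by simp
qed

lemma N2_Fatou:
  fixes F :: "nat \<Rightarrow> real^3 \<Rightarrow> 'a::euclidean_space"
  assumes F: "\<And>n. sq_int (F n)" and f[measurable]: "f \<in> borel_measurable TM"
    and lim: "AE x in TM. (\<lambda>n. F n x) \<longlonglongrightarrow> f x" and C: "\<forall>\<^sub>F n in sequentially. N2 (F n) \<le> C"
  shows "sq_int f" and "N2 f \<le> C"
proof -
  obtain n where "N2 (F n) \<le> C" using C by (auto simp: eventually_sequentially)
  then have "0 \<le> C" using N2_nonneg[of "F n"] by linarith
  have [measurable]: "F n \<in> borel_measurable TM" for n using F by (simp add: sq_int_def)
  have "(\<integral>\<^sup>+x. ennreal ((norm (f x))\<^sup>2) \<partial>TM) =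
      (\<integral>\<^sup>+x. liminf (\<lambda>n. ennreal ((norm (F n x))\<^sup>2)) \<partial>TM)"
  proof (intro nn_integral_cong_AE)
    show "AE x in TM. ennreal ((norm (f x))\<^sup>2) = liminf (\<lambda>n. ennreal ((norm (F n x))\<^sup>2))"
      using lim
    proof eventually_elim
      case (elim x)
      then have "(\<lambda>n. ennreal ((norm (F n x))\<^sup>2)) \<longlonglongrightarrow> ennreal ((norm (f x))\<^sup>2)"
        by (intro tendsto_intros)
      from lim_imp_Liminf[OF sequentially_bot this] show ?case by (rule sym)
    qed
  qed
  also have "\<dots> \<le> liminf (\<lambda>n. \<integral>\<^sup>+x. ennreal ((norm (F n x))\<^sup>2) \<partial>TM)"
    by (rule nn_integral_liminf) measurable
  also have "\<dots> \<le> ennreal (C\<^sup>2)"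
  proof -
    have "(\<integral>\<^sup>+x. ennreal ((norm (F n x))\<^sup>2) \<partial>TM) = ennreal ((N2 (F n))\<^sup>2)" for n
      using F by (simp add: N2_sq sq_int_norm_sq nn_integral_eq_integral)
    moreover have "\<forall>\<^sub>F n in sequentially. ennreal ((N2 (F n))\<^sup>2) \<le> ennreal (C\<^sup>2)"
      using C by eventually_elim (auto intro!: ennreal_leI power_mono)
    ultimately have "\<forall>\<^sub>F n in sequentially. (\<integral>\<^sup>+x. ennreal ((norm (F n x))\<^sup>2) \<partial>TM) \<le> ennreal (C\<^sup>2)"
      by simp
    then show ?thesis by (intro Liminf_le) auto
  qed
  finally have le: "(\<integral>\<^sup>+x. ennreal ((norm (f x))\<^sup>2) \<partial>TM) \<le> ennreal (C\<^sup>2)" .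
  then have i: "integrable TM (\<lambda>x. (norm (f x))\<^sup>2)"
    by (intro integrableI_bounded) (auto simp: order_le_less_trans)
  then show "sq_int f" by (simp add: sq_int_def)
  have "ennreal ((N2 f)\<^sup>2) \<le> ennreal (C\<^sup>2)"
    using le i by (simp add: N2_sq nn_integral_eq_integral)
  then show "N2 f \<le> C" using \<open>0 \<le> C\<close> by (simp add: power2_le_iff_abs_le)
qed

text \<open>
  The limit is defined pointwise along a subsequence with summable increments, which converges
  almost everywhere; defined pointwise, it inherits periodicity.
\<close>

lemma L2_complete:
  fixes g :: "nat \<Rightarrow> real^3 \<Rightarrow> 'a::euclidean_space"
  assumes g: "\<And>n. sq_int (g n)" and per: "\<And>n. periodic (g n)"
    and Cauchy: "\<And>e. 0 < e \<Longrightarrow> \<exists>N. \<forall>m\<ge>N. \<forall>n\<ge>N. N2 (\<lambda>x. g m x - g n x) < e"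
  shows "\<exists>G. sq_int G \<and> periodic G \<and> (\<lambda>n. N2 (\<lambda>x. g n x - G x)) \<longlonglongrightarrow> 0"
proof -
  have [measurable]: "g n \<in> borel_measurable TM" for n using g by (simp add: sq_int_def)
  have "\<exists>N. \<forall>m\<ge>N. \<forall>n\<ge>N. N2 (\<lambda>x. g m x - g n x) < (1/2) ^ k" for k
    by (rule Cauchy) simp
  then obtain N where N: "\<And>k m n. m \<ge> N k \<Longrightarrow> n \<ge> N k \<Longrightarrow> N2 (\<lambda>x. g m x - g n x) < (1/2) ^ k"
    by metis
  \<comment> \<open>Partial sums make the indices monotone; consecutive members differ by at most \<open>2\<^bsup>-k\<^esup>\<close>.\<close>
  define r where "r k = (\<Sum>i\<le>k. N i)" for k
  have rN: "N k \<le> r l" if "k \<le> l" for k l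
    using that unfolding r_def by (intro member_le_sum) auto
  define d where "d k x = g (r (Suc k)) x - g (r k) x" for k x
  have [measurable]: "d k \<in> borel_measurable TM" for k unfolding d_def by measurable
  have dint: "integrable TM (d k)" for k
    unfolding d_def[abs_def] by (intro sq_int_integrable sq_int_diff g)
  have one: "sq_int (\<lambda>x. 1 :: real)" by (intro sq_int_continuous) simp
  have dle: "(\<integral>x. norm (d k x) \<partial>TM) \<le> (1/2) ^ k * N2 (\<lambda>x. 1 :: real)" for k
  proof -
    have sd: "sq_int (d k)" unfolding d_def[abs_def] by (intro sq_int_diff g)
    have "(\<integral>x. norm (d k x) * norm (1 :: real) \<partial>TM) \<le> N2 (d k) * N2 (\<lambda>x. 1 :: real)"
      by (rule integral_norm_mult_le[OF sd one])
    also have "\<dots> \<le> (1/2) ^ k * N2 (\<lambda>x. 1 :: real)"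
      using N[of k "r (Suc k)" "r k"] rN[of k k] rN[of k "Suc k"]
      by (intro mult_right_mono) (auto simp: d_def[abs_def])
    finally show ?thesis by simp
  qed
  have "(\<integral>\<^sup>+x. (\<Sum>k. ennreal (norm (d k x))) \<partial>TM) = (\<Sum>k. \<integral>\<^sup>+x. ennreal (norm (d k x)) \<partial>TM)"
    by (intro nn_integral_suminf) measurable
  also have "\<dots> = (\<Sum>k. ennreal (\<integral>x. norm (d k x) \<partial>TM))"
    using dint by (simp add: nn_integral_eq_integral)
  also have "\<dots> = ennreal (\<Sum>k. \<integral>x. norm (d k x) \<partial>TM)"
  proof (rule suminf_ennreal2)
    show "summable (\<lambda>k. \<integral>x. norm (d k x) \<partial>TM)"
      by (rule summable_comparison_test'[where g="\<lambda>k. (1/2) ^ k * N2 (\<lambda>x. 1 :: real)" and N=0])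
        (auto intro!: summable_mult2 summable_geometric dle)
  qed simp
  finally have "(\<integral>\<^sup>+x. (\<Sum>k. ennreal (norm (d k x))) \<partial>TM) \<noteq> \<infinity>" by simp
  then have "AE x in TM. (\<Sum>k. ennreal (norm (d k x))) \<noteq> \<infinity>"
    by (intro nn_integral_noteq_infinite) measurable
  then have conv: "AE x in TM. convergent (\<lambda>k. g (r k) x)"
  proof eventually_elim
    case (elim x)
    then have "summable (\<lambda>k. norm (d k x))"
      by (intro summable_suminf_not_top) auto
    then have "(\<lambda>n. \<Sum>k<n. d k x) \<longlonglongrightarrow> (\<Sum>k. d k x)"
      by (rule summable_LIMSEQ[OF summable_norm_cancel])
    from tendsto_add[OF this tendsto_const[of "g (r 0) x"]]
    have "(\<lambda>n. (\<Sum>k<n. d k x) + g (r 0) x) \<longlonglongrightarrow> (\<Sum>k. d k x) + g (r 0) x" .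
    moreover have "(\<Sum>k<n. d k x) + g (r 0) x = g (r n) x" for n
      unfolding d_def sum_lessThan_telescope[of "\<lambda>k. g (r k) x"] by simp
    ultimately show ?case unfolding convergent_def by auto
  qed
  define G where "G x = lim (\<lambda>k. g (r k) x)" for x
  have [measurable]: "G \<in> borel_measurable TM" unfolding G_def by measurable
  have lim: "AE x in TM. (\<lambda>k. g (r k) x) \<longlonglongrightarrow> G x"
    using conv by eventually_elim (simp add: G_def convergent_LIMSEQ_iff)
  have est: "sq_int (\<lambda>x. g m x - G x) \<and> N2 (\<lambda>x. g m x - G x) \<le> (1/2) ^ K" if "m \<ge> N K" for m K
  proof -
    have s: "sq_int (\<lambda>x. g m x - g (r k) x)" for k by (intro sq_int_diff g)
    have l: "AE x in TM. (\<lambda>k. g m x - g (r k) x) \<longlonglongrightarrow> g m x - G x"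
      using lim by eventually_elim (intro tendsto_intros)
    have "\<forall>\<^sub>F k in sequentially. N2 (\<lambda>x. g m x - g (r k) x) \<le> (1/2) ^ K"
      unfolding eventually_sequentially
      using N[OF that rN] by (intro exI[of _ K]) (auto intro: less_imp_le)
    from N2_Fatou[OF s _ l this] show ?thesis by simp
  qed
  have "sq_int (\<lambda>x. g (N 0) x - (g (N 0) x - G x))"
    using est[of 0 "N 0"] sq_int_diff[OF g[of "N 0"], of "\<lambda>x. g (N 0) x - G x"] by blast
  then have "sq_int G" by simp
  moreover have "periodic G"
    using per by (simp add: periodic_def G_def)
  moreover have "(\<lambda>n. N2 (\<lambda>x. g n x - G x)) \<longlonglongrightarrow> 0"
  proof (rule LIMSEQ_I)
    fix e :: real assume "0 < e"
    then obtain K where K: "(1/2) ^ K < e" using real_arch_pow_inv[of e "1/2"] by auto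
    then show "\<exists>no. \<forall>n\<ge>no. norm (N2 (\<lambda>x. g n x - G x) - 0) < e"
      using est by (intro exI[of _ "N K"]) (auto intro: order_le_less_trans)
  qed
  ultimately show ?thesis by blast
qed

subsection \<open>Trilinear forms\<close>

lemma norm_sq_vec: "(norm (x :: 'a::real_normed_vector^'n))\<^sup>2 = (\<Sum>i\<in>UNIV. (norm (x $ i))\<^sup>2)"
  by (simp add: norm_vec_def L2_set_def sum_nonneg)

lemma norm_matrix_vector_le:
  fixes A :: "real^'n^'m"
  shows "norm (A *v x) \<le> norm A * norm x"
proof (rule power2_le_imp_le)
  have "(norm (A *v x))\<^sup>2 = (\<Sum>i\<in>UNIV. (A $ i \<bullet> x)\<^sup>2)"
    by (simp add: norm_sq_vec matrix_vector_mult_def inner_vec_def)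
  also have "\<dots> \<le> (\<Sum>i\<in>UNIV. (norm (A $ i))\<^sup>2 * (norm x)\<^sup>2)"
    by (intro sum_mono) (metis Cauchy_Schwarz_ineq power2_norm_eq_inner)
  also have "\<dots> = (norm A * norm x)\<^sup>2"
    by (simp add: power_mult_distrib sum_distrib_right norm_sq_vec[of A])
  finally show "(norm (A *v x))\<^sup>2 \<le> (norm A * norm x)\<^sup>2" .
qed simp

lemma AE_norm_le_imp_nonneg:
  assumes "AE x in TM. norm (f x) \<le> K" shows "0 \<le> K"
proof (rule ccontr)
  assume K: "\<not> 0 \<le> K"
  have "AE x in TM. False"
    using assms by eventually_elim (use K norm_ge_zero order_trans in blast)
  then have "space TM \<in> null_sets TM" by (subst (asm) AE_iff_null) auto
  then show False using measure_TM by (simp add: measure_def null_sets_def)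
qed

text \<open>With \<open>G = \<nabla>f\<close> this is \<open>\<langle>(a \<cdot> \<nabla>) f, \<psi>\<rangle>\<close>.\<close>

definition tri :: "(real^3 \<Rightarrow> real^3^3) \<Rightarrow> vfield \<Rightarrow> vfield \<Rightarrow> real" where
  "tri G a \<psi> = pairing (\<lambda>x. G x *v a x) \<psi>"

lemma matrix_vector_measurable [measurable (raw)]:
  fixes G :: "_ \<Rightarrow> real^3^3"
  assumes "G \<in> borel_measurable N" "a \<in> borel_measurable N"
  shows "(\<lambda>x. G x *v a x) \<in> borel_measurable N"
proof -
  have "continuous_on UNIV (\<lambda>p :: (real^3^3) \<times> (real^3). fst p *v snd p)"
    unfolding matrix_vector_mult_def by (intro continuous_intros)
  then have "(\<lambda>p :: (real^3^3) \<times> (real^3). fst p *v snd p) \<in> borel_measurable borel"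
    by (rule borel_measurable_continuous_onI)
  moreover have "(\<lambda>x. (G x, a x)) \<in> borel_measurable N"
    using assms by (intro borel_measurable_Pair)
  ultimately show ?thesis
    using measurable_compose[of "\<lambda>x. (G x, a x)" N borel "\<lambda>p. fst p *v snd p"] by simp
qed

text \<open>
  Of the three factors of \<open>tri\<close> two are square integrable and one is bounded, which one varies.
\<close>

lemma tri_bounded_test:
  assumes G: "sq_int G" and a: "sq_int a" and m[measurable]: "\<psi> \<in> borel_measurable TM"
    and B: "AE x in TM. norm (\<psi> x) \<le> K"
  shows "integrable TM (\<lambda>x. (G x *v a x) \<bullet> \<psi> x)" and "\<bar>tri G a \<psi>\<bar> \<le> K * N2 G * N2 a"
proof -
  have [measurable]: "G \<in> borel_measurable TM" "a \<in> borel_measurable TM"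
    using G a by (auto simp: sq_int_def)
  have "AE x in TM. \<bar>(G x *v a x) \<bullet> \<psi> x\<bar> \<le> K * (norm (G x) * norm (a x))"
    using B
  proof eventually_elim
    case (elim x)
    have "\<bar>(G x *v a x) \<bullet> \<psi> x\<bar> \<le> norm (G x *v a x) * norm (\<psi> x)" by (rule Cauchy_Schwarz_ineq2)
    also have "\<dots> \<le> (norm (G x) * norm (a x)) * K"
      using elim norm_matrix_vector_le by (intro mult_mono) auto
    finally show ?case by (simp add: mult.commute)
  qed
  note le = this
  have i: "integrable TM (\<lambda>x. K * (norm (G x) * norm (a x)))"
    using sq_int_norm_mult_integrable[OF G a] by simp
  show *: "integrable TM (\<lambda>x. (G x *v a x) \<bullet> \<psi> x)"
    by (rule Bochner_Integration.integrable_bound[OF i]) (use le in auto)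
  have K: "0 \<le> K" using B by (rule AE_norm_le_imp_nonneg)
  have "\<bar>tri G a \<psi>\<bar> \<le> (\<integral>x. \<bar>(G x *v a x) \<bullet> \<psi> x\<bar> \<partial>TM)"
    unfolding tri_def pairing_def by (rule integral_abs_bound)
  also have "\<dots> \<le> (\<integral>x. K * (norm (G x) * norm (a x)) \<partial>TM)"
    using * i le by (intro integral_mono_AE) auto
  also have "\<dots> \<le> K * (N2 G * N2 a)"
    using integral_norm_mult_le[OF G a] K by (simp add: mult_left_mono)
  finally show "\<bar>tri G a \<psi>\<bar> \<le> K * N2 G * N2 a" by (simp add: mult.assoc)
qed

lemma tri_bounded_advection:
  assumes G: "sq_int G" and m[measurable]: "a \<in> borel_measurable TM"
    and B: "AE x in TM. norm (a x) \<le> K" and p: "sq_int \<psi>"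
  shows "sq_int (\<lambda>x. G x *v a x)" and "\<bar>tri G a \<psi>\<bar> \<le> K * N2 G * N2 \<psi>"
proof -
  have [measurable]: "G \<in> borel_measurable TM" "\<psi> \<in> borel_measurable TM"
    using G p by (auto simp: sq_int_def)
  have "AE x in TM. norm (G x *v a x) \<le> norm (K *\<^sub>R G x)"
    using B
  proof eventually_elim
    case (elim x)
    have "norm (G x *v a x) \<le> norm (G x) * norm (a x)" by (rule norm_matrix_vector_le)
    also have "\<dots> \<le> norm (G x) * \<bar>K\<bar>" using elim by (intro mult_left_mono) auto
    finally show ?case by (simp add: mult.commute)
  qed
  from sq_int_bound[OF sq_int_scaleR[OF G] _ this] have 1: "sq_int (\<lambda>x. G x *v a x)"
    "N2 (\<lambda>x. G x *v a x) \<le> \<bar>K\<bar> * N2 G" by (auto simp: N2_scaleR)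
  then show "sq_int (\<lambda>x. G x *v a x)" by simp
  have K: "0 \<le> K" using B by (rule AE_norm_le_imp_nonneg)
  have "\<bar>tri G a \<psi>\<bar> \<le> N2 (\<lambda>x. G x *v a x) * N2 \<psi>"
    unfolding tri_def by (rule pairing_bound[OF 1(1) p])
  also have "\<dots> \<le> \<bar>K\<bar> * N2 G * N2 \<psi>" using 1(2) by (intro mult_right_mono) auto
  finally show "\<bar>tri G a \<psi>\<bar> \<le> K * N2 G * N2 \<psi>" using K by simp
qed

section \<open>Density of trigonometric polynomials\<close>

text \<open>The linear span of the waves.  The product formula for cosines makes it an algebra.\<close>

inductive_set trig :: "(real^3 \<Rightarrow> real) set" where
  trig_wave: "wave k \<theta> \<in> trig"
| trig_add: "f \<in> trig \<Longrightarrow> g \<in> trig \<Longrightarrow> (\<lambda>x. f x + g x) \<in> trig"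
| trig_scale: "f \<in> trig \<Longrightarrow> (\<lambda>x. c * f x) \<in> trig"

lemma trig_mult:
  assumes "f \<in> trig" "g \<in> trig" shows "(\<lambda>x. f x * g x) \<in> trig"
  using assms(1)
proof induction
  case (trig_wave k \<theta>)
  show ?case using assms(2)
  proof induction
    case (trig_wave m \<phi>)
    have "(\<lambda>x. (1/2) * (wave (k + m) (\<theta> + \<phi>) x + wave (k - m) (\<theta> - \<phi>) x)) \<in> trig"
      by (intro trig.intros)
    then show ?case by (simp add: wave_mult)
  next
    case (trig_add f g)
    then show ?case by (simp add: distrib_left trig.trig_add)
  next
    case (trig_scale f c)
    then show ?case by (simp add: mult.left_commute trig.trig_scale)
  qed
next
  case (trig_add f1 f2)
  then show ?case by (simp add: distrib_right trig.trig_add)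
next
  case (trig_scale f c)
  then show ?case by (simp add: mult.assoc trig.trig_scale)
qed

lemma trig_const: "(\<lambda>x. c) \<in> trig"
  using trig_scale[OF trig_wave[of 0 0], of c] by (simp add: wave_def freq_simps)

lemma trig_continuous: "f \<in> trig \<Longrightarrow> continuous_on S f"
  by (induction rule: trig.induct) (auto intro: continuous_intros)

text \<open>
  Embeds the torus into Euclidean space, as a compact set to which the Stone--Weierstrass theorem
  applies.
\<close>

definition circles :: "real^3 \<Rightarrow> (real^3) \<times> (real^3)" where
  "circles x = ((\<chi> j. cos (x $ j)), (\<chi> j. sin (x $ j)))"

abbreviation cell :: "(real^3) set" where "cell \<equiv> cbox 0 (\<chi> i. 2 * pi)"
abbreviation open_cell :: "(real^3) set" where "open_cell \<equiv> box 0 (\<chi> i. 2 * pi)"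

lemma circles_inj:
  assumes "x \<in> open_cell" "y \<in> cell" "circles x = circles y"
  shows "x = y"
proof -
  have "x $ j = y $ j" for j
  proof -
    have e: "cos (x $ j) = cos (y $ j)" "sin (x $ j) = sin (y $ j)"
      using assms(3) by (auto simp: circles_def vec_eq_iff)
    have "cos (x $ j - y $ j) = 1"
      unfolding cos_diff e by (simp flip: power2_eq_square)
    then obtain n :: int where n: "x $ j - y $ j = n * 2 * pi"
      by (auto simp: cos_one_2pi_int)
    have b: "0 < x $ j" "x $ j < 2 * pi" "0 \<le> y $ j" "y $ j \<le> 2 * pi"
      using assms(1,2) by (auto simp: mem_box_cart)
    have "real_of_int n * (2 * pi) < 1 * (2 * pi)" "(-1) * (2 * pi) < real_of_int n * (2 * pi)"
      using n b by linarith+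
    then have "real_of_int n < 1" "-1 < real_of_int n"
      by (simp_all only: mult_less_cancel_right) auto
    then have "n = 0" by linarith
    then show ?thesis using n by simp
  qed
  then show ?thesis by (simp add: vec_eq_iff)
qed

lemma continuous_circles: "continuous_on S circles"
  unfolding circles_def by (intro continuous_intros continuous_on_vec_lambda)

text \<open>
  Such a \<open>g\<close> is a continuous function on the torus, embedded by \<open>circles\<close>, and there
  trigonometric polynomials separate points.
\<close>

lemma trig_dense_uniform:
  assumes cont: "continuous_on UNIV g" and zero: "\<And>x. x \<notin> open_cell \<Longrightarrow> g x = 0" and "0 < e"
  shows "\<exists>p\<in>trig. \<forall>x\<in>cell. \<bar>g x - p x\<bar> < e"
proof -
  define S where "S = circles ` cell"
  define g' where "g' y = g (SOME x. x \<in> cell \<and> circles x = y)" for y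
  have g': "g' (circles x) = g x" if "x \<in> cell" for x
  proof -
    define z where "z = (SOME z. z \<in> cell \<and> circles z = circles x)"
    have z: "z \<in> cell \<and> circles z = circles x"
      unfolding z_def by (rule someI[of _ x]) (use that in simp)
    have "g z = g x"
    proof (cases "x \<in> open_cell \<or> z \<in> open_cell")
      case True
      then show ?thesis using z that circles_inj[of x z] circles_inj[of z x] by auto
    next
      case False
      then show ?thesis using zero by simp
    qed
    then show ?thesis by (simp add: g'_def z_def)
  qed
  have S: "compact S" unfolding S_def
    by (intro compact_continuous_image continuous_circles compact_cbox)
  have g'cont: "continuous_on S g'"
  proof (subst continuous_on_closed_vimage[OF compact_imp_closed[OF S]], intro allI impI)
    fix B :: "real set" assume "closed B"
    then have "closed (g -` B)"
      using continuous_closed_vimage[of B g] cont by (simp add: continuous_on_eq_continuous_at)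
    then have "compact (circles ` (g -` B \<inter> cell))"
      by (intro compact_continuous_image continuous_circles) (auto intro: closed_Int_compact)
    moreover have "g' -` B \<inter> S = circles ` (g -` B \<inter> cell)"
      using g' by (auto simp: S_def)
    ultimately show "closed (g' -` B \<inter> S)" by (simp add: compact_imp_closed)
  qed
  define R where "R = {f. continuous_on S f \<and> (\<exists>p\<in>trig. \<forall>x. f (circles x) = p x)}"
  have ax: "freq (axis j 1) \<bullet> x = x $ j" for j x
  proof -
    have "freq (axis j 1) = axis j 1" by (auto simp: freq_def axis_def vec_eq_iff)
    then show ?thesis by (simp add: inner_axis')
  qed
  interpret R: function_ring_on R S
  proof
    show "compact S" by (rule S)
    show "f \<in> R \<Longrightarrow> continuous_on S f" for f by (simp add: R_def)
    show "f \<in> R \<Longrightarrow> g \<in> R \<Longrightarrow> (\<lambda>x. f x + g x) \<in> R" for f g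
      by (fastforce simp: R_def intro: continuous_intros trig_add)
    show "f \<in> R \<Longrightarrow> g \<in> R \<Longrightarrow> (\<lambda>x. f x * g x) \<in> R" for f g
      by (fastforce simp: R_def intro: continuous_intros trig_mult)
    show "(\<lambda>_. c) \<in> R" for c
      using trig_const[of c] by (auto simp: R_def)
    fix x y :: "(real^3) \<times> (real^3)" assume "x \<noteq> y"
    then consider j where "fst x $ j \<noteq> fst y $ j" | j where "snd x $ j \<noteq> snd y $ j"
      by (auto simp: prod_eq_iff vec_eq_iff)
    then show "\<exists>f\<in>R. f x \<noteq> f y"
    proof cases
      case 1
      have "(\<lambda>p. fst p $ j) \<in> R"
        using trig_wave[of "axis j 1" 0]
        by (auto simp: R_def circles_def wave_def ax intro!: continuous_intros bexI[of _ "wave (axis j 1) 0"])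
      then show ?thesis using 1 by (intro bexI[of _ "\<lambda>p. fst p $ j"])
    next
      case 2
      have "(\<lambda>p. snd p $ j) \<in> R"
        using trig_wave[of "axis j 1" "- pi / 2"]
        by (auto simp: R_def circles_def wave_def ax cos_diff
            intro!: continuous_intros bexI[of _ "wave (axis j 1) (- pi / 2)"])
      then show ?thesis using 2 by (intro bexI[of _ "\<lambda>p. snd p $ j"])
    qed
  qed
  obtain f where f: "f \<in> R" "\<And>y. y \<in> S \<Longrightarrow> \<bar>g' y - f y\<bar> < e"
    using R.Stone_Weierstrass_basic[OF g'cont \<open>0 < e\<close>] by auto
  then obtain p where p: "p \<in> trig" "\<And>x. f (circles x) = p x" by (auto simp: R_def)
  have "\<bar>g x - p x\<bar> < e" if "x \<in> cell" for x
    using f(2)[of "circles x"] p(2) g'[OF that] that by (simp add: S_def)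
  then show ?thesis using p(1) by blast
qed

lemma AE_TM_iff: "(AE x in TM. P x) \<longleftrightarrow> (AE x in lebesgue. x \<in> cell \<longrightarrow> P x)"
  unfolding torus_measure_def by (subst AE_restrict_space_iff) auto

lemma AE_TM_cell: "AE x in TM. x \<in> cell"
  by (simp add: AE_TM_iff)

text \<open>
  A measurable function is almost everywhere a limit of continuous functions.  Clipped at \<open>M\<close> and
  multiplied by a cutoff that vanishes off the open cell, these are continuous on the torus and
  uniformly close to trigonometric polynomials.
\<close>

lemma bounded_measurable_limit_trig:
  assumes h: "h \<in> borel_measurable TM" and M: "\<And>x. \<bar>h x\<bar> \<le> M"
  shows "\<exists>p. (\<forall>n. p n \<in> trig) \<and> (\<forall>n. \<forall>x\<in>cell. \<bar>p n x\<bar> \<le> M + 1) \<and>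
    (AE x in TM. (\<lambda>n. p n x) \<longlonglongrightarrow> h x)"
proof -
  have M0: "0 \<le> M" using M[of 0] by linarith
  have "h measurable_on cell"
    using h by (simp add: measurable_on_iff_borel_measurable torus_measure_def)
  then obtain N g where N: "negligible N" and gc: "\<And>n. continuous_on UNIV (g n)"
    and gl: "\<And>x. x \<notin> N \<Longrightarrow> (\<lambda>n. g n x) \<longlonglongrightarrow> (if x \<in> cell then h x else 0)"
    unfolding measurable_on_def by metis
  define q where "q n x = max (- M) (min M (g n x)) * min 1 (real n * infdist x (- open_cell))"
    for n :: nat and x
  have qc: "continuous_on UNIV (q n)" for n
    unfolding q_def by (intro continuous_intros gc)
  have q0: "q n x = 0" if "x \<notin> open_cell" for n x
    using that by (simp add: q_def)
  have qM: "\<bar>q n x\<bar> \<le> M" for n x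
  proof -
    have "\<bar>q n x\<bar> \<le> M * 1"
      unfolding q_def abs_mult using M0 by (intro mult_mono) (auto simp: infdist_nonneg)
    then show ?thesis by simp
  qed
  have "\<exists>p\<in>trig. \<forall>x\<in>cell. \<bar>q n x - p x\<bar> < 1 / real (Suc n)" for n
    by (rule trig_dense_uniform[OF qc q0]) auto
  then obtain p where p: "\<And>n. p n \<in> trig" "\<And>n x. x \<in> cell \<Longrightarrow> \<bar>q n x - p n x\<bar> < 1 / real (Suc n)"
    by metis
  have "\<bar>p n x\<bar> \<le> M + 1" if "x \<in> cell" for n x
  proof -
    have "1 / real (Suc n) \<le> 1" by simp
    then show ?thesis using p(2)[OF that, of n] qM[of n x] by linarith
  qed
  moreover have "AE x in TM. (\<lambda>n. p n x) \<longlonglongrightarrow> h x"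
    unfolding AE_TM_iff
  proof (rule AE_I'[of "N \<union> (cell - open_cell)"])
    show "N \<union> (cell - open_cell) \<in> null_sets lebesgue"
      using N negligible_frontier_interval[of 0 "(\<chi> i. 2 * pi) :: real^3"]
      by (simp add: negligible_iff_null_sets[symmetric] negligible_Un)
    show "{x \<in> space lebesgue. \<not> (x \<in> cell \<longrightarrow> (\<lambda>n. p n x) \<longlonglongrightarrow> h x)} \<subseteq> N \<union> (cell - open_cell)"
    proof (rule subsetI, rule ccontr)
      fix x assume a: "x \<in> {x \<in> space lebesgue. \<not> (x \<in> cell \<longrightarrow> (\<lambda>n. p n x) \<longlonglongrightarrow> h x)}"
        and b: "x \<notin> N \<union> (cell - open_cell)"
      then have x: "x \<in> cell" "x \<in> open_cell" "x \<notin> N" by auto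
      have ne: "- open_cell \<noteq> {}"
      proof
        assume "- open_cell = {}"
        then have "(0 :: real^3) \<in> open_cell" by auto
        then show False by (simp add: mem_box_cart)
      qed
      have d: "0 < infdist x (- open_cell)"
        using infdist_pos_not_in_closed[of "- open_cell" x] x ne by (simp add: open_box closed_Compl)
      have "\<forall>\<^sub>F n in sequentially. 1 / infdist x (- open_cell) \<le> real n"
        by (rule eventually_sequentiallyI[of "nat \<lceil>1 / infdist x (- open_cell)\<rceil>"]) linarith
      then have ev: "\<forall>\<^sub>F n in sequentially. max (- M) (min M (g n x)) = q n x"
      proof eventually_elim
        case (elim n)
        then have "1 \<le> real n * infdist x (- open_cell)" using d by (simp add: field_simps)
        then show ?case by (simp add: q_def)
      qed
      have "(\<lambda>n. max (- M) (min M (g n x))) \<longlonglongrightarrow> max (- M) (min M (h x))"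
        using gl[OF x(3)] x(1) by (intro tendsto_intros) auto
      moreover have "max (- M) (min M (h x)) = h x" using M[of x] by auto
      ultimately have ql: "(\<lambda>n. q n x) \<longlonglongrightarrow> h x"
        using tendsto_cong[OF ev] by simp
      have "(\<lambda>n. p n x - q n x) \<longlonglongrightarrow> 0"
      proof (rule Lim_null_comparison)
        show "\<forall>\<^sub>F n in sequentially. norm (p n x - q n x) \<le> 1 / real (Suc n)"
          using p(2)[OF x(1)] by (auto simp: abs_minus_commute intro!: always_eventually less_imp_le)
        show "(\<lambda>n. 1 / real (Suc n)) \<longlonglongrightarrow> 0" by (rule LIMSEQ_Suc[OF lim_1_over_n])
      qed
      from tendsto_add[OF this ql] show False using a by simp
    qed
  qed
  ultimately show ?thesis using p(1) by blast
qed

lemma integrable_mult_bounded_continuous: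
  fixes w :: "real^3 \<Rightarrow> 'a::euclidean_space" and p :: "real^3 \<Rightarrow> real"
  assumes w: "integrable TM w" and p: "continuous_on UNIV p"
  shows "integrable TM (\<lambda>x. p x *\<^sub>R w x)"
proof -
  have "bounded (p ` cell)"
    by (intro compact_imp_bounded compact_continuous_image continuous_on_subset[OF p] compact_cbox) simp
  then obtain B where B: "\<And>x. x \<in> cell \<Longrightarrow> \<bar>p x\<bar> \<le> B" by (auto simp: bounded_iff)
  have [measurable]: "w \<in> borel_measurable TM" "p \<in> borel_measurable TM"
    using w p by (auto intro: continuous_measurable_TM)
  show ?thesis
  proof (rule Bochner_Integration.integrable_bound)
    show "integrable TM (\<lambda>x. B *\<^sub>R w x)" using w by simp
    show "AE x in TM. norm (p x *\<^sub>R w x) \<le> norm (B *\<^sub>R w x)"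
      using AE_TM_cell
    proof eventually_elim
      case (elim x)
      have "\<bar>p x\<bar> \<le> \<bar>B\<bar>" using B[OF elim] by linarith
      then show ?case by (simp add: mult_right_mono)
    qed
  qed measurable
qed

text \<open>Testing against trigonometric polynomials that converge boundedly to \<open>sgn w\<close> gives \<open>\<integral>|w| = 0\<close>.\<close>

lemma fourier_uniqueness:
  fixes w :: "real^3 \<Rightarrow> real"
  assumes w: "integrable TM w" and zero: "\<And>k \<theta>. (\<integral>x. wave k \<theta> x * w x \<partial>TM) = 0"
  shows "AE x in TM. w x = 0"
proof -
  have wm[measurable]: "w \<in> borel_measurable TM" using w by simp
  have z: "(\<integral>x. p x * w x \<partial>TM) = 0" if "p \<in> trig" for p
    using that
  proof induction
    case (trig_add f g)
    then show ?case
      using integrable_mult_bounded_continuous[OF w trig_continuous, of f]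
        integrable_mult_bounded_continuous[OF w trig_continuous, of g]
      by (simp add: distrib_right)
  qed (auto simp: zero mult.assoc)
  obtain p where p: "\<And>n. p n \<in> trig" "\<And>n x. x \<in> cell \<Longrightarrow> \<bar>p n x\<bar> \<le> 1 + 1"
    "AE x in TM. (\<lambda>n. p n x) \<longlonglongrightarrow> sgn (w x)"
    using bounded_measurable_limit_trig[of "\<lambda>x. sgn (w x)" 1] by (auto simp: abs_sgn_eq)
  have [measurable]: "p n \<in> borel_measurable TM" for n
    by (intro continuous_measurable_TM trig_continuous p)
  have "(\<lambda>n. \<integral>x. p n x * w x \<partial>TM) \<longlonglongrightarrow> (\<integral>x. sgn (w x) * w x \<partial>TM)"
  proof (rule integral_dominated_convergence)
    show "integrable TM (\<lambda>x. 2 * \<bar>w x\<bar>)" using w by simp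
    show "AE x in TM. (\<lambda>n. p n x * w x) \<longlonglongrightarrow> sgn (w x) * w x"
      using p(3) by eventually_elim (intro tendsto_intros)
    show "AE x in TM. norm (p n x * w x) \<le> 2 * \<bar>w x\<bar>" for n
      using AE_TM_cell
    proof eventually_elim
      case (elim x)
      then show ?case using p(2)[OF elim, of n] by (simp add: abs_mult mult_right_mono)
    qed
  qed measurable
  then have "(\<integral>x. sgn (w x) * w x \<partial>TM) = 0"
    using z[OF p(1)] LIMSEQ_unique[OF _ tendsto_const] by simp
  moreover have "sgn (w x) * w x = \<bar>w x\<bar>" for x by (simp add: mult.commute abs_sgn)
  ultimately have "(\<integral>x. \<bar>w x\<bar> \<partial>TM) = 0" by simp
  then have "AE x in TM. \<bar>w x\<bar> = 0"
    using w by (subst integral_nonneg_eq_0_iff_AE[symmetric]) auto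
  then show ?thesis by simp
qed

lemma N2_tendsto_dominated:
  fixes F :: "nat \<Rightarrow> real^3 \<Rightarrow> 'a::euclidean_space"
  assumes [measurable]: "\<And>n. F n \<in> borel_measurable TM" "f \<in> borel_measurable TM"
    and lim: "AE x in TM. (\<lambda>n. F n x) \<longlonglongrightarrow> f x" and d: "integrable TM d"
    and dom: "\<And>n. AE x in TM. (norm (F n x - f x))\<^sup>2 \<le> d x"
  shows "(\<lambda>n. N2 (\<lambda>x. F n x - f x)) \<longlonglongrightarrow> 0"
proof -
  have "(\<lambda>n. \<integral>x. (norm (F n x - f x))\<^sup>2 \<partial>TM) \<longlonglongrightarrow> (\<integral>x. 0 \<partial>TM)"
  proof (rule integral_dominated_convergence[OF _ _ d])
    show "AE x in TM. (\<lambda>n. (norm (F n x - f x))\<^sup>2) \<longlonglongrightarrow> 0"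
      using lim
    proof eventually_elim
      case (elim x)
      have "(\<lambda>n. (norm (F n x - f x))\<^sup>2) \<longlonglongrightarrow> (norm (f x - f x))\<^sup>2"
        by (intro tendsto_intros elim)
      then show ?case by simp
    qed
  qed (use dom in auto)
  from tendsto_real_sqrt[OF this] show ?thesis by (simp add: N2_eq)
qed

text \<open>
  First \<open>h\<close> is clipped, then the bounded function is approximated; both steps converge by dominated
  convergence.
\<close>

lemma trig_dense_L2:
  fixes h :: "real^3 \<Rightarrow> real"
  assumes h: "sq_int h" and "0 < e"
  shows "\<exists>p\<in>trig. N2 (\<lambda>x. h x - p x) < e"
proof -
  have [measurable]: "h \<in> borel_measurable TM" using h by (simp add: sq_int_def)
  define T where "T n x = max (- real n) (min (real n) (h x))" for n x
  have [measurable]: "T n \<in> borel_measurable TM" for n unfolding T_def by measurable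
  have "(\<lambda>n. N2 (\<lambda>x. T n x - h x)) \<longlonglongrightarrow> 0"
  proof (rule N2_tendsto_dominated[where d="\<lambda>x. (h x)\<^sup>2"])
    have "(\<lambda>n. T n x) \<longlonglongrightarrow> h x" for x
    proof (rule tendsto_eventually)
      show "\<forall>\<^sub>F n in sequentially. T n x = h x"
        by (rule eventually_sequentiallyI[of "nat \<lceil>\<bar>h x\<bar>\<rceil>"]) (auto simp: T_def)
    qed
    then show "AE x in TM. (\<lambda>n. T n x) \<longlonglongrightarrow> h x" by simp
    have "norm (T n x - h x) \<le> \<bar>h x\<bar>" for n x
      unfolding T_def real_norm_def by linarith
    then have "(norm (T n x - h x))\<^sup>2 \<le> (h x)\<^sup>2" for n x
      by (simp add: abs_le_square_iff[symmetric])
    then show "AE x in TM. (norm (T n x - h x))\<^sup>2 \<le> (h x)\<^sup>2" for n by simp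
    show "integrable TM (\<lambda>x. (h x)\<^sup>2)" using sq_int_norm_sq[OF h] by simp
  qed measurable
  then have "\<forall>\<^sub>F n in sequentially. N2 (\<lambda>x. T n x - h x) < e / 2"
    using \<open>0 < e\<close> by (intro order_tendstoD(2)) auto
  then obtain n where n: "N2 (\<lambda>x. T n x - h x) < e / 2"
    by (auto simp: eventually_sequentially)
  have Tn: "\<bar>T n x\<bar> \<le> real n" for x by (auto simp: T_def)
  obtain p where p: "\<And>m. p m \<in> trig" "\<And>m x. x \<in> cell \<Longrightarrow> \<bar>p m x\<bar> \<le> real n + 1"
    "AE x in TM. (\<lambda>m. p m x) \<longlonglongrightarrow> T n x"
    using bounded_measurable_limit_trig[of "T n" "real n"] Tn by auto blast
  have pm[measurable]: "p m \<in> borel_measurable TM" for m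
    by (intro continuous_measurable_TM trig_continuous p)
  have "(\<lambda>m. N2 (\<lambda>x. p m x - T n x)) \<longlonglongrightarrow> 0"
  proof (rule N2_tendsto_dominated[OF _ _ p(3), where d="\<lambda>x. (2 * real n + 1)\<^sup>2"])
    show "AE x in TM. (norm (p m x - T n x))\<^sup>2 \<le> (2 * real n + 1)\<^sup>2" for m
      using AE_TM_cell
    proof eventually_elim
      case (elim x)
      have "norm (p m x - T n x) \<le> 2 * real n + 1"
        using p(2)[OF elim, of m] Tn[of x] by simp
      then show ?case by (rule power_mono) simp
    qed
  qed auto
  then have "\<forall>\<^sub>F m in sequentially. N2 (\<lambda>x. p m x - T n x) < e / 2"
    using \<open>0 < e\<close> by (intro order_tendstoD(2)) auto
  then obtain m where m: "N2 (\<lambda>x. p m x - T n x) < e / 2"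
    by (auto simp: eventually_sequentially)
  have "sq_int (T n)" by (rule sq_int_bounded[of _ "real n"]) (use Tn in auto)
  moreover have "sq_int (p m)" by (intro sq_int_continuous trig_continuous p)
  ultimately have "N2 (\<lambda>x. h x - p m x) \<le> N2 (\<lambda>x. h x - T n x) + N2 (\<lambda>x. T n x - p m x)"
    using h by (intro N2_triangle_diff)
  also have "\<dots> < e" using m n N2_minus[of h "T n"] N2_minus[of "T n" "p m"] by simp
  finally show ?thesis using p(1) by blast
qed

section \<open>Fourier truncation\<close>

definition modes :: "nat \<Rightarrow> (int^3) set" where
  "modes N = {k. \<forall>j. \<bar>k $ j\<bar> \<le> int N}"

lemma modes_image: "modes N = vec_lambda ` (UNIV \<rightarrow>\<^sub>E {- int N..int N})"
proof safe
  fix k assume "k \<in> modes N"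
  then have "k = vec_lambda (\<lambda>j. k $ j)" "(\<lambda>j. k $ j) \<in> UNIV \<rightarrow>\<^sub>E {- int N..int N}"
    by (auto simp: modes_def abs_le_iff minus_le_iff)
  then show "k \<in> vec_lambda ` (UNIV \<rightarrow>\<^sub>E {- int N..int N})" by blast
qed (auto simp: modes_def PiE_iff abs_le_iff minus_le_iff)

lemma finite_modes [simp]: "finite (modes N)"
  unfolding modes_image by (intro finite_imageI finite_PiE) auto

lemma modes_uminus [simp]: "- k \<in> modes N \<longleftrightarrow> k \<in> modes N"
  by (simp add: modes_def)

lemma modes_mono: assumes "M \<le> N" shows "modes M \<subseteq> modes N"
proof
  fix k assume "k \<in> modes M"
  then have "\<bar>k $ j\<bar> \<le> int M" for j by (simp add: modes_def)
  then have "\<bar>k $ j\<bar> \<le> int N" for j using assms order_trans of_nat_mono by blast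
  then show "k \<in> modes N" by (simp add: modes_def)
qed

lemma modes_exhaust: "\<exists>N. k \<in> modes N"
proof -
  have "\<bar>k $ j\<bar> \<le> int (\<Sum>j\<in>UNIV. nat \<bar>k $ j\<bar>)" for j
    using member_le_sum[of j UNIV "\<lambda>j. \<bar>k $ j\<bar>"] by simp
  then show ?thesis unfolding modes_def by blast
qed

definition coef :: "int^3 \<Rightarrow> real \<Rightarrow> (real^3 \<Rightarrow> 'a::euclidean_space) \<Rightarrow> 'a" where
  "coef k \<theta> f = (\<integral>x. wave k \<theta> x *\<^sub>R f x \<partial>TM)"

text \<open>
  The Fourier partial sum in real form: summing \<open>cos (k \<bullet> x + \<theta>) cos (k \<bullet> y + \<theta>)\<close> over the two phases
  gives \<open>cos (k \<bullet> (x - y))\<close>.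
\<close>

definition trunc :: "nat \<Rightarrow> (real^3 \<Rightarrow> 'a::euclidean_space) \<Rightarrow> real^3 \<Rightarrow> 'a" where
  "trunc N f x = (1 / (2 * pi) ^ 3) *\<^sub>R
     (\<Sum>k\<in>modes N. \<Sum>\<theta>\<in>{0, pi / 2}. wave k \<theta> x *\<^sub>R coef k \<theta> f)"

lemma coef_integrable:
  fixes f :: "real^3 \<Rightarrow> 'a::euclidean_space"
  shows "integrable TM f \<Longrightarrow> integrable TM (\<lambda>x. wave k \<theta> x *\<^sub>R f x)"
  using integrable_mult_bounded_continuous[of f "wave k \<theta>"] continuous_wave[of UNIV k \<theta>] by blast

lemma coef_add: "integrable TM f \<Longrightarrow> integrable TM g \<Longrightarrow> coef k \<theta> (\<lambda>x. f x + g x) = coef k \<theta> f + coef k \<theta> g"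
  by (simp add: coef_def scaleR_add_right coef_integrable)

lemma coef_scaleR: "coef k \<theta> (\<lambda>x. c *\<^sub>R f x) = c *\<^sub>R coef k \<theta> f"
  unfolding coef_def by (subst integral_scaleR_right[symmetric]) (simp add: mult.commute)

lemma coef_diff: "integrable TM f \<Longrightarrow> integrable TM g \<Longrightarrow> coef k \<theta> (\<lambda>x. f x - g x) = coef k \<theta> f - coef k \<theta> g"
  by (simp add: coef_def scaleR_diff_right coef_integrable)

lemma coef_inner: "integrable TM f \<Longrightarrow> coef k \<theta> (\<lambda>x. f x \<bullet> b) = coef k \<theta> f \<bullet> b"
  unfolding coef_def
  by (subst integral_inner_left[symmetric]) (auto intro: coef_integrable)

lemma trunc_add: "integrable TM f \<Longrightarrow> integrable TM g \<Longrightarrow> trunc N (\<lambda>x. f x + g x) x = trunc N f x + trunc N g x"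
  by (simp add: trunc_def coef_add scaleR_add_right sum.distrib algebra_simps)

lemma trunc_diff: "integrable TM f \<Longrightarrow> integrable TM g \<Longrightarrow> trunc N (\<lambda>x. f x - g x) x = trunc N f x - trunc N g x"
  by (simp add: trunc_def coef_diff scaleR_diff_right sum_subtractf sum.distrib algebra_simps)

lemma trunc_scaleR: "trunc N (\<lambda>x. c *\<^sub>R f x) x = c *\<^sub>R trunc N f x"
  by (simp add: trunc_def coef_scaleR scaleR_sum_right sum.distrib algebra_simps)

lemma trunc_inner: "integrable TM f \<Longrightarrow> trunc N (\<lambda>x. f x \<bullet> b) x = trunc N f x \<bullet> b"
  by (simp add: trunc_def coef_inner inner_sum_left inner_add_left)

lemma continuous_trunc [continuous_intros]: "continuous_on S (trunc N f)"
  unfolding trunc_def[abs_def] by (intro continuous_intros)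

lemma periodic_trunc: "periodic (trunc N f)"
  using periodic_wave by (simp add: periodic_def trunc_def)

lemma sq_int_trunc [simp]: "sq_int (trunc N f)"
  by (intro sq_int_continuous continuous_intros)

lemma integrable_trunc [simp]: "integrable TM (trunc N f)"
  by (intro continuous_integrable_TM continuous_intros)

text \<open>
  Orthogonality of the waves, applied to any family \<open>Z\<close> that depends on \<open>(k, \<theta>)\<close> like
  \<open>cos (k \<bullet> x + \<theta>)\<close> does.
\<close>

lemma sum_wave_products:
  fixes Z :: "int^3 \<Rightarrow> real \<Rightarrow> 'a::real_vector"
  assumes phase: "\<And>k \<theta>. Z k \<theta> = cos \<theta> *\<^sub>R Z k 0 + sin \<theta> *\<^sub>R Z k (pi / 2)"
    and sym: "\<And>k. Z (- k) 0 = Z k 0" "\<And>k. Z (- k) (pi / 2) = - Z k (pi / 2)"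
    and m: "m \<in> modes N"
  shows "(\<Sum>k\<in>modes N. \<Sum>\<theta>\<in>{0, pi / 2}. (\<integral>x. wave m \<phi> x * wave k \<theta> x \<partial>TM) *\<^sub>R Z k \<theta>) =
    (2 * pi) ^ 3 *\<^sub>R Z m \<phi>"
proof -
  define c where "c = (2 * pi) ^ 3 / 2"
  have neg: "m = - k \<longleftrightarrow> k = - m" for k by (auto simp: equation_minus_iff)
  define a where "a k = c *\<^sub>R (cos \<phi> *\<^sub>R Z k 0 + cos (\<phi> + pi / 2) *\<^sub>R Z k (pi / 2))" for k
  define b where "b k = c *\<^sub>R (cos \<phi> *\<^sub>R Z k 0 + cos (\<phi> - pi / 2) *\<^sub>R Z k (pi / 2))" for k
  have "(\<Sum>\<theta>\<in>{0, pi / 2}. (\<integral>x. wave m \<phi> x * wave k \<theta> x \<partial>TM) *\<^sub>R Z k \<theta>) =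
      (if k = - m then a k else 0) + (if k = m then b k else 0)" for k
  proof -
    have I: "(\<integral>x. wave m \<phi> x * wave k \<theta> x \<partial>TM) =
        c * ((if k = - m then cos (\<phi> + \<theta>) else 0) + (if k = m then cos (\<phi> - \<theta>) else 0))" for \<theta>
      unfolding integral_wave_mult neg[of k] eq_commute[of m k] c_def by (rule refl)
    have S: "(\<Sum>\<theta>\<in>{0, pi / 2}. h \<theta>) = h 0 + h (pi / 2)" for h :: "real \<Rightarrow> 'a"
      by simp
    have "c * (x + y) = c * x + c * y" for x y by (rule distrib_left)
    moreover have "(if b then x else 0) *\<^sub>R z = (if b then x *\<^sub>R z else 0)" for b x and z :: 'a by simp
    moreover have "(c * (if b then x else 0)) = (if b then c * x else 0)" for b x by simp
    ultimately show ?thesis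
      unfolding S I a_def b_def
      by (simp only: scaleR_add_left scaleR_add_right scaleR_scaleR) (simp add: add_ac)
  qed
  then have "(\<Sum>k\<in>modes N. \<Sum>\<theta>\<in>{0, pi / 2}. (\<integral>x. wave m \<phi> x * wave k \<theta> x \<partial>TM) *\<^sub>R Z k \<theta>) =
      (\<Sum>k\<in>modes N. if k = - m then a k else 0) + (\<Sum>k\<in>modes N. if k = m then b k else 0)"
    by (simp add: sum.distrib)
  also have "\<dots> = a (- m) + b m" using m by simp
  also have "\<dots> = (2 * c) *\<^sub>R (cos \<phi> *\<^sub>R Z m 0 + sin \<phi> *\<^sub>R Z m (pi / 2))"
  proof -
    have e: "2 * c * x = c * x + c * x" for x by simp
    show ?thesis
      by (simp add: a_def b_def sym cos_add cos_diff scaleR_add_right)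
        (simp only: e scaleR_add_left add_ac)
  qed
  also have "\<dots> = (2 * pi) ^ 3 *\<^sub>R Z m \<phi>"
    by (simp add: c_def phase[symmetric])
  finally show ?thesis .
qed

lemma wave_phase: "wave k \<theta> x = cos \<theta> * wave k 0 x + sin \<theta> * wave k (pi / 2) x"
  by (simp add: wave_def cos_add)

lemma wave_uminus: "wave (- k) 0 x = wave k 0 x" "wave (- k) (pi / 2) x = - wave k (pi / 2) x"
  by (simp_all add: wave_def freq_simps cos_add cos_diff)

lemma coef_trunc:
  fixes f :: "real^3 \<Rightarrow> 'a::euclidean_space"
  assumes f: "integrable TM f" and m: "m \<in> modes N"
  shows "coef m \<phi> (trunc N f) = coef m \<phi> f"
proof -
  have i: "integrable TM (\<lambda>x. (wave m \<phi> x * wave k \<theta> x) *\<^sub>R a)" for k \<theta> and a :: 'a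
    by (intro continuous_integrable_TM continuous_intros)
  have wmi: "integrable TM (\<lambda>x. wave m \<phi> x * wave k \<theta> x)" for k \<theta>
    by (intro continuous_integrable_TM continuous_intros)
  have "coef m \<phi> (trunc N f) = (\<integral>x. (1 / (2 * pi) ^ 3) *\<^sub>R (\<Sum>k\<in>modes N. \<Sum>\<theta>\<in>{0, pi / 2}.
      (wave m \<phi> x * wave k \<theta> x) *\<^sub>R coef k \<theta> f) \<partial>TM)"
    unfolding coef_def[of m] trunc_def
    by (simp add: scaleR_sum_right scaleR_add_right mult.left_commute)
  also have "\<dots> = (1 / (2 * pi) ^ 3) *\<^sub>R (\<Sum>k\<in>modes N. \<Sum>\<theta>\<in>{0, pi / 2}.
      (\<integral>x. wave m \<phi> x * wave k \<theta> x \<partial>TM) *\<^sub>R coef k \<theta> f)"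
    using i by (simp add: Bochner_Integration.integral_sum wmi)
  also have "\<dots> = (1 / (2 * pi) ^ 3) *\<^sub>R ((2 * pi) ^ 3 *\<^sub>R coef m \<phi> f)"
  proof (subst sum_wave_products[where Z="\<lambda>k \<theta>. coef k \<theta> f"])
    show "coef k \<theta> f = cos \<theta> *\<^sub>R coef k 0 f + sin \<theta> *\<^sub>R coef k (pi / 2) f" for k \<theta>
      unfolding coef_def
      by (subst wave_phase) (simp add: scaleR_add_left coef_integrable[OF f] flip: scaleR_scaleR)
    show "coef (- k) 0 f = coef k 0 f" "coef (- k) (pi / 2) f = - coef k (pi / 2) f" for k
      by (simp_all add: coef_def wave_uminus)
  qed (use m in auto)
  also have "\<dots> = coef m \<phi> f" by simp
  finally show ?thesis .
qed

lemma trunc_wave: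
  assumes m: "m \<in> modes N"
  shows "trunc N (wave m \<phi>) x = wave m \<phi> x"
proof -
  have "trunc N (wave m \<phi>) x = (1 / (2 * pi) ^ 3) *\<^sub>R (\<Sum>k\<in>modes N. \<Sum>\<theta>\<in>{0, pi / 2}.
      (\<integral>x. wave m \<phi> x * wave k \<theta> x \<partial>TM) *\<^sub>R wave k \<theta> x)"
    by (simp add: trunc_def coef_def mult.commute)
  also have "\<dots> = (1 / (2 * pi) ^ 3) *\<^sub>R ((2 * pi) ^ 3 *\<^sub>R wave m \<phi> x)"
  proof (subst sum_wave_products[where Z="\<lambda>k \<theta>. wave k \<theta> x"])
    show "wave k \<theta> x = cos \<theta> *\<^sub>R wave k 0 x + sin \<theta> *\<^sub>R wave k (pi / 2) x" for k \<theta>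
      unfolding real_scaleR_def by (rule wave_phase)
  qed (simp_all add: m wave_uminus)
  finally show ?thesis by simp
qed

lemma trunc_trig: "p \<in> trig \<Longrightarrow> \<exists>N0. \<forall>N\<ge>N0. \<forall>x. trunc N p x = p x"
proof (induction rule: trig.induct)
  case (trig_wave k \<theta>)
  obtain N0 where "k \<in> modes N0" using modes_exhaust by blast
  then show ?case using trunc_wave modes_mono by blast
next
  case (trig_add f g)
  then obtain Nf Ng where "\<forall>N\<ge>Nf. \<forall>x. trunc N f x = f x" "\<forall>N\<ge>Ng. \<forall>x. trunc N g x = g x" by blast
  moreover have "integrable TM f" "integrable TM g"
    using trig_add by (auto intro: continuous_integrable_TM trig_continuous)
  ultimately show ?case by (intro exI[of _ "max Nf Ng"]) (simp add: trunc_add)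
next
  case (trig_scale f c)
  then obtain N0 where "\<forall>N\<ge>N0. \<forall>x. trunc N f x = f x" by blast
  then show ?case using trunc_scaleR[of _ c f] by (intro exI[of _ N0]) simp
qed

lemma pairing_trunc:
  fixes f g :: "real^3 \<Rightarrow> 'a::euclidean_space"
  assumes g: "integrable TM g"
  shows "pairing (trunc N f) g =
    (1 / (2 * pi) ^ 3) * (\<Sum>k\<in>modes N. \<Sum>\<theta>\<in>{0, pi / 2}. coef k \<theta> f \<bullet> coef k \<theta> g)"
proof -
  have i: "integrable TM (\<lambda>x. coef k \<theta> f \<bullet> (wave k \<theta> x *\<^sub>R g x))" for k \<theta>
    by (intro integrable_inner_right coef_integrable g)
  have "pairing (trunc N f) g = (\<integral>x. (1 / (2 * pi) ^ 3) * (\<Sum>k\<in>modes N. \<Sum>\<theta>\<in>{0, pi / 2}.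
      coef k \<theta> f \<bullet> (wave k \<theta> x *\<^sub>R g x)) \<partial>TM)"
    unfolding pairing_def trunc_def by (simp add: inner_sum_left inner_add_left)
  also have "\<dots> = (1 / (2 * pi) ^ 3) * (\<Sum>k\<in>modes N. \<Sum>\<theta>\<in>{0, pi / 2}.
      (\<integral>x. coef k \<theta> f \<bullet> (wave k \<theta> x *\<^sub>R g x) \<partial>TM))"
    using i by (simp add: Bochner_Integration.integral_sum)
  also have "\<dots> = (1 / (2 * pi) ^ 3) * (\<Sum>k\<in>modes N. \<Sum>\<theta>\<in>{0, pi / 2}. coef k \<theta> f \<bullet> coef k \<theta> g)"
    unfolding coef_def[of _ _ g]
    by (subst integral_inner_right) (auto intro: coef_integrable g)
  finally show ?thesis .
qed

lemma pairing_trunc_trunc: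
  "integrable TM f \<Longrightarrow> integrable TM g \<Longrightarrow> pairing (trunc N f) (trunc N g) = pairing (trunc N f) g"
  unfolding pairing_trunc[OF integrable_trunc] pairing_trunc
  by (intro arg_cong2[of _ _ _ _ "(*)"] sum.cong refl) (simp add: coef_trunc)

lemma N2_trunc_sq: "integrable TM f \<Longrightarrow> (N2 (trunc N f))\<^sup>2 =
    (1 / (2 * pi) ^ 3) * (\<Sum>k\<in>modes N. \<Sum>\<theta>\<in>{0, pi / 2}. (norm (coef k \<theta> f))\<^sup>2)"
  unfolding pairing_self[symmetric] power2_norm_eq_inner
  by (subst pairing_trunc_trunc) (auto simp: pairing_trunc)

lemma N2_trunc_le:
  assumes f: "sq_int f" shows "N2 (trunc N f) \<le> N2 f"
proof -
  have "N2 (trunc N f) * N2 (trunc N f) = pairing (trunc N f) f"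
    using sq_int_integrable[OF f] by (simp add: pairing_trunc_trunc[symmetric] pairing_self power2_eq_square)
  also have "\<dots> \<le> N2 (trunc N f) * N2 f" using pairing_bound[of "trunc N f" f] f by simp
  finally show ?thesis
    using N2_nonneg[of "trunc N f"] N2_nonneg[of f] by (metis less_eq_real_def mult_le_cancel_left_pos)
qed

text \<open>Each truncation is a contraction, and every trigonometric polynomial is fixed by all large ones.\<close>

lemma trunc_tendsto_real:
  fixes f :: "real^3 \<Rightarrow> real"
  assumes f: "sq_int f"
  shows "(\<lambda>N. N2 (\<lambda>x. trunc N f x - f x)) \<longlonglongrightarrow> 0"
proof (rule LIMSEQ_I)
  fix e :: real assume "0 < e"
  then obtain p where p: "p \<in> trig" "N2 (\<lambda>x. f x - p x) < e / 2"
    using trig_dense_L2[OF f, of "e / 2"] by auto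
  obtain N0 where N0: "\<And>N x. N \<ge> N0 \<Longrightarrow> trunc N p x = p x" using trunc_trig[OF p(1)] by blast
  have sp: "sq_int p" by (intro sq_int_continuous trig_continuous p)
  have "N2 (\<lambda>x. trunc N f x - f x) < e" if "N \<ge> N0" for N
  proof -
    have "N2 (\<lambda>x. trunc N f x - f x) \<le> N2 (\<lambda>x. trunc N f x - p x) + N2 (\<lambda>x. p x - f x)"
      by (intro N2_triangle_diff f sp sq_int_trunc)
    also have "(\<lambda>x. trunc N f x - p x) = trunc N (\<lambda>x. f x - p x)"
      using N0[OF that] f sp by (simp add: trunc_diff sq_int_integrable fun_eq_iff)
    also have "N2 (trunc N (\<lambda>x. f x - p x)) \<le> N2 (\<lambda>x. f x - p x)"
      by (intro N2_trunc_le sq_int_diff f sp)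
    finally show ?thesis using p(2) N2_minus[of f p] by simp
  qed
  then show "\<exists>no. \<forall>N\<ge>no. norm (N2 (\<lambda>x. trunc N f x - f x) - 0) < e" by auto
qed

lemma N2_sq_Basis:
  assumes "sq_int f"
  shows "(N2 f)\<^sup>2 = (\<Sum>b\<in>Basis. (N2 (\<lambda>x. f x \<bullet> b))\<^sup>2)"
proof -
  have i: "integrable TM (\<lambda>x. (f x \<bullet> b)\<^sup>2)" if "b \<in> Basis" for b
  proof (rule Bochner_Integration.integrable_bound[OF sq_int_norm_sq[OF assms]])
    have [measurable]: "f \<in> borel_measurable TM" using assms by (simp add: sq_int_def)
    show "(\<lambda>x. (f x \<bullet> b)\<^sup>2) \<in> borel_measurable TM" by measurable
    show "AE x in TM. norm ((f x \<bullet> b)\<^sup>2) \<le> norm ((norm (f x))\<^sup>2)"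
      using Basis_le_norm[OF that] by (simp add: abs_le_square_iff[symmetric])
  qed
  have "(norm (f x))\<^sup>2 = (\<Sum>b\<in>Basis. (f x \<bullet> b)\<^sup>2)" for x
    unfolding power2_norm_eq_inner by (subst euclidean_inner) (simp add: power2_eq_square)
  then show ?thesis using i by (simp add: N2_sq)
qed

lemma sq_int_inner: "sq_int f \<Longrightarrow> sq_int (\<lambda>x. f x \<bullet> b)"
  by (rule sq_int_bound(1)[of "\<lambda>x. norm b *\<^sub>R f x"])
    (use Cauchy_Schwarz_ineq2[of "f _" b] in
      \<open>auto intro!: sq_int_scaleR borel_measurable_inner simp: sq_int_measurable mult.commute\<close>)

theorem trunc_tendsto:
  fixes f :: "real^3 \<Rightarrow> 'a::euclidean_space"
  assumes f: "sq_int f"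
  shows "(\<lambda>N. N2 (\<lambda>x. trunc N f x - f x)) \<longlonglongrightarrow> 0"
proof -
  have "(N2 (\<lambda>x. trunc N f x - f x))\<^sup>2 = (\<Sum>b\<in>Basis. (N2 (\<lambda>x. trunc N (\<lambda>x. f x \<bullet> b) x - f x \<bullet> b))\<^sup>2)" for N
    using f by (simp add: N2_sq_Basis sq_int_diff trunc_inner sq_int_integrable inner_diff_left)
  moreover have "(\<lambda>N. \<Sum>b\<in>(Basis :: 'a set). (N2 (\<lambda>x. trunc N (\<lambda>x. f x \<bullet> b) x - f x \<bullet> b))\<^sup>2) \<longlonglongrightarrow> (\<Sum>b\<in>(Basis :: 'a set). 0\<^sup>2)"
    by (intro tendsto_intros trunc_tendsto_real sq_int_inner f)
  ultimately have "(\<lambda>N. (N2 (\<lambda>x. trunc N f x - f x))\<^sup>2) \<longlonglongrightarrow> 0" by simp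
  from tendsto_real_sqrt[OF this] show ?thesis by simp
qed

section \<open>Weak gradients\<close>

lemma smooth_trunc: "smooth (trunc N f)"
  unfolding trunc_def[abs_def]
  by (intro smooth_scaleR[OF smooth_const] smooth_sum smooth_wave)

lemma grad_nth: "grad f x $ i $ j = frechet_derivative f (at x) (axis j 1) $ i"
  by (simp add: grad_def jacobian_def matrix_def)

lemma periodic_frechet:
  assumes f: "smooth f" and per: "periodic f"
  shows "frechet_derivative f (at (x + axis i (2 * pi))) = frechet_derivative f (at x)"
proof -
  have "(f has_derivative frechet_derivative f (at (x + axis i (2 * pi)))) (at (x + axis i (2 * pi)))"
    using f by (rule smooth_frechet)
  moreover have "((\<lambda>y. y + axis i (2 * pi)) has_derivative (\<lambda>v. v)) (at x)"
    by (auto intro!: derivative_eq_intros)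
  ultimately have "((\<lambda>y. f (y + axis i (2 * pi))) has_derivative frechet_derivative f (at (x + axis i (2 * pi)))) (at x)"
    by (rule has_derivative_compose[rotated])
  then have "(f has_derivative frechet_derivative f (at (x + axis i (2 * pi)))) (at x)"
    using per by (simp add: periodic_def)
  then show ?thesis by (rule frechet_derivative_at)
qed

lemma integration_by_parts_torus:
  fixes f g :: "real^3 \<Rightarrow> real"
  assumes f: "\<And>x. (f has_derivative D x) (at x)" "continuous_on UNIV (\<lambda>x. D x (axis j 1))" "periodic f"
    and g: "\<And>x. (g has_derivative E x) (at x)" "continuous_on UNIV (\<lambda>x. E x (axis j 1))" "periodic g"
  shows "(\<integral>x. f x * E x (axis j 1) \<partial>TM) = - (\<integral>x. D x (axis j 1) * g x \<partial>TM)"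
proof -
  have c: "continuous_on UNIV f" "continuous_on UNIV g"
    using f(1) g(1) by (auto simp: continuous_on_eq_continuous_at intro: has_derivative_continuous)
  have "(\<integral>x. f x * E x (axis j 1) + D x (axis j 1) * g x \<partial>TM) = 0"
    by (rule integral_partial_derivative_zero[of "\<lambda>x. f x * g x" "\<lambda>x v. f x * E x v + D x v * g x"])
      (use f g c in \<open>auto intro!: derivative_eq_intros continuous_intros simp: periodic_def\<close>)
  moreover have "integrable TM (\<lambda>x. f x * E x (axis j 1))" "integrable TM (\<lambda>x. D x (axis j 1) * g x)"
    by (intro continuous_integrable_TM continuous_intros c f g)+
  ultimately show ?thesis by simp
qed

lemma has_derivative_nth: "(f has_derivative D) F \<Longrightarrow> ((\<lambda>x. f x $ i) has_derivative (\<lambda>v. D v $ i)) F"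
  by (rule bounded_linear.has_derivative[OF bounded_linear_vec_nth])

lemma continuous_grad: "smooth f \<Longrightarrow> continuous_on UNIV (\<lambda>x. grad f x)"
  unfolding continuous_on_componentwise[of _ "\<lambda>x. grad f x"]
  by (auto simp: Basis_vec_def inner_axis grad_nth intro!: continuous_intros smooth_frechet(2))

lemma has_weak_grad_smooth:
  assumes f: "smooth f" and per: "periodic f"
  shows "has_weak_grad f (grad f)"
  unfolding has_weak_grad_def
proof (intro conjI allI impI)
  show "periodic (grad f)"
    using periodic_frechet[OF f per] by (simp add: periodic_def grad_def jacobian_def)
  show "integrable TM (grad f)"
    by (intro continuous_integrable_TM) (use continuous_grad[OF f] in simp)
  fix \<psi> :: "real^3 \<Rightarrow> real" and i j :: 3
  assume psi: "smooth \<psi>" "periodic \<psi>"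
  have "(\<integral>x. f x $ i * frechet_derivative \<psi> (at x) (axis j 1) \<partial>TM) =
      - (\<integral>x. frechet_derivative f (at x) (axis j 1) $ i * \<psi> x \<partial>TM)"
    by (rule integration_by_parts_torus)
      (use f per psi in \<open>auto simp: periodic_def intro!: has_derivative_nth smooth_frechet(1,2) continuous_intros\<close>)
  then show "(\<integral>x. f x $ i * frechet_derivative \<psi> (at x) (axis j 1) \<partial>TM) = - (\<integral>x. grad f x $ i $ j * \<psi> x \<partial>TM)"
    by (simp add: grad_nth)
qed

lemma has_weak_grad_integrable: "has_weak_grad f G \<Longrightarrow> integrable TM G"
  by (simp add: has_weak_grad_def)

lemma coef_nth: "integrable TM f \<Longrightarrow> coef k \<theta> f $ i = coef k \<theta> (\<lambda>x. f x $ i)" for f :: "real^3 \<Rightarrow> real^'n"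
  using coef_inner[of f k \<theta> "axis i 1"] by (simp add: inner_axis)

lemma coef_nth2:
  "integrable TM G \<Longrightarrow> coef k \<theta> G $ i $ j = (\<integral>x. wave k \<theta> x * G x $ i $ j \<partial>TM)" for G :: "real^3 \<Rightarrow> real^3^3"
  using coef_inner[of G k \<theta> "axis i (axis j 1)"] by (simp add: inner_axis coef_def)

lemma wave_pi: "wave k (\<theta> + pi / 2 + pi / 2) x = - wave k \<theta> x"
  by (simp add: wave_shift[of k "\<theta> + pi / 2"]) (simp add: wave_def sin_add cos_add)

lemma coef_pi: "coef k (\<theta> + pi / 2 + pi / 2) f = - coef k \<theta> f"
  unfolding coef_def wave_pi by simp

lemma smooth_wave_real: "smooth (wave k \<theta>)"
  using smooth_wave[of k \<theta> "1 :: real"] by simp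

lemma frechet_wave: "frechet_derivative (wave k \<theta>) (at x) v = (freq k \<bullet> v) * wave k (\<theta> + pi / 2) x"
  by (simp add: frechet_derivative_at[OF wave_has_derivative, symmetric])

lemma coef_weak_grad:
  assumes G: "has_weak_grad f G" and f: "integrable TM f"
  shows "coef k \<theta> G $ i $ j = - (freq k $ j) * coef k (\<theta> + pi / 2) f $ i"
proof -
  have "(\<integral>x. f x $ i * frechet_derivative (wave k \<theta>) (at x) (axis j 1) \<partial>TM) = - (\<integral>x. G x $ i $ j * wave k \<theta> x \<partial>TM)"
    using G smooth_wave_real periodic_wave by (simp add: has_weak_grad_def)
  moreover have "(\<integral>x. f x $ i * frechet_derivative (wave k \<theta>) (at x) (axis j 1) \<partial>TM) =
      freq k $ j * coef k (\<theta> + pi / 2) f $ i"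
  proof -
    have "f x $ i * frechet_derivative (wave k \<theta>) (at x) (axis j 1) = freq k $ j * (wave k (\<theta> + pi / 2) x * f x $ i)" for x
      by (simp add: frechet_wave inner_axis)
    then show ?thesis unfolding coef_nth[OF f] unfolding coef_def by (simp only: integral_mult_right_zero real_scaleR_def)
  qed
  ultimately show ?thesis
    using coef_nth2[OF has_weak_grad_integrable[OF G]] by (simp add: mult.commute)
qed

text \<open>
  Waves are admissible test functions, so the Fourier coefficients of a weak gradient are determined by
  those of \<open>f\<close>.
\<close>

lemma has_weak_grad_unique:
  assumes G: "has_weak_grad f G" and G': "has_weak_grad f G'" and f: "integrable TM f"
  shows "AE x in TM. G x = G' x"
proof -
  have i: "integrable TM (\<lambda>x. G x $ i $ j)" if "has_weak_grad f G" for G i j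
  proof -
    have "integrable TM (\<lambda>x. G x \<bullet> axis i (axis j 1))"
      using has_weak_grad_integrable[OF that] by simp
    then show ?thesis by (simp add: inner_axis)
  qed
  have "AE x in TM. G x $ i $ j - G' x $ i $ j = 0" for i j
  proof (rule fourier_uniqueness)
    fix k \<theta>
    have "(\<integral>x. wave k \<theta> x * (G x $ i $ j - G' x $ i $ j) \<partial>TM) = coef k \<theta> G $ i $ j - coef k \<theta> G' $ i $ j"
      using coef_integrable[OF i[OF G, of i j], of k \<theta>] coef_integrable[OF i[OF G', of i j], of k \<theta>]
      by (simp add: coef_nth2 has_weak_grad_integrable[OF G] has_weak_grad_integrable[OF G'] right_diff_distrib)
    then show "(\<integral>x. wave k \<theta> x * (G x $ i $ j - G' x $ i $ j) \<partial>TM) = 0"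
      by (simp add: coef_weak_grad[OF G f] coef_weak_grad[OF G' f])
  qed (intro Bochner_Integration.integrable_diff i G G')
  then have "AE x in TM. \<forall>i j. G x $ i $ j - G' x $ i $ j = 0"
    by (intro eventually_all_finite)
  then show ?thesis by eventually_elim (simp add: vec_eq_iff)
qed

lemma frechet_trunc:
  "frechet_derivative (trunc N f) (at x) v = (1 / (2 * pi) ^ 3) *\<^sub>R
    (\<Sum>k\<in>modes N. \<Sum>\<theta>\<in>{0, pi / 2}. ((freq k \<bullet> v) * wave k (\<theta> + pi / 2) x) *\<^sub>R coef k \<theta> f)"
proof -
  have "(trunc N f has_derivative (\<lambda>v. (1 / (2 * pi) ^ 3) *\<^sub>R
    (\<Sum>k\<in>modes N. \<Sum>\<theta>\<in>{0, pi / 2}. ((freq k \<bullet> v) * wave k (\<theta> + pi / 2) x) *\<^sub>R coef k \<theta> f))) (at x)"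
    unfolding trunc_def[abs_def]
    by (intro has_derivative_scaleR_right has_derivative_sum has_derivative_scaleR_left wave_has_derivative)
  from frechet_derivative_at[OF this, symmetric] show ?thesis by simp
qed

text \<open>
  Differentiating a wave of phase \<open>0\<close> gives one of phase \<open>\<pi>/2\<close> and conversely, which matches the phase
  shift in \<open>coef_weak_grad\<close>.
\<close>

lemma grad_trunc:
  assumes G: "has_weak_grad f G" and f: "integrable TM f"
  shows "grad (trunc N f) x = trunc N G x"
proof -
  have "grad (trunc N f) x $ i $ j = trunc N G x $ i $ j" for i j
  proof -
    have "(\<Sum>\<theta>\<in>{0, pi / 2}. freq k $ j * wave k (\<theta> + pi / 2) x * coef k \<theta> f $ i) =
        (\<Sum>\<theta>\<in>{0, pi / 2}. wave k \<theta> x * coef k \<theta> G $ i $ j)" for k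
    proof -
      have S: "(\<Sum>\<theta>\<in>{0, pi / 2}. h \<theta>) = h 0 + h (pi / 2)" for h :: "real \<Rightarrow> real" by simp
      show ?thesis
        unfolding S coef_weak_grad[OF G f]
        using wave_pi[of k 0 x] coef_pi[of k 0 f] by simp
    qed
    then show ?thesis
      unfolding grad_nth frechet_trunc trunc_def vector_scaleR_component sum_component inner_axis
      by (simp only: real_scaleR_def inner_real_def mult_1_right)
  qed
  then show ?thesis by (simp add: vec_eq_iff)
qed

lemma trunc_trunc: "integrable TM f \<Longrightarrow> N \<le> M \<Longrightarrow> trunc N (trunc M f) = trunc N f"
  unfolding trunc_def[of N, abs_def] using modes_mono[of N M]
  by (intro ext arg_cong2[of _ _ _ _ scaleR] sum.cong refl) (auto simp: coef_trunc subset_iff)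

text \<open>
  The gradients of the truncations are the truncations of one another, hence their increments are
  orthogonal.
\<close>

lemma grad_trunc_trunc:
  assumes f: "integrable TM f" and "N \<le> M"
  shows "grad (trunc N f) = trunc N (grad (trunc M f))"
  using grad_trunc[OF has_weak_grad_smooth[OF smooth_trunc periodic_trunc], of M f N] trunc_trunc[OF f \<open>N \<le> M\<close>]
  by auto

section \<open>Sobolev norms\<close>

lemma Lp_space_2: "f \<in> Lp_space 2 \<longleftrightarrow> periodic f \<and> sq_int f"
  by (auto simp: Lp_space_def sq_int_def powr_two)

lemma norm_fourier_coeff:
  assumes f: "integrable TM f"
  shows "(norm (fourier_coeff f k))\<^sup>2 = (1 / (2 * pi) ^ 3)\<^sup>2 * (\<Sum>\<theta>\<in>{0, pi / 2}. (norm (coef k \<theta> f))\<^sup>2)"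
proof -
  have fi: "integrable TM (\<lambda>x. f x $ i)" for i
  proof -
    have "integrable TM (\<lambda>x. f x \<bullet> axis i 1)" using f by simp
    then show ?thesis by (simp add: inner_axis)
  qed
  have "fourier_coeff f k $ i = complex_of_real (1 / (2 * pi) ^ 3) * Complex (coef k 0 f $ i) (coef k (pi / 2) f $ i)" for i
  proof -
    have dot: "(\<Sum>j\<in>UNIV. real_of_int (k $ j) * x $ j) = freq k \<bullet> x" for x
      by (simp add: freq_def inner_vec_def)
    have "complex_of_real (f x $ i) * cis (- (\<Sum>j\<in>UNIV. real_of_int (k $ j) * x $ j)) =
        complex_of_real (wave k 0 x * f x $ i) + \<i> * complex_of_real (wave k (pi / 2) x * f x $ i)" for x
      unfolding dot by (simp add: complex_eq_iff wave_def cos_add)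
    then have "(\<integral>x. complex_of_real (f x $ i) * cis (- (\<Sum>j\<in>UNIV. real_of_int (k $ j) * x $ j)) \<partial>TM) =
        complex_of_real (coef k 0 f $ i) + \<i> * complex_of_real (coef k (pi / 2) f $ i)"
      using coef_integrable[OF fi[of i], of k 0] coef_integrable[OF fi[of i], of k "pi / 2"]
      unfolding coef_nth[OF f] unfolding coef_def by (simp del: of_real_mult)
    then show ?thesis by (simp add: fourier_coeff_def Complex_eq)
  qed
  then have "(norm (fourier_coeff f k $ i))\<^sup>2 =
      (1 / (2 * pi) ^ 3)\<^sup>2 * ((coef k 0 f $ i)\<^sup>2 + (coef k (pi / 2) f $ i)\<^sup>2)" for i
    by (simp only: norm_mult power_mult_distrib norm_of_real cmod_power2 complex.sel power2_abs)
  then show ?thesis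
    by (simp add: norm_sq_vec sum_distrib_left sum.distrib distrib_left)
qed

definition Hs_mult :: "real \<Rightarrow> int^3 \<Rightarrow> real" where
  "Hs_mult s k = 1 + norm (freq k) powr (2 * s)"

lemma Hs_weight_coef:
  assumes f: "integrable TM f"
  shows "(2 * pi) ^ 3 * Hs_weight s f k =
    (1 / (2 * pi) ^ 3) * (Hs_mult s k * (\<Sum>\<theta>\<in>{0, pi / 2}. (norm (coef k \<theta> f))\<^sup>2))"
  unfolding Hs_weight_def norm_fourier_coeff[OF f] Hs_mult_def freq_def
  by (simp add: power2_eq_square field_simps flip: power_add)

lemma Hs_weight_nonneg: "0 \<le> Hs_weight s f k"
  by (simp add: Hs_weight_def)

lemma Hs_norm_nonneg [simp]: "0 \<le> Hs_norm s f"
  by (simp add: Hs_norm_def infsum_nonneg Hs_weight_nonneg)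

lemma Hs_norm_sq_bound:
  assumes f: "f \<in> Hs_space s" and F: "finite F"
  shows "(1 / (2 * pi) ^ 3) * (\<Sum>k\<in>F. Hs_mult s k * (\<Sum>\<theta>\<in>{0, pi / 2}. (norm (coef k \<theta> f))\<^sup>2)) \<le> (Hs_norm s f)\<^sup>2"
proof -
  have i: "integrable TM f" using f by (auto simp: Hs_space_def Lp_space_2 sq_int_integrable)
  have "(1 / (2 * pi) ^ 3) * (\<Sum>k\<in>F. Hs_mult s k * (\<Sum>\<theta>\<in>{0, pi / 2}. (norm (coef k \<theta> f))\<^sup>2)) =
      (2 * pi) ^ 3 * (\<Sum>k\<in>F. Hs_weight s f k)"
    unfolding sum_distrib_left Hs_weight_coef[OF i] by (simp add: sum_distrib_left)
  also have "\<dots> \<le> (2 * pi) ^ 3 * (\<Sum>\<^sub>\<infinity>k. Hs_weight s f k)"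
    using f F by (intro mult_left_mono finite_sum_le_infsum) (auto simp: Hs_space_def Hs_weight_nonneg)
  also have "\<dots> = (Hs_norm s f)\<^sup>2"
    unfolding Hs_norm_def by (subst real_sqrt_pow2) (auto intro!: mult_nonneg_nonneg infsum_nonneg Hs_weight_nonneg)
  finally show ?thesis .
qed

lemma Hs_space_sq_int: "f \<in> Hs_space s \<Longrightarrow> sq_int f" "f \<in> Hs_space s \<Longrightarrow> periodic f"
  by (auto simp: Hs_space_def Lp_space_2)

lemma N2_le_Hs_norm:
  assumes f: "f \<in> Hs_space s" shows "N2 f \<le> Hs_norm s f"
proof (rule LIMSEQ_le_const2[OF N2_tendsto[OF sq_int_trunc _ trunc_tendsto]])
  show "sq_int f" "sq_int f" using f by (auto simp: Hs_space_sq_int)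
  have "N2 (trunc N f) \<le> Hs_norm s f" for N
  proof (rule power2_le_imp_le)
    have "(N2 (trunc N f))\<^sup>2 \<le> (1 / (2 * pi) ^ 3) * (\<Sum>k\<in>modes N. Hs_mult s k * (\<Sum>\<theta>\<in>{0, pi / 2}. (norm (coef k \<theta> f))\<^sup>2))"
      unfolding N2_trunc_sq[OF sq_int_integrable[OF Hs_space_sq_int(1)[OF f]]]
    proof (intro mult_left_mono sum_mono)
      fix k :: "int^3"
      have "1 * (\<Sum>\<theta>\<in>{0, pi / 2}. (norm (coef k \<theta> f))\<^sup>2) \<le> Hs_mult s k * (\<Sum>\<theta>\<in>{0, pi / 2}. (norm (coef k \<theta> f))\<^sup>2)"
        by (intro mult_right_mono) (auto simp: Hs_mult_def)
      then show "(\<Sum>\<theta>\<in>{0, pi / 2}. (norm (coef k \<theta> f))\<^sup>2) \<le> Hs_mult s k * (\<Sum>\<theta>\<in>{0, pi / 2}. (norm (coef k \<theta> f))\<^sup>2)"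
        by simp
    qed simp
    also have "\<dots> \<le> (Hs_norm s f)\<^sup>2" by (rule Hs_norm_sq_bound[OF f finite_modes])
    finally show "(N2 (trunc N f))\<^sup>2 \<le> (Hs_norm s f)\<^sup>2" .
  qed simp
  then show "\<exists>N. \<forall>n\<ge>N. N2 (trunc n f) \<le> Hs_norm s f" by blast
qed

text \<open>Parseval's identity for the gradient of a truncation.\<close>

lemma N2_grad_trunc_sq:
  assumes f: "integrable TM f"
  shows "(N2 (grad (trunc N f)))\<^sup>2 =
    (1 / (2 * pi) ^ 3) * (\<Sum>k\<in>modes N. (norm (freq k))\<^sup>2 * (\<Sum>\<theta>\<in>{0, pi / 2}. (norm (coef k \<theta> f))\<^sup>2))"
proof -
  have wg: "has_weak_grad (trunc N f) (grad (trunc N f))"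
    by (intro has_weak_grad_smooth smooth_trunc periodic_trunc)
  have e: "grad (trunc N f) = trunc N (grad (trunc N f))"
    by (rule grad_trunc_trunc[OF f order_refl])
  have gi: "integrable TM (grad (trunc N f))" using wg by (rule has_weak_grad_integrable)
  have nc: "(norm (coef k \<theta> (grad (trunc N f))))\<^sup>2 = (norm (freq k))\<^sup>2 * (norm (coef k (\<theta> + pi / 2) f))\<^sup>2"
    if "k \<in> modes N" for k \<theta>
  proof -
    have "coef k \<theta> (grad (trunc N f)) $ i $ j = - freq k $ j * coef k (\<theta> + pi / 2) f $ i" for i j
      unfolding coef_weak_grad[OF wg integrable_trunc] coef_trunc[OF f that] by simp
    then have "(norm (coef k \<theta> (grad (trunc N f)) $ i))\<^sup>2 = (norm (freq k))\<^sup>2 * (coef k (\<theta> + pi / 2) f $ i)\<^sup>2" for i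
      by (simp add: norm_sq_vec[of "coef _ _ _ $ _"] norm_sq_vec[of "freq _"] power_mult_distrib sum_distrib_right)
    then show ?thesis
      by (simp add: norm_sq_vec[of "coef k \<theta> _"] norm_sq_vec[of "coef k (\<theta> + pi / 2) f"] sum_distrib_left)
  qed
  have ns: "(\<Sum>\<theta>\<in>{0, pi / 2}. (norm (coef k (\<theta> + pi / 2) f))\<^sup>2) = (\<Sum>\<theta>\<in>{0, pi / 2}. (norm (coef k \<theta> f))\<^sup>2)" for k
    using coef_pi[of k 0 f] by simp
  have "(N2 (grad (trunc N f)))\<^sup>2 = (1 / (2 * pi) ^ 3) * (\<Sum>k\<in>modes N. \<Sum>\<theta>\<in>{0, pi / 2}. (norm (coef k \<theta> (grad (trunc N f))))\<^sup>2)"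
    by (subst e) (rule N2_trunc_sq[OF gi])
  also have "\<dots> = (1 / (2 * pi) ^ 3) * (\<Sum>k\<in>modes N. (norm (freq k))\<^sup>2 * (\<Sum>\<theta>\<in>{0, pi / 2}. (norm (coef k (\<theta> + pi / 2) f))\<^sup>2))"
    unfolding sum_distrib_left[of "(norm (freq _))\<^sup>2"]
    by (intro arg_cong2[of _ _ _ _ "(*)"] sum.cong refl nc)
  finally show ?thesis unfolding ns .
qed

text \<open>
  By orthogonality of increments the gradients \<open>g N\<close> of the truncations satisfy
  \<open>\<parallel>g M - g N\<parallel>\<^sup>2 = \<parallel>g M\<parallel>\<^sup>2 - \<parallel>g N\<parallel>\<^sup>2\<close>, and the norms on the right are bounded by the \<open>H\<^sup>1\<close> norm.  So
  \<open>g N\<close> is a Cauchy sequence, and integration by parts passes to its limit.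
\<close>

lemma weak_grad_exists:
  assumes f: "f \<in> Hs_space 1"
  shows "\<exists>G. has_weak_grad f G \<and> sq_int G \<and> N2 G \<le> Hs_norm 1 f"
proof -
  have sf: "sq_int f" using f by (rule Hs_space_sq_int)
  then have fi: "integrable TM f" by (rule sq_int_integrable)
  define g where "g N = grad (trunc N f)" for N
  have gs: "sq_int (g N)" for N
    unfolding g_def by (rule sq_int_continuous) (use continuous_grad[OF smooth_trunc, of N f] in simp)
  have gwg: "has_weak_grad (trunc N f) (g N)" for N
    unfolding g_def by (intro has_weak_grad_smooth smooth_trunc periodic_trunc)
  have gN: "N2 (g N) \<le> Hs_norm 1 f" for N
  proof (rule power2_le_imp_le)
    have "(N2 (g N))\<^sup>2 \<le> (1 / (2 * pi) ^ 3) * (\<Sum>k\<in>modes N. Hs_mult 1 k * (\<Sum>\<theta>\<in>{0, pi / 2}. (norm (coef k \<theta> f))\<^sup>2))"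
      unfolding g_def N2_grad_trunc_sq[OF fi]
    proof (intro mult_left_mono sum_mono mult_right_mono)
      show "(norm (freq k))\<^sup>2 \<le> Hs_mult 1 k" for k by (simp add: Hs_mult_def powr_two)
    qed (auto intro!: sum_nonneg)
    also have "\<dots> \<le> (Hs_norm 1 f)\<^sup>2" by (rule Hs_norm_sq_bound[OF f finite_modes])
    finally show "(N2 (g N))\<^sup>2 \<le> (Hs_norm 1 f)\<^sup>2" .
  qed simp
  have diff: "(N2 (\<lambda>x. g M x - g N x))\<^sup>2 = (N2 (g M))\<^sup>2 - (N2 (g N))\<^sup>2" if "N \<le> M" for M N
  proof -
    have e: "g N = trunc N (g M)" unfolding g_def by (rule grad_trunc_trunc[OF fi that])
    have "pairing (g M) (g N) = (N2 (g N))\<^sup>2"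
      using pairing_trunc_trunc[of "g M" "g M" N] has_weak_grad_integrable[OF gwg] pairing_commute[of "g M" "g N"]
      by (simp add: e[symmetric] pairing_self)
    then show ?thesis by (simp add: N2_diff_sq gs)
  qed
  define a where "a N = (N2 (g N))\<^sup>2" for N
  have amono: "incseq a"
    unfolding incseq_def a_def
  proof (intro allI impI)
    fix M N :: nat assume "M \<le> N"
    then show "(N2 (g M))\<^sup>2 \<le> (N2 (g N))\<^sup>2"
      using diff[of M N] zero_le_power2[of "N2 (\<lambda>x. g N x - g M x)"] by linarith
  qed
  have "a N \<le> (Hs_norm 1 f)\<^sup>2" for N unfolding a_def using gN by (intro power_mono) auto
  then obtain L where L: "a \<longlonglongrightarrow> L" using incseq_convergent[OF amono] by metis
  have aL: "a N \<le> L" for N using incseq_le[OF amono L] .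
  have "\<exists>G. sq_int G \<and> periodic G \<and> (\<lambda>n. N2 (\<lambda>x. g n x - G x)) \<longlonglongrightarrow> 0"
  proof (rule L2_complete[OF gs])
    show "periodic (g n)" for n using gwg by (simp add: has_weak_grad_def)
    fix e :: real assume "0 < e"
    then have "\<forall>\<^sub>F n in sequentially. L - e\<^sup>2 < a n" using L by (intro order_tendstoD) auto
    then obtain N0 where N0: "\<And>n. n \<ge> N0 \<Longrightarrow> L - e\<^sup>2 < a n" by (auto simp: eventually_sequentially)
    have le: "N2 (\<lambda>x. g m x - g n x) < e" if "n \<ge> N0" "n \<le> m" for m n
    proof (rule power2_less_imp_less)
      show "(N2 (\<lambda>x. g m x - g n x))\<^sup>2 < e\<^sup>2"
        using diff[OF that(2)] N0[OF that(1)] aL[of m] by (simp add: a_def)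
    qed (use \<open>0 < e\<close> in simp)
    have "N2 (\<lambda>x. g m x - g n x) < e" if "m \<ge> N0" "n \<ge> N0" for m n
      using le[of n m] le[of m n] that N2_minus[of "g m" "g n"] by (cases "n \<le> m") auto
    then show "\<exists>N. \<forall>m\<ge>N. \<forall>n\<ge>N. N2 (\<lambda>x. g m x - g n x) < e" by blast
  qed
  then obtain G where G: "sq_int G" "periodic G" "(\<lambda>n. N2 (\<lambda>x. g n x - G x)) \<longlonglongrightarrow> 0" by blast
  have nth_lim: "(\<lambda>n. N2 (\<lambda>x. F n x $ i - H x $ i)) \<longlonglongrightarrow> 0"
    if "(\<lambda>n. N2 (\<lambda>x. F n x - H x)) \<longlonglongrightarrow> 0" "\<And>n. sq_int (F n)" "sq_int H"
    for F :: "nat \<Rightarrow> real^3 \<Rightarrow> 'b::euclidean_space^3" and H i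
  proof (rule Lim_null_comparison[OF _ that(1)])
    show "\<forall>\<^sub>F n in sequentially. norm (N2 (\<lambda>x. F n x $ i - H x $ i)) \<le> N2 (\<lambda>x. F n x - H x)"
    proof (intro always_eventually allI)
      fix n
      have "sq_int (\<lambda>x. F n x - H x)" using that by (intro sq_int_diff)
      from sq_int_bound(2)[OF this, of "\<lambda>x. (F n x - H x) $ i"]
      show "norm (N2 (\<lambda>x. F n x $ i - H x $ i)) \<le> N2 (\<lambda>x. F n x - H x)"
        using sq_int_measurable[OF sq_int_nth[OF \<open>sq_int (\<lambda>x. F n x - H x)\<close>, of i]]
        by (simp add: Finite_Cartesian_Product.norm_nth_le flip: vector_minus_component)
    qed
  qed
  have "has_weak_grad f G"
    unfolding has_weak_grad_def
  proof (intro conjI allI impI)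
    fix \<psi> :: "real^3 \<Rightarrow> real" and i j :: 3
    assume psi: "smooth \<psi>" "periodic \<psi>"
    have s1: "sq_int (\<lambda>x. frechet_derivative \<psi> (at x) (axis j 1))" "sq_int \<psi>"
      using psi by (auto intro: sq_int_continuous[OF smooth_frechet(2)] sq_int_continuous[OF smooth_frechet(3)])
    have z: "(\<lambda>n. N2 (\<lambda>x. p x - p x)) \<longlonglongrightarrow> 0" for p :: "real^3 \<Rightarrow> real" by (simp add: N2_eq)
    have 1: "(\<lambda>n. pairing (\<lambda>x. trunc n f x $ i) (\<lambda>x. frechet_derivative \<psi> (at x) (axis j 1)))
        \<longlonglongrightarrow> pairing (\<lambda>x. f x $ i) (\<lambda>x. frechet_derivative \<psi> (at x) (axis j 1))"
      by (intro pairing_tendsto nth_lim trunc_tendsto sf sq_int_nth sq_int_trunc s1 z)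
    have 2: "(\<lambda>n. - pairing (\<lambda>x. g n x $ i $ j) \<psi>) \<longlonglongrightarrow> - pairing (\<lambda>x. G x $ i $ j) \<psi>"
      by (intro tendsto_minus pairing_tendsto nth_lim G gs sq_int_nth s1 z)
    have "pairing (\<lambda>x. trunc n f x $ i) (\<lambda>x. frechet_derivative \<psi> (at x) (axis j 1)) = - pairing (\<lambda>x. g n x $ i $ j) \<psi>" for n
      using gwg[of n] psi by (simp add: has_weak_grad_def pairing_def)
    then have "pairing (\<lambda>x. f x $ i) (\<lambda>x. frechet_derivative \<psi> (at x) (axis j 1)) = - pairing (\<lambda>x. G x $ i $ j) \<psi>"
      using LIMSEQ_unique[OF 1] 2 by simp
    then show "(\<integral>x. f x $ i * frechet_derivative \<psi> (at x) (axis j 1) \<partial>TM) = - (\<integral>x. G x $ i $ j * \<psi> x \<partial>TM)"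
      by (simp add: pairing_def)
  qed (use G in \<open>auto intro: sq_int_integrable\<close>)
  moreover have "N2 G \<le> Hs_norm 1 f"
    by (rule LIMSEQ_le_const2[OF N2_tendsto[OF gs G(1,3)]]) (use gN in auto)
  ultimately show ?thesis using G(1) by blast
qed

lemma weak_grad:
  assumes f: "f \<in> Hs_space 1"
  shows "has_weak_grad f (weak_grad f)" and "sq_int (weak_grad f)" and "N2 (weak_grad f) \<le> Hs_norm 1 f"
proof -
  obtain G where G: "has_weak_grad f G" "sq_int G" "N2 G \<le> Hs_norm 1 f" using weak_grad_exists[OF f] by blast
  show w: "has_weak_grad f (weak_grad f)" unfolding weak_grad_def by (rule someI[of "has_weak_grad f"], rule G(1))
  have ae: "AE x in TM. weak_grad f x = G x"
    by (rule has_weak_grad_unique[OF w G(1)]) (use f in \<open>auto intro: sq_int_integrable Hs_space_sq_int\<close>)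
  have m: "weak_grad f \<in> borel_measurable TM" using has_weak_grad_integrable[OF w] by simp
  have "AE x in TM. norm (weak_grad f x) \<le> norm (G x)" using ae by eventually_elim simp
  from sq_int_bound[OF G(2) m this] show "sq_int (weak_grad f)" "N2 (weak_grad f) \<le> Hs_norm 1 f"
    using G(3) by auto
qed

lemma grad_trunc_tendsto:
  assumes f: "f \<in> Hs_space 1"
  shows "(\<lambda>N. N2 (\<lambda>x. grad (trunc N f) x - weak_grad f x)) \<longlonglongrightarrow> 0"
  using trunc_tendsto[OF weak_grad(2)[OF f]] grad_trunc[OF weak_grad(1)[OF f]] sq_int_integrable[OF Hs_space_sq_int(1)[OF f]]
  by simp

lemma N2_grad_trunc_le:
  assumes f: "f \<in> Hs_space 1"
  shows "N2 (grad (trunc N f)) \<le> N2 (weak_grad f)" and "sq_int (grad (trunc N f))"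
proof -
  have e: "grad (trunc N f) = trunc N (weak_grad f)"
    using grad_trunc[OF weak_grad(1)[OF f]] sq_int_integrable[OF Hs_space_sq_int(1)[OF f]] by auto
  show "N2 (grad (trunc N f)) \<le> N2 (weak_grad f)"
    unfolding e by (rule N2_trunc_le[OF weak_grad(2)[OF f]])
  show "sq_int (grad (trunc N f))" unfolding e by simp
qed

lemma Hs_space_diff:
  assumes f: "f \<in> Hs_space s" and g: "g \<in> Hs_space s"
  shows "(\<lambda>x. f x - g x) \<in> Hs_space s"
proof -
  have sf: "sq_int f" "sq_int g" using f g by (auto simp: Hs_space_sq_int)
  then have i: "integrable TM f" "integrable TM g" by (auto intro: sq_int_integrable)
  have p: "periodic (\<lambda>x. f x - g x)" using Hs_space_sq_int(2)[OF f] Hs_space_sq_int(2)[OF g] by (simp add: periodic_def)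
  have le: "Hs_weight s (\<lambda>x. f x - g x) k \<le> 2 * Hs_weight s f k + 2 * Hs_weight s g k" for k
  proof -
    define c :: real where "c = (2 * pi) ^ 3"
    define h where "h = (1 / c) * Hs_mult s k"
    have cpos: "0 < c" and h: "0 \<le> h" by (auto simp: c_def h_def Hs_mult_def intro!: mult_nonneg_nonneg add_nonneg_nonneg)
    have n: "(norm (a - b))\<^sup>2 \<le> 2 * (norm a)\<^sup>2 + 2 * (norm b)\<^sup>2" for a b :: "real^3"
      using zero_le_power2[of "norm (a + b)"]
      by (simp add: power2_norm_eq_inner inner_add_left inner_add_right inner_diff_left inner_diff_right inner_commute)
    have "(\<Sum>\<theta>\<in>{0, pi / 2}. (norm (coef k \<theta> (\<lambda>x. f x - g x)))\<^sup>2) \<le>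
        (\<Sum>\<theta>\<in>{0, pi / 2}. 2 * (norm (coef k \<theta> f))\<^sup>2 + 2 * (norm (coef k \<theta> g))\<^sup>2)"
      unfolding coef_diff[OF i] by (intro sum_mono n)
    then have "h * (\<Sum>\<theta>\<in>{0, pi / 2}. (norm (coef k \<theta> (\<lambda>x. f x - g x)))\<^sup>2) \<le>
        h * (2 * (\<Sum>\<theta>\<in>{0, pi / 2}. (norm (coef k \<theta> f))\<^sup>2) + 2 * (\<Sum>\<theta>\<in>{0, pi / 2}. (norm (coef k \<theta> g))\<^sup>2))"
      using h by (intro mult_left_mono) auto
    then have "c * Hs_weight s (\<lambda>x. f x - g x) k \<le> 2 * (c * Hs_weight s f k) + 2 * (c * Hs_weight s g k)"
      unfolding Hs_weight_coef[OF i(1), folded c_def] Hs_weight_coef[OF i(2), folded c_def]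
        Hs_weight_coef[OF Bochner_Integration.integrable_diff[OF i], folded c_def]
      by (simp add: h_def algebra_simps)
    then have "c * Hs_weight s (\<lambda>x. f x - g x) k \<le> c * (2 * Hs_weight s f k + 2 * Hs_weight s g k)"
      by (simp add: algebra_simps)
    then show ?thesis using cpos by simp
  qed
  have "(\<lambda>k. 2 * Hs_weight s f k + 2 * Hs_weight s g k) summable_on UNIV"
    using f g by (intro summable_on_add summable_on_cmult_right) (auto simp: Hs_space_def)
  then have "Hs_weight s (\<lambda>x. f x - g x) summable_on UNIV"
    by (rule summable_on_comparison_test) (auto simp: le Hs_weight_nonneg)
  then show ?thesis using p sf by (simp add: Hs_space_def Lp_space_2 sq_int_diff)
qed

lemma weak_grad_diff:
  assumes f: "f \<in> Hs_space 1" and g: "g \<in> Hs_space 1"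
  shows "AE x in TM. weak_grad (\<lambda>x. f x - g x) x = weak_grad f x - weak_grad g x"
proof (rule has_weak_grad_unique)
  have sf: "sq_int f" "sq_int g" using f g by (auto simp: Hs_space_sq_int)
  show "has_weak_grad (\<lambda>x. f x - g x) (weak_grad (\<lambda>x. f x - g x))"
    by (intro weak_grad Hs_space_diff f g)
  show "integrable TM (\<lambda>x. f x - g x)" by (intro sq_int_integrable sq_int_diff sf)
  show "has_weak_grad (\<lambda>x. f x - g x) (\<lambda>x. weak_grad f x - weak_grad g x)"
    unfolding has_weak_grad_def
  proof (intro conjI allI impI)
    show "periodic (\<lambda>x. weak_grad f x - weak_grad g x)"
      using weak_grad(1)[OF f] weak_grad(1)[OF g] by (simp add: has_weak_grad_def periodic_def)
    show "integrable TM (\<lambda>x. weak_grad f x - weak_grad g x)"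
      by (intro sq_int_integrable sq_int_diff weak_grad f g)
    fix \<psi> :: "real^3 \<Rightarrow> real" and i j :: 3
    assume psi: "smooth \<psi>" "periodic \<psi>"
    have s1: "sq_int (\<lambda>x. frechet_derivative \<psi> (at x) (axis j 1))" "sq_int \<psi>"
      using psi by (auto intro: sq_int_continuous[OF smooth_frechet(2)] sq_int_continuous[OF smooth_frechet(3)])
    have n: "sq_int (\<lambda>x. f x $ i)" "sq_int (\<lambda>x. g x $ i)" "sq_int (\<lambda>x. weak_grad f x $ i $ j)" "sq_int (\<lambda>x. weak_grad g x $ i $ j)"
      by (intro sq_int_nth sf weak_grad f g)+
    have "pairing (\<lambda>x. f x $ i - g x $ i) (\<lambda>x. frechet_derivative \<psi> (at x) (axis j 1)) =
        - pairing (\<lambda>x. weak_grad f x $ i $ j - weak_grad g x $ i $ j) \<psi>"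
      unfolding pairing_diff_left[OF n(1,2) s1(1)] pairing_diff_left[OF n(3,4) s1(2)]
      using weak_grad(1)[OF f] weak_grad(1)[OF g] psi by (simp add: has_weak_grad_def pairing_def)
    then show "(\<integral>x. (f x - g x) $ i * frechet_derivative \<psi> (at x) (axis j 1) \<partial>TM) =
        - (\<integral>x. (weak_grad f x - weak_grad g x) $ i $ j * \<psi> x \<partial>TM)"
      by (simp add: pairing_def)
  qed
qed

section \<open>Bounded functions in $H^2$\<close>

text \<open>
  The sum over \<open>\<int>\<^sup>3\<close> is dominated by a product of three one-dimensional sums of
  \<open>(1 + n\<^sup>2)\<^bsup>-2/3\<^esup>\<close>.
\<close>

lemma inverse_Hs_mult_2_sum_bounded:
  "\<exists>Z. \<forall>F. finite F \<longrightarrow> (\<Sum>k\<in>F. 1 / Hs_mult 2 k) \<le> Z"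
proof -
  define b :: "int \<Rightarrow> real" where "b n = (1 + (real_of_int n)\<^sup>2) powr (- 2 / 3)" for n
  have b0: "0 \<le> b n" for n by (simp add: b_def)
  have le: "1 / Hs_mult 2 k \<le> 2 * (\<Prod>j\<in>UNIV. b (k $ j))" for k
  proof -
    define q where "q = (norm (freq k))\<^sup>2"
    define P where "P = (\<Prod>j\<in>UNIV. 1 + (real_of_int (k $ j))\<^sup>2)"
    have q0: "0 \<le> q" by (simp add: q_def)
    have P1: "1 \<le> P" unfolding P_def by (intro prod_ge_1) auto
    have "(real_of_int (k $ j))\<^sup>2 \<le> q" for j
    proof -
      have "(freq k $ j)\<^sup>2 \<le> (\<Sum>i\<in>UNIV. (freq k $ i)\<^sup>2)" by (rule member_le_sum) auto
      then show ?thesis by (simp add: q_def norm_sq_vec freq_def)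
    qed
    then have "P \<le> (\<Prod>j\<in>(UNIV :: 3 set). 1 + q)"
      unfolding P_def by (intro prod_mono) (auto intro: add_nonneg_nonneg)
    then have P: "P \<le> (1 + q) ^ 3" by simp
    have m: "Hs_mult 2 k = 1 + q\<^sup>2"
    proof -
      have "norm (freq k) powr (2 * 2) = (norm (freq k)) ^ 4"
        by (cases "norm (freq k) = 0") (auto simp: powr_numeral)
      also have "\<dots> = q\<^sup>2" by (simp add: q_def flip: power_mult)
      finally show ?thesis by (simp add: Hs_mult_def)
    qed
    have "P powr (2 / 3) \<le> ((1 + q) ^ 3) powr (2 / 3)"
      using P P1 by (intro powr_mono2) auto
    also have "\<dots> = ((1 + q) powr 3) powr (2 / 3)" using q0 by (simp add: powr_numeral)
    also have "\<dots> = (1 + q)\<^sup>2" using q0 by (subst powr_powr) (simp add: powr_numeral)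
    also have "\<dots> \<le> 2 * Hs_mult 2 k"
      using sum_squares_bound[of 1 q] by (simp add: m power2_sum)
    finally have "P powr (2 / 3) \<le> 2 * Hs_mult 2 k" .
    then have "1 / Hs_mult 2 k \<le> 2 * (1 / P powr (2 / 3))"
      using P1 q0 by (simp add: field_simps m add_pos_nonneg)
    also have "1 / P powr (2 / 3) = P powr (- 2 / 3)" by (simp add: powr_minus_divide)
    also have "P powr (- 2 / 3) = (\<Prod>j\<in>UNIV. b (k $ j))"
      unfolding P_def b_def by (rule prod_powr_distrib)
    finally show ?thesis .
  qed
  have "summable (\<lambda>n. b (int n))"
  proof (rule summable_comparison_test_ev)
    show "\<forall>\<^sub>F n in sequentially. norm (b (int n)) \<le> real n powr (- 4 / 3)"
      using eventually_gt_at_top[of 0]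
    proof eventually_elim
      case (elim n)
      have "b (int n) \<le> ((real n)\<^sup>2) powr (- 2 / 3)"
        unfolding b_def using elim by (intro powr_mono2') auto
      also have "\<dots> = (real n powr 2) powr (- 2 / 3)" using elim by (simp add: powr_numeral)
      also have "\<dots> = real n powr (- 4 / 3)" by (subst powr_powr) simp
      finally show ?case using b0 by simp
    qed
    show "summable (\<lambda>n. real n powr (- 4 / 3))" by (simp add: summable_real_powr_iff)
  qed
  define B where "B = 2 * (\<Sum>n. b (int n))"
  have bsum: "(\<Sum>n\<in>{- int N..int N}. b n) \<le> B" for N
  proof -
    have sub: "{- int N..int N} \<subseteq> int ` {..N} \<union> (\<lambda>n. - int n) ` {..N}"
    proof
      fix x assume x: "x \<in> {- int N..int N}"
      show "x \<in> int ` {..N} \<union> (\<lambda>n. - int n) ` {..N}"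
      proof (cases "0 \<le> x")
        case True
        then have "x = int (nat x)" "nat x \<in> {..N}" using x by auto
        then show ?thesis by blast
      next
        case False
        then have "x = - int (nat (- x))" "nat (- x) \<in> {..N}" using x by auto
        then show ?thesis by blast
      qed
    qed
    have "(\<Sum>n\<in>{- int N..int N}. b n) \<le> (\<Sum>n\<in>int ` {..N} \<union> (\<lambda>n. - int n) ` {..N}. b n)"
      by (rule sum_mono2[OF _ sub]) (auto simp: b0)
    also have "\<dots> \<le> (\<Sum>n\<in>int ` {..N}. b n) + (\<Sum>n\<in>(\<lambda>n. - int n) ` {..N}. b n)"
      using sum.union_inter[of "int ` {..N}" "(\<lambda>n. - int n) ` {..N}" b]
        sum_nonneg[of "int ` {..N} \<inter> (\<lambda>n. - int n) ` {..N}" b] b0 by simp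
    also have "\<dots> = (\<Sum>n\<le>N. b (int n)) + (\<Sum>n\<le>N. b (- int n))"
      by (subst (1 2) sum.reindex) (auto simp: inj_on_def)
    also have "\<dots> = 2 * (\<Sum>n\<le>N. b (int n))" by (simp add: b_def)
    also have "\<dots> \<le> B"
      unfolding B_def using b0 \<open>summable (\<lambda>n. b (int n))\<close> by (intro mult_left_mono sum_le_suminf) auto
    finally show ?thesis .
  qed
  have "(\<Sum>k\<in>F. 1 / Hs_mult 2 k) \<le> 2 * B ^ 3" if "finite F" for F
  proof -
    obtain N where N: "F \<subseteq> modes N"
    proof -
      obtain n where n: "\<And>k. k \<in> modes (n k)" using modes_exhaust by metis
      have "k \<in> modes (\<Sum>k\<in>F. n k)" if "k \<in> F" for k
        using n[of k] modes_mono[of "n k" "\<Sum>k\<in>F. n k"] member_le_sum[of k F n] that \<open>finite F\<close> by auto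
      then show ?thesis using that by blast
    qed
    have "(\<Sum>k\<in>F. 1 / Hs_mult 2 k) \<le> (\<Sum>k\<in>F. 2 * (\<Prod>j\<in>UNIV. b (k $ j)))" by (intro sum_mono le)
    also have "\<dots> \<le> (\<Sum>k\<in>modes N. 2 * (\<Prod>j\<in>UNIV. b (k $ j)))"
      by (intro sum_mono2 N) (auto intro!: mult_nonneg_nonneg prod_nonneg b0)
    also have "\<dots> = 2 * (\<Sum>k\<in>modes N. \<Prod>j\<in>UNIV. b (k $ j))" by (simp add: sum_distrib_left)
    also have "(\<Sum>k\<in>modes N. \<Prod>j\<in>UNIV. b (k $ j)) = (\<Sum>g\<in>(UNIV :: 3 set) \<rightarrow>\<^sub>E {- int N..int N}. \<Prod>j\<in>UNIV. b (g j))"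
      unfolding modes_image by (subst sum.reindex) (auto simp: inj_on_def vec_lambda_inject)
    also have "\<dots> = (\<Prod>j\<in>(UNIV :: 3 set). \<Sum>n\<in>{- int N..int N}. b n)"
      using infsum_prod_PiE[of "UNIV :: 3 set" "\<lambda>_. b" "\<lambda>_. {- int N..int N}"]
      by (simp add: finite_PiE)
    also have "\<dots> \<le> (\<Prod>j\<in>(UNIV :: 3 set). B)"
      by (intro prod_mono) (auto intro!: sum_nonneg b0 bsum)
    finally show ?thesis by simp
  qed
  then show ?thesis by blast
qed

definition coef_size :: "vfield \<Rightarrow> int^3 \<Rightarrow> real" where
  "coef_size f k = (1 / (2 * pi) ^ 3) * (\<Sum>\<theta>\<in>{0, pi / 2}. norm (coef k \<theta> f))"

lemma coef_size_nonneg: "0 \<le> coef_size f k"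
  by (simp add: coef_size_def)

text \<open>
  The quantitative form of \<open>H\<^sup>2 \<subseteq> L\<^sup>\<infinity>\<close>: Cauchy--Schwarz against the summable weights
  \<open>1 / (1 + |k|\<^sup>4)\<close>.
\<close>

lemma coef_size_sum_bound:
  "\<exists>K\<ge>0. \<forall>f\<in>Hs_space 2. \<forall>F. finite F \<longrightarrow> (\<Sum>k\<in>F. coef_size f k) \<le> K * Hs_norm 2 f"
proof -
  obtain Z where Z: "\<And>F. finite F \<Longrightarrow> (\<Sum>k\<in>F. 1 / Hs_mult 2 k) \<le> Z"
    using inverse_Hs_mult_2_sum_bounded by blast
  have Z0: "0 \<le> Z" using Z[of "{}"] by simp
  define c :: real where "c = (2 * pi) ^ 3"
  have c0: "0 < c" by (simp add: c_def)
  define K where "K = sqrt (2 * Z / c)"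
  have "(\<Sum>k\<in>F. coef_size f k) \<le> K * Hs_norm 2 f" if f: "f \<in> Hs_space 2" and F: "finite F" for f F
  proof (rule power2_le_imp_le)
    have m0: "0 < Hs_mult 2 k" for k by (simp add: Hs_mult_def add_pos_nonneg)
    have "(\<Sum>k\<in>F. coef_size f k)\<^sup>2 = (\<Sum>k\<in>F. (1 / sqrt (Hs_mult 2 k)) * (sqrt (Hs_mult 2 k) * coef_size f k))\<^sup>2"
      using m0 by (simp add: less_imp_neq[symmetric])
    also have "\<dots> \<le> (\<Sum>k\<in>F. (1 / sqrt (Hs_mult 2 k))\<^sup>2) * (\<Sum>k\<in>F. (sqrt (Hs_mult 2 k) * coef_size f k)\<^sup>2)"
      by (rule Cauchy_Schwarz_ineq_sum)
    also have "(\<Sum>k\<in>F. (1 / sqrt (Hs_mult 2 k))\<^sup>2) = (\<Sum>k\<in>F. 1 / Hs_mult 2 k)"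
      using m0 by (simp add: power_divide less_imp_le)
    also have "(\<Sum>k\<in>F. 1 / Hs_mult 2 k) * (\<Sum>k\<in>F. (sqrt (Hs_mult 2 k) * coef_size f k)\<^sup>2) \<le>
        Z * ((2 / c) * (Hs_norm 2 f)\<^sup>2)"
    proof (intro mult_mono Z F sum_nonneg)
      have "(sqrt (Hs_mult 2 k) * coef_size f k)\<^sup>2 \<le>
          (2 / c) * ((1 / c) * (Hs_mult 2 k * (\<Sum>\<theta>\<in>{0, pi / 2}. (norm (coef k \<theta> f))\<^sup>2)))" for k
      proof -
        have "(\<Sum>\<theta>\<in>{0, pi / 2}. norm (coef k \<theta> f))\<^sup>2 \<le> 2 * (\<Sum>\<theta>\<in>{0, pi / 2}. (norm (coef k \<theta> f))\<^sup>2)"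
          using sum_squares_bound[of "norm (coef k 0 f)" "norm (coef k (pi / 2) f)"] by (simp add: power2_sum)
        then have "Hs_mult 2 k * ((1 / c)\<^sup>2 * (\<Sum>\<theta>\<in>{0, pi / 2}. norm (coef k \<theta> f))\<^sup>2) \<le>
          Hs_mult 2 k * ((1 / c)\<^sup>2 * (2 * (\<Sum>\<theta>\<in>{0, pi / 2}. (norm (coef k \<theta> f))\<^sup>2)))"
          using m0[of k] by (intro mult_left_mono) auto
        moreover have "(sqrt (Hs_mult 2 k) * coef_size f k)\<^sup>2 =
            Hs_mult 2 k * ((1 / c)\<^sup>2 * (\<Sum>\<theta>\<in>{0, pi / 2}. norm (coef k \<theta> f))\<^sup>2)"
          using m0[of k] unfolding coef_size_def c_def by (simp only: power_mult_distrib real_sqrt_pow2 less_imp_le)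
        moreover have "Hs_mult 2 k * ((1 / c)\<^sup>2 * (2 * s)) = (2 / c) * ((1 / c) * (Hs_mult 2 k * s))" for s
          by (simp add: power2_eq_square)
        ultimately show ?thesis by (simp only:)
      qed
      then have "(\<Sum>k\<in>F. (sqrt (Hs_mult 2 k) * coef_size f k)\<^sup>2) \<le>
          (\<Sum>k\<in>F. (2 / c) * ((1 / c) * (Hs_mult 2 k * (\<Sum>\<theta>\<in>{0, pi / 2}. (norm (coef k \<theta> f))\<^sup>2))))"
        by (rule sum_mono)
      also have "\<dots> = (2 / c) * ((1 / c) * (\<Sum>k\<in>F. Hs_mult 2 k * (\<Sum>\<theta>\<in>{0, pi / 2}. (norm (coef k \<theta> f))\<^sup>2)))"
        by (simp only: sum_distrib_left)
      also have "\<dots> \<le> (2 / c) * (Hs_norm 2 f)\<^sup>2"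
        using Hs_norm_sq_bound[OF f F] c0 unfolding c_def[symmetric] by (intro mult_left_mono) auto
      finally show "(\<Sum>k\<in>F. (sqrt (Hs_mult 2 k) * coef_size f k)\<^sup>2) \<le> (2 / c) * (Hs_norm 2 f)\<^sup>2" .
    qed (use Z0 in auto)
    also have "\<dots> = (K * Hs_norm 2 f)\<^sup>2" using Z0 c0 by (simp add: K_def power_mult_distrib)
    finally show "(\<Sum>k\<in>F. coef_size f k)\<^sup>2 \<le> (K * Hs_norm 2 f)\<^sup>2" .
  qed (use Z0 c0 in \<open>simp add: K_def\<close>)
  moreover have "0 \<le> K" using Z0 c0 by (simp add: K_def)
  ultimately show ?thesis by blast
qed

definition sup_const :: real where
  "sup_const = (SOME K. K \<ge> 0 \<and> (\<forall>f\<in>Hs_space 2. \<forall>F. finite F \<longrightarrow> (\<Sum>k\<in>F. coef_size f k) \<le> K * Hs_norm 2 f))"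

lemma sup_const_nonneg: "0 \<le> sup_const"
  and coef_size_sum_le: "f \<in> Hs_space 2 \<Longrightarrow> finite F \<Longrightarrow> (\<Sum>k\<in>F. coef_size f k) \<le> sup_const * Hs_norm 2 f"
proof -
  have "sup_const \<ge> 0 \<and> (\<forall>f\<in>Hs_space 2. \<forall>F. finite F \<longrightarrow> (\<Sum>k\<in>F. coef_size f k) \<le> sup_const * Hs_norm 2 f)"
    unfolding sup_const_def by (rule someI_ex) (use coef_size_sum_bound in blast)
  then show "0 \<le> sup_const" "f \<in> Hs_space 2 \<Longrightarrow> finite F \<Longrightarrow> (\<Sum>k\<in>F. coef_size f k) \<le> sup_const * Hs_norm 2 f"
    by auto
qed

definition sup_bound :: "vfield \<Rightarrow> real" where
  "sup_bound f = sup_const * Hs_norm 2 f"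

lemma sup_bound_nonneg [simp]: "0 \<le> sup_bound f"
  by (simp add: sup_bound_def sup_const_nonneg)

lemma norm_mode_sum_le:
  assumes "finite A"
  shows "norm ((1 / (2 * pi) ^ 3) *\<^sub>R (\<Sum>k\<in>A. \<Sum>\<theta>\<in>{0, pi / 2}. wave k \<theta> x *\<^sub>R coef k \<theta> f)) \<le> (\<Sum>k\<in>A. coef_size f k)"
proof -
  have "norm (\<Sum>k\<in>A. \<Sum>\<theta>\<in>{0, pi / 2}. wave k \<theta> x *\<^sub>R coef k \<theta> f) \<le> (\<Sum>k\<in>A. \<Sum>\<theta>\<in>{0, pi / 2}. norm (coef k \<theta> f))"
  proof (intro sum_norm_le)
    fix k \<theta>
    show "norm (wave k \<theta> x *\<^sub>R coef k \<theta> f) \<le> norm (coef k \<theta> f)"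
      using mult_right_mono[OF abs_wave_le norm_ge_zero] by simp
  qed
  then have "(1 / (2 * pi) ^ 3) * norm (\<Sum>k\<in>A. \<Sum>\<theta>\<in>{0, pi / 2}. wave k \<theta> x *\<^sub>R coef k \<theta> f) \<le>
      (1 / (2 * pi) ^ 3) * (\<Sum>k\<in>A. \<Sum>\<theta>\<in>{0, pi / 2}. norm (coef k \<theta> f))"
    by (intro mult_left_mono) auto
  then show ?thesis
    unfolding coef_size_def sum_distrib_left[of "1 / (2 * pi) ^ 3" _ A, symmetric] norm_scaleR by simp
qed

lemma norm_trunc_le:
  assumes f: "f \<in> Hs_space 2" shows "norm (trunc N f x) \<le> sup_bound f"
  unfolding trunc_def sup_bound_def
  by (rule order_trans[OF norm_mode_sum_le[OF finite_modes] coef_size_sum_le[OF f finite_modes]])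

text \<open>
  The partial sums are uniformly Cauchy, with the tails of an absolutely convergent series as errors;
  that the uniform limit is \<open>f\<close> follows from convergence in \<open>L\<^sup>2\<close>.
\<close>

lemma trunc_tendsto_uniform:
  assumes f: "f \<in> Hs_space 2"
  shows "\<exists>\<epsilon>. \<epsilon> \<longlonglongrightarrow> 0 \<and> (\<forall>N. AE x in TM. norm (trunc N f x - f x) \<le> \<epsilon> N)"
proof -
  have sf: "sq_int f" using f by (rule Hs_space_sq_int)
  have sum: "coef_size f summable_on UNIV"
    by (rule nonneg_bdd_above_summable_on)
      (use coef_size_sum_le[OF f] in \<open>auto simp: coef_size_nonneg bdd_above_def\<close>)
  define S where "S = (\<Sum>\<^sub>\<infinity>k. coef_size f k)"
  define \<epsilon> where "\<epsilon> N = S - (\<Sum>k\<in>modes N. coef_size f k)" for N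
  have le: "(\<Sum>k\<in>F. coef_size f k) \<le> S" if "finite F" for F
    unfolding S_def by (rule finite_sum_le_infsum[OF sum that]) (auto simp: coef_size_nonneg)
  have e0: "0 \<le> \<epsilon> N" for N using le[OF finite_modes] by (simp add: \<epsilon>_def)
  have "\<epsilon> \<longlonglongrightarrow> 0"
  proof (rule LIMSEQ_I)
    fix r :: real assume "0 < r"
    then have "\<forall>\<^sub>F F in finite_subsets_at_top UNIV. S - r < (\<Sum>k\<in>F. coef_size f k)"
      using infsum_tendsto[OF sum] by (intro order_tendstoD(1)[of _ S]) (auto simp: S_def)
    then obtain F where F: "finite F" "S - r < (\<Sum>k\<in>F. coef_size f k)"
      by (auto simp: eventually_finite_subsets_at_top)
    obtain n where n: "\<And>k. k \<in> modes (n k)" using modes_exhaust by metis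
    have FN: "F \<subseteq> modes N" if "N \<ge> (\<Sum>k\<in>F. n k)" for N
    proof
      fix k assume "k \<in> F"
      then have "n k \<le> N" using member_le_sum[of k F n] that F(1) by auto
      then show "k \<in> modes N" using n[of k] modes_mono by blast
    qed
    have "norm (\<epsilon> N - 0) < r" if "N \<ge> (\<Sum>k\<in>F. n k)" for N
      using sum_mono2[OF finite_modes FN[OF that], of "coef_size f"] F(2) e0[of N]
      by (simp add: \<epsilon>_def coef_size_nonneg)
    then show "\<exists>no. \<forall>N\<ge>no. norm (\<epsilon> N - 0) < r" by blast
  qed
  moreover have "AE x in TM. norm (trunc N f x - f x) \<le> \<epsilon> N" for N
  proof -
    have MN: "norm (trunc M f x - trunc N f x) \<le> \<epsilon> N" if "N \<le> M" for M x
    proof -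
      have "trunc M f x - trunc N f x =
          (1 / (2 * pi) ^ 3) *\<^sub>R (\<Sum>k\<in>modes M - modes N. \<Sum>\<theta>\<in>{0, pi / 2}. wave k \<theta> x *\<^sub>R coef k \<theta> f)"
        unfolding trunc_def scaleR_diff_right[symmetric] by (subst sum_diff) (use modes_mono[OF that] in auto)
      also have "norm \<dots> \<le> (\<Sum>k\<in>modes M - modes N. coef_size f k)" by (rule norm_mode_sum_le) simp
      also have "\<dots> = (\<Sum>k\<in>modes M. coef_size f k) - (\<Sum>k\<in>modes N. coef_size f k)"
        by (rule sum_diff) (use modes_mono[OF that] in auto)
      also have "\<dots> \<le> \<epsilon> N" using le[OF finite_modes[of M]] by (simp add: \<epsilon>_def)
      finally show ?thesis .
    qed
    \<comment> \<open>The excess over \<open>\<epsilon> N\<close> is dominated by \<open>|trunc M f - f|\<close> for every \<open>M \<ge> N\<close>.\<close>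
    define q where "q x = max 0 (norm (trunc N f x - f x) - \<epsilon> N)" for x
    have [measurable]: "f \<in> borel_measurable TM" "trunc N f \<in> borel_measurable TM"
      using sf sq_int_trunc by (auto simp: sq_int_def)
    have qm: "q \<in> borel_measurable TM" unfolding q_def by measurable
    have qle: "q x \<le> norm (trunc M f x - f x)" if "N \<le> M" for M x
    proof -
      have "norm (trunc N f x - f x) \<le> norm (trunc M f x - trunc N f x) + norm (trunc M f x - f x)"
        using norm_triangle_ineq4[of "trunc M f x - f x" "trunc M f x - trunc N f x"] by simp
      then show ?thesis using MN[OF that, of x] by (simp add: q_def)
    qed
    have s: "sq_int (\<lambda>x. trunc M f x - f x)" for M by (intro sq_int_diff sf sq_int_trunc)
    have q: "sq_int q" "N2 q \<le> N2 (\<lambda>x. trunc M f x - f x)" if "N \<le> M" for M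
      using sq_int_bound[OF s[of M] qm] qle[OF that] by (auto simp: q_def)
    have "N2 q \<le> 0"
      by (rule LIMSEQ_le_const[OF trunc_tendsto[OF sf]]) (use q in blast)
    then have "N2 q = 0" using N2_nonneg[of q] by linarith
    from N2_zero_imp_AE[OF q(1)[OF order_refl] this] show ?thesis
      by eventually_elim (simp add: q_def)
  qed
  ultimately show ?thesis by blast
qed

lemma AE_norm_le_sup_bound:
  assumes f: "f \<in> Hs_space 2" shows "AE x in TM. norm (f x) \<le> sup_bound f"
proof -
  obtain \<epsilon> where e: "\<epsilon> \<longlonglongrightarrow> 0" "\<And>N. AE x in TM. norm (trunc N f x - f x) \<le> \<epsilon> N"
    using trunc_tendsto_uniform[OF f] by blast
  have "AE x in TM. \<forall>N. norm (trunc N f x - f x) \<le> \<epsilon> N" using e(2) by (simp add: AE_all_countable)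
  then show ?thesis
  proof eventually_elim
    case (elim x)
    have "norm (f x) \<le> sup_bound f + \<epsilon> N" for N
      using norm_triangle_ineq4[of "trunc N f x" "trunc N f x - f x"] norm_trunc_le[OF f, of N x] elim[rule_format, of N]
      by simp
    moreover have "(\<lambda>N. sup_bound f + \<epsilon> N) \<longlonglongrightarrow> sup_bound f + 0"
      by (intro tendsto_intros e)
    ultimately show ?case by (auto intro: LIMSEQ_le_const)
  qed
qed

section \<open>Divergence-free fields\<close>

lemma H_sigma_sq_int: "f \<in> H_sigma \<Longrightarrow> sq_int f" "f \<in> H_sigma \<Longrightarrow> periodic f"
  by (auto simp: Lp_sigma_def Lp_space_2)

lemma D_sigma_sq_int: "f \<in> D_sigma \<Longrightarrow> sq_int f"
  by (auto simp: D_sigma_def intro: sq_int_continuous smooth_frechet(3))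

text \<open>Integration by parts for fields in \<open>D_sigma\<close>, followed by the limit in \<open>L\<^sup>2\<close>.\<close>

lemma H_sigma_orthogonal_gradients:
  fixes \<psi> :: "real^3 \<Rightarrow> real"
  assumes a: "a \<in> H_sigma" and psi: "\<And>x. (\<psi> has_derivative D x) (at x)"
    "\<And>j. continuous_on UNIV (\<lambda>x. D x (axis j 1))" "periodic \<psi>"
  shows "pairing a (\<lambda>x. \<chi> j. D x (axis j 1)) = 0"
proof -
  obtain \<phi> where phi: "\<And>n. \<phi> n \<in> D_sigma" "(\<lambda>n. N2 (\<lambda>x. \<phi> n x - a x)) \<longlonglongrightarrow> 0"
    using a by (auto simp: Lp_sigma_def)
  have cpsi: "continuous_on UNIV \<psi>"
    using psi(1) by (auto simp: continuous_on_eq_continuous_at intro: has_derivative_continuous)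
  have s: "sq_int (\<lambda>x. \<chi> j. D x (axis j 1))"
    by (intro sq_int_continuous continuous_on_vec_lambda psi)
  have "pairing (\<phi> n) (\<lambda>x. \<chi> j. D x (axis j 1)) = 0" for n
  proof -
    let ?f = "\<phi> n"
    have f: "smooth ?f" "periodic ?f" "\<And>x. divergence ?f x = 0" using phi(1)[of n] by (auto simp: D_sigma_def)
    have cf: "continuous_on UNIV (\<lambda>x. ?f x $ j)" "continuous_on UNIV (\<lambda>x. frechet_derivative ?f (at x) (axis j 1) $ j)" for j
      by (rule continuous_on_component, rule smooth_frechet, rule f)+
    have 1: "(\<integral>x. ?f x $ j * D x (axis j 1) \<partial>TM) = - (\<integral>x. frechet_derivative ?f (at x) (axis j 1) $ j * \<psi> x \<partial>TM)" for j
      by (rule integration_by_parts_torus)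
        (use f psi in \<open>auto simp: periodic_def intro!: has_derivative_nth smooth_frechet(1,2) continuous_intros\<close>)
    have "pairing ?f (\<lambda>x. \<chi> j. D x (axis j 1)) = (\<Sum>j\<in>UNIV. \<integral>x. ?f x $ j * D x (axis j 1) \<partial>TM)"
      unfolding pairing_def inner_vec_def
      by (subst Bochner_Integration.integral_sum[symmetric])
        (auto intro!: continuous_integrable_TM continuous_intros cf psi)
    also have "\<dots> = - (\<integral>x. (\<Sum>j\<in>UNIV. frechet_derivative ?f (at x) (axis j 1) $ j * \<psi> x) \<partial>TM)"
      unfolding 1 sum_negf
      by (subst Bochner_Integration.integral_sum)
        (auto intro!: continuous_integrable_TM continuous_intros cf cpsi)
    also have "(\<lambda>x. \<Sum>j\<in>UNIV. frechet_derivative ?f (at x) (axis j 1) $ j * \<psi> x) = (\<lambda>x. 0)"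
      using f(3) by (simp add: divergence_def trace_def grad_nth flip: sum_distrib_right)
    finally show ?thesis by simp
  qed
  moreover have "(\<lambda>n. pairing (\<phi> n) (\<lambda>x. \<chi> j. D x (axis j 1))) \<longlonglongrightarrow> pairing a (\<lambda>x. \<chi> j. D x (axis j 1))"
    by (intro pairing_tendsto phi s D_sigma_sq_int H_sigma_sq_int a) (simp add: N2_eq)
  ultimately show ?thesis using LIMSEQ_unique[OF _ tendsto_const] by simp
qed

lemma coef_orthogonal_freq:
  assumes a: "a \<in> H_sigma" shows "coef k \<theta> a \<bullet> freq k = 0"
proof -
  have i: "integrable TM a" by (intro sq_int_integrable H_sigma_sq_int a)
  have "pairing a (\<lambda>x. \<chi> j. (freq k \<bullet> axis j 1) * wave k (\<theta> - pi / 2 + pi / 2) x) = 0"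
    by (rule H_sigma_orthogonal_gradients[OF a wave_has_derivative _ periodic_wave]) (intro continuous_intros)
  moreover have "(\<chi> j. (freq k \<bullet> axis j 1) * wave k (\<theta> - pi / 2 + pi / 2) x) = wave k \<theta> x *\<^sub>R freq k" for x
    by (simp add: vec_eq_iff inner_axis)
  ultimately have "(\<integral>x. wave k \<theta> x *\<^sub>R a x \<bullet> freq k \<partial>TM) = 0"
    by (simp add: pairing_def)
  then show ?thesis
    unfolding coef_def using integral_inner_left[OF coef_integrable[OF i]] by metis
qed

subsection \<open>A frame of divergence-free waves\<close>

definition freq_proj :: "int^3 \<Rightarrow> real^3 \<Rightarrow> real^3" where
  "freq_proj k a = a - ((a \<bullet> freq k) / (freq k \<bullet> freq k)) *\<^sub>R freq k"

text \<open>For \<open>k = 0\<close> the convention \<open>x / 0 = 0\<close> makes the projection the identity, as it should be.\<close>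

lemma freq_proj_orthogonal: "freq_proj k a \<bullet> freq k = 0"
  by (simp add: freq_proj_def inner_diff_left)

lemma freq_proj_symmetric: "freq_proj k a \<bullet> b = a \<bullet> freq_proj k b"
  by (simp add: freq_proj_def inner_diff_left inner_diff_right inner_commute)

lemma freq_proj_id: "a \<bullet> freq k = 0 \<Longrightarrow> freq_proj k a = a"
  by (simp add: freq_proj_def)

type_synonym mode = "(int^3) \<times> real \<times> 3"

text \<open>
  For each wave vector \<open>k\<close> the three coordinate axes are projected onto the plane orthogonal to \<open>k\<close>.
  These three vectors form a tight frame of that plane, so that no orthonormal basis depending on
  \<open>k\<close> has to be chosen.
\<close>

definition frame :: "mode \<Rightarrow> vfield" where
  "frame = (\<lambda>(k, \<theta>, i) x. wave k \<theta> x *\<^sub>R freq_proj k (axis i 1))"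

definition frame_index :: "nat \<Rightarrow> mode set" where
  "frame_index N = modes N \<times> {0, pi / 2} \<times> UNIV"

lemma finite_frame_index [simp]: "finite (frame_index N)"
  by (simp add: frame_index_def)

lemma frame_D_sigma: "frame j \<in> D_sigma"
proof -
  obtain k \<theta> i where j: "j = (k, \<theta>, i)" by (cases j)
  have "(frame j has_derivative (\<lambda>v. ((freq k \<bullet> v) * wave k (\<theta> + pi / 2) x) *\<^sub>R freq_proj k (axis i 1))) (at x)" for x
    unfolding frame_def j prod.case by (intro has_derivative_scaleR_left wave_has_derivative)
  from frechet_derivative_at[OF this, symmetric]
  have "frechet_derivative (frame j) (at x) v = ((freq k \<bullet> v) * wave k (\<theta> + pi / 2) x) *\<^sub>R freq_proj k (axis i 1)" for x v
    by simp
  then have "divergence (frame j) x = wave k (\<theta> + pi / 2) x * (freq_proj k (axis i 1) \<bullet> freq k)" for x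
    by (simp add: divergence_def trace_def grad_nth inner_axis inner_vec_def[of "freq_proj _ _"] sum_distrib_left mult_ac)
  then show ?thesis
    using smooth_wave periodic_wave by (simp add: D_sigma_def frame_def j freq_proj_orthogonal periodic_def)
qed

lemma pairing_frame:
  assumes f: "integrable TM f"
  shows "pairing f (frame (k, \<theta>, i)) = coef k \<theta> f \<bullet> freq_proj k (axis i 1)"
proof -
  have "pairing f (frame (k, \<theta>, i)) = (\<integral>x. (wave k \<theta> x *\<^sub>R f x) \<bullet> freq_proj k (axis i 1) \<partial>TM)"
    by (simp add: pairing_def frame_def)
  also have "\<dots> = coef k \<theta> f \<bullet> freq_proj k (axis i 1)"
    unfolding coef_def by (rule integral_inner_left) (rule coef_integrable[OF f])
  finally show ?thesis .
qed

text \<open>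
  The Fourier coefficients of a divergence-free field are orthogonal to \<open>k\<close>, so the projection in the
  frame fixes them.
\<close>

lemma trunc_frame:
  assumes f: "f \<in> H_sigma"
  shows "trunc N f x = (\<Sum>j\<in>frame_index N. ((1 / (2 * pi) ^ 3) * pairing f (frame j)) *\<^sub>R frame j x)"
proof -
  have i: "integrable TM f" by (intro sq_int_integrable H_sigma_sq_int f)
  have "wave k \<theta> x *\<^sub>R coef k \<theta> f = (\<Sum>i\<in>UNIV. pairing f (frame (k, \<theta>, i)) *\<^sub>R frame (k, \<theta>, i) x)" for k \<theta>
  proof -
    define A where "A = coef k \<theta> f"
    have A: "freq_proj k A = A" unfolding A_def by (intro freq_proj_id coef_orthogonal_freq f)
    have lin: "linear (freq_proj k)"
      by (rule linearI) (simp_all add: freq_proj_def inner_add_left add_divide_distrib algebra_simps)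
    have "A = freq_proj k (\<Sum>i\<in>UNIV. A $ i *\<^sub>R axis i 1)"
      using A basis_expansion[of A] by (simp add: scalar_mult_eq_scaleR)
    also have "\<dots> = (\<Sum>i\<in>UNIV. A $ i *\<^sub>R freq_proj k (axis i 1))"
      by (simp add: linear_sum[OF lin] linear_cmul[OF lin])
    finally have e: "A = (\<Sum>i\<in>UNIV. A $ i *\<^sub>R freq_proj k (axis i 1))" .
    have p: "pairing f (frame (k, \<theta>, i)) = A $ i" for i
      using pairing_frame[OF i] freq_proj_symmetric[of k A "axis i 1"] A
      by (simp add: A_def[symmetric] inner_axis)
    show ?thesis
      unfolding p A_def[symmetric] by (subst e) (simp add: frame_def scaleR_sum_right mult.commute)
  qed
  then show ?thesis
    unfolding trunc_def frame_index_def
    by (simp only: sum.cartesian_product' scaleR_sum_right scaleR_scaleR)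
qed

section \<open>Antisymmetry of the convective term\<close>

text \<open>The sum of the two integrands is \<open>a \<cdot> \<nabla>(f \<cdot> g)\<close>.\<close>

lemma tri_antisym_smooth:
  assumes a: "a \<in> H_sigma" and f: "smooth f" "periodic f" and g: "smooth g" "periodic g"
  shows "tri (grad f) a g + tri (grad g) a f = 0"
proof -
  have "pairing a (\<lambda>x. \<chi> j. f x \<bullet> frechet_derivative g (at x) (axis j 1) + frechet_derivative f (at x) (axis j 1) \<bullet> g x) = 0"
    by (rule H_sigma_orthogonal_gradients[OF a, of "\<lambda>x. f x \<bullet> g x"
        "\<lambda>x v. f x \<bullet> frechet_derivative g (at x) v + frechet_derivative f (at x) v \<bullet> g x"])
      (use f g in \<open>auto intro!: has_derivative_inner smooth_frechet(1) continuous_on_add continuous_on_inner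
          intro: smooth_frechet(2,3) simp: periodic_def\<close>)
  moreover have "a x \<bullet> (\<chi> j. f x \<bullet> frechet_derivative g (at x) (axis j 1) + frechet_derivative f (at x) (axis j 1) \<bullet> g x) =
      (grad f x *v a x) \<bullet> g x + (grad g x *v a x) \<bullet> f x" for x
    by (simp add: inner_vec_def matrix_vector_mult_def grad_nth sum_3 algebra_simps)
  ultimately have z: "(\<integral>x. (grad f x *v a x) \<bullet> g x + (grad g x *v a x) \<bullet> f x \<partial>TM) = 0"
    by (simp add: pairing_def)
  have i: "integrable TM (\<lambda>x. (grad f x *v a x) \<bullet> g x)" if "smooth f" "smooth g" for f g
  proof -
    have "bounded (g ` cell)"
      by (intro compact_imp_bounded compact_continuous_image compact_cbox continuous_on_subset[OF smooth_frechet(3)[OF that(2)]]) simp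
    then obtain B where B: "\<And>x. x \<in> cell \<Longrightarrow> norm (g x) \<le> B" by (auto simp: bounded_iff)
    show ?thesis
    proof (rule tri_bounded_test(1))
      show "sq_int (grad f)" by (rule sq_int_continuous) (use continuous_grad[OF that(1)] in simp)
      show "AE x in TM. norm (g x) \<le> B" using AE_TM_cell by eventually_elim (rule B)
    qed (use a that in \<open>auto intro: H_sigma_sq_int continuous_measurable_TM smooth_frechet(3)\<close>)
  qed
  show ?thesis using z i[OF f(1) g(1)] i[OF g(1) f(1)] by (simp add: tri_def pairing_def)
qed

lemma tri_diff_left:
  assumes "integrable TM (\<lambda>x. (G x *v a x) \<bullet> \<psi> x)" "integrable TM (\<lambda>x. (G' x *v a x) \<bullet> \<psi> x)"
  shows "tri (\<lambda>x. G x - G' x) a \<psi> = tri G a \<psi> - tri G' a \<psi>"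
  using assms by (simp add: tri_def pairing_def matrix_vector_mult_diff_rdistrib inner_diff_left)

text \<open>
  Passage to the limit in \<open>tri_antisym_smooth\<close> for truncations; as \<open>u\<close> is bounded, convergence of gradients
  in \<open>L\<^sup>2\<close> is preserved on multiplication by \<open>u\<close>.
\<close>

lemma tri_antisym_bounded:
  assumes u: "u \<in> H_sigma" "u \<in> Hs_space 1" "u \<in> Hs_space 2" and v: "v \<in> Hs_space 1"
  shows "tri (weak_grad v) u u + tri (weak_grad u) u v = 0"
proof -
  have um: "u \<in> borel_measurable TM" using H_sigma_sq_int(1)[OF u(1)] by (rule sq_int_measurable)
  have lim: "(\<lambda>N. tri (grad (trunc N f)) u (trunc N g)) \<longlonglongrightarrow> tri (weak_grad f) u g"
    if f: "f \<in> Hs_space 1" and g: "g \<in> Hs_space 1" for f g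
    unfolding tri_def
  proof (rule pairing_tendsto)
    have s: "sq_int (grad (trunc N f))" for N by (rule N2_grad_trunc_le(2)[OF f])
    note ub = AE_norm_le_sup_bound[OF u(3)]
    show "sq_int (\<lambda>x. grad (trunc N f) x *v u x)" for N
      by (rule tri_bounded_advection(1)[OF s um ub sq_int_zero])
    show "sq_int (\<lambda>x. weak_grad f x *v u x)"
      by (rule tri_bounded_advection(1)[OF weak_grad(2)[OF f] um ub sq_int_zero])
    show "(\<lambda>N. N2 (\<lambda>x. grad (trunc N f) x *v u x - weak_grad f x *v u x)) \<longlonglongrightarrow> 0"
    proof (rule Lim_null_comparison)
      show "\<forall>\<^sub>F N in sequentially. norm (N2 (\<lambda>x. grad (trunc N f) x *v u x - weak_grad f x *v u x)) \<le>
          sup_bound u * N2 (\<lambda>x. grad (trunc N f) x - weak_grad f x)"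
      proof (intro always_eventually allI)
        fix N
        have d: "sq_int (\<lambda>x. grad (trunc N f) x - weak_grad f x)" by (intro sq_int_diff s weak_grad f)
        have e: "AE x in TM. norm ((grad (trunc N f) x - weak_grad f x) *v u x) \<le>
            norm (sup_bound u *\<^sub>R (grad (trunc N f) x - weak_grad f x))"
          using ub
        proof eventually_elim
          case (elim x)
          have "norm ((grad (trunc N f) x - weak_grad f x) *v u x) \<le> norm (grad (trunc N f) x - weak_grad f x) * norm (u x)"
            by (rule norm_matrix_vector_le)
          also have "\<dots> \<le> norm (grad (trunc N f) x - weak_grad f x) * sup_bound u"
            using elim by (intro mult_left_mono) auto
          finally show ?case by (simp add: mult.commute)
        qed
        have [measurable]: "(\<lambda>x. grad (trunc N f) x - weak_grad f x) \<in> borel_measurable TM" "u \<in> borel_measurable TM"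
          using d um by (auto simp: sq_int_def)
        have "N2 (\<lambda>x. (grad (trunc N f) x - weak_grad f x) *v u x) \<le> N2 (\<lambda>x. sup_bound u *\<^sub>R (grad (trunc N f) x - weak_grad f x))"
          by (rule sq_int_bound(2)[OF sq_int_scaleR[OF d] _ e]) measurable
        then show "norm (N2 (\<lambda>x. grad (trunc N f) x *v u x - weak_grad f x *v u x)) \<le>
            sup_bound u * N2 (\<lambda>x. grad (trunc N f) x - weak_grad f x)"
          by (simp add: N2_scaleR matrix_vector_mult_diff_rdistrib)
      qed
      show "(\<lambda>N. sup_bound u * N2 (\<lambda>x. grad (trunc N f) x - weak_grad f x)) \<longlonglongrightarrow> 0"
        using tendsto_mult[OF tendsto_const grad_trunc_tendsto[OF f], of "sup_bound u"] by simp
    qed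
  qed (use g in \<open>auto intro: trunc_tendsto Hs_space_sq_int\<close>)
  have "tri (grad (trunc N v)) u (trunc N u) + tri (grad (trunc N u)) u (trunc N v) = 0" for N
    by (intro tri_antisym_smooth u smooth_trunc periodic_trunc)
  then show ?thesis
    using LIMSEQ_unique[OF tendsto_add[OF lim[OF v u(2)] lim[OF u(2) v]]] by simp
qed

text \<open>
  Here \<open>a\<close> is only square integrable, and uniform convergence of the truncations of \<open>u\<close> compensates
  for it.
\<close>

lemma tri_tendsto_smooth_test:
  assumes f: "f \<in> Hs_space 1" and a: "sq_int a" and u: "u \<in> Hs_space 2" "sq_int u"
  shows "(\<lambda>N. tri (grad (trunc N f)) a (trunc N u)) \<longlonglongrightarrow> tri (weak_grad f) a u"
    and "(\<lambda>N. tri (weak_grad f) a (trunc N u)) \<longlonglongrightarrow> tri (weak_grad f) a u"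
proof -
  obtain \<epsilon> where e: "\<epsilon> \<longlonglongrightarrow> 0" "\<And>N. AE x in TM. norm (trunc N u x - u x) \<le> \<epsilon> N"
    using trunc_tendsto_uniform[OF u(1)] by blast
  have s: "sq_int (grad (trunc N f))" for N by (rule N2_grad_trunc_le(2)[OF f])
  have tm: "trunc N u \<in> borel_measurable TM" for N using sq_int_trunc sq_int_measurable by blast
  have um: "u \<in> borel_measurable TM" using u(2) by (rule sq_int_measurable)
  have tb: "AE x in TM. norm (trunc N u x) \<le> sup_bound u" for N using norm_trunc_le[OF u(1)] by simp
  note ub = AE_norm_le_sup_bound[OF u(1)]
  note W = weak_grad(2)[OF f]
  have 2: "\<bar>tri (weak_grad f) a (trunc N u) - tri (weak_grad f) a u\<bar> \<le> \<epsilon> N * N2 (weak_grad f) * N2 a" for N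
  proof -
    have "tri (weak_grad f) a (trunc N u) - tri (weak_grad f) a u = tri (weak_grad f) a (\<lambda>x. trunc N u x - u x)"
      using tri_bounded_test(1)[OF W a tm tb] tri_bounded_test(1)[OF W a um ub]
      by (simp add: tri_def pairing_def inner_diff_right)
    then show ?thesis
      using tri_bounded_test(2)[OF W a _ e(2)] sq_int_measurable[OF sq_int_diff[OF sq_int_trunc u(2)]] by simp
  qed
  have 1: "\<bar>tri (grad (trunc N f)) a (trunc N u) - tri (weak_grad f) a (trunc N u)\<bar> \<le>
      sup_bound u * N2 (\<lambda>x. grad (trunc N f) x - weak_grad f x) * N2 a" for N
  proof -
    have "tri (grad (trunc N f)) a (trunc N u) - tri (weak_grad f) a (trunc N u) = tri (\<lambda>x. grad (trunc N f) x - weak_grad f x) a (trunc N u)"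
      using tri_bounded_test(1)[OF W a tm tb] tri_bounded_test(1)[OF s a tm tb] by (simp add: tri_diff_left)
    then show ?thesis
      using tri_bounded_test(2)[OF sq_int_diff[OF s W] a tm tb] by simp
  qed
  have lim2: "(\<lambda>N. tri (weak_grad f) a (trunc N u) - tri (weak_grad f) a u) \<longlonglongrightarrow> 0"
    by (rule Lim_null_comparison[of _ "\<lambda>N. \<epsilon> N * N2 (weak_grad f) * N2 a"])
      (use 2 in \<open>auto intro!: tendsto_mult_left_zero e\<close>)
  show "(\<lambda>N. tri (weak_grad f) a (trunc N u)) \<longlonglongrightarrow> tri (weak_grad f) a u" using lim2 by (rule LIM_zero_cancel)
  have lim1: "(\<lambda>N. tri (grad (trunc N f)) a (trunc N u) - tri (weak_grad f) a (trunc N u)) \<longlonglongrightarrow> 0"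
  proof (rule Lim_null_comparison)
    show "\<forall>\<^sub>F N in sequentially. norm (tri (grad (trunc N f)) a (trunc N u) - tri (weak_grad f) a (trunc N u)) \<le>
        sup_bound u * N2 (\<lambda>x. grad (trunc N f) x - weak_grad f x) * N2 a"
      using 1 by simp
    show "(\<lambda>N. sup_bound u * N2 (\<lambda>x. grad (trunc N f) x - weak_grad f x) * N2 a) \<longlonglongrightarrow> 0"
      by (rule tendsto_mult_left_zero[OF tendsto_mult_right_zero[OF grad_trunc_tendsto[OF f]]])
  qed
  show "(\<lambda>N. tri (grad (trunc N f)) a (trunc N u)) \<longlonglongrightarrow> tri (weak_grad f) a u"
    by (rule LIM_zero_cancel) (use tendsto_add[OF lim1 lim2] in simp)
qed

lemma tri_self_zero:
  assumes w: "w \<in> H_sigma" and u: "u \<in> Hs_space 1" "u \<in> Hs_space 2"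
  shows "tri (weak_grad u) w u = 0"
proof -
  have "tri (grad (trunc N u)) w (trunc N u) = 0" for N
    using tri_antisym_smooth[OF w smooth_trunc periodic_trunc smooth_trunc periodic_trunc, of N u N u] by simp
  then show ?thesis
    using LIMSEQ_unique[OF tri_tendsto_smooth_test(1)[OF u(1) H_sigma_sq_int(1)[OF w] u(2) Hs_space_sq_int(1)[OF u(1)]]]
    by simp
qed

section \<open>The absorption term\<close>

definition absorb :: "real \<Rightarrow> real^3 \<Rightarrow> real^3" where
  "absorb r a = (norm a powr (r - 1)) *\<^sub>R a"

lemma absorption_absorb: "absorption r f x = absorb r (f x)"
  by (simp add: absorption_def absorb_def)

lemma powr_minus_one_mult: "0 \<le> x \<Longrightarrow> x powr (r - 1) * x = x powr r" for x r :: real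
  by (cases "x = 0") (auto simp: powr_diff)

lemma norm_absorb: "norm (absorb r a) = norm a powr r"
  by (simp add: absorb_def powr_minus_one_mult)

lemma absorb_inner_self: "absorb r a \<bullet> a = norm a powr (r + 1)"
proof -
  have "absorb r a \<bullet> a = (norm a powr (r - 1) * norm a) * norm a"
    by (simp add: absorb_def power2_norm_eq_inner[symmetric] power2_eq_square)
  also have "\<dots> = norm a powr ((r + 1) - 1) * norm a" by (simp add: powr_minus_one_mult)
  also have "\<dots> = norm a powr (r + 1)" by (rule powr_minus_one_mult) simp
  finally show ?thesis .
qed

lemma absorb_monotone:
  assumes "1 \<le> r" shows "0 \<le> (absorb r a - absorb r b) \<bullet> (a - b)"
proof -
  define p q where "p = norm a powr (r - 1)" and "q = norm b powr (r - 1)"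
  have pq: "0 \<le> p" "0 \<le> q" by (simp_all add: p_def q_def)
  have "0 \<le> (p * norm a - q * norm b) * (norm a - norm b)"
  proof (cases "norm a \<le> norm b")
    case True
    then have "p * norm a \<le> q * norm b"
      unfolding p_def q_def using assms by (intro mult_mono powr_mono2) auto
    then show ?thesis using True by (intro mult_nonpos_nonpos) auto
  next
    case False
    then have "q * norm b \<le> p * norm a"
      unfolding p_def q_def using assms by (intro mult_mono powr_mono2) auto
    then show ?thesis using False by (intro mult_nonneg_nonneg) auto
  qed
  also have "\<dots> = p * (norm a)\<^sup>2 + q * (norm b)\<^sup>2 - (p + q) * (norm a * norm b)"
    by (simp add: power2_eq_square algebra_simps)
  also have "\<dots> \<le> p * (norm a)\<^sup>2 + q * (norm b)\<^sup>2 - (p + q) * (a \<bullet> b)"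
    using pq norm_cauchy_schwarz[of a b] by (intro diff_left_mono mult_left_mono) auto
  also have "\<dots> = (absorb r a - absorb r b) \<bullet> (a - b)"
    by (simp add: absorb_def p_def[symmetric] q_def[symmetric] power2_norm_eq_inner inner_diff_left
        inner_diff_right inner_commute algebra_simps)
  finally show ?thesis .
qed

text \<open>
  For \<open>|b| \<le> |a|\<close> and \<open>z = |b|/|a|\<close> the factor \<open>1 - z\<^bsup>r-1\<^esup>\<close> is at most \<open>1 - z\<^sup>2 \<le> 2 (1 - z)\<close>,
  by \<open>r \<le> 3\<close>.
\<close>

lemma absorb_lipschitz_ordered:
  assumes r: "1 \<le> r" "r \<le> 3" and le: "norm b \<le> norm a"
  shows "norm (absorb r a - absorb r b) \<le> 3 * norm a powr (r - 1) * norm (a - b)"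
proof (cases "a = 0")
  case True
  then show ?thesis using le by (simp add: absorb_def)
next
  case False
  define p q where "p = norm a powr (r - 1)" and "q = norm b powr (r - 1)"
  have pq: "0 \<le> q" "q \<le> p" unfolding p_def q_def using le r by (auto intro: powr_mono2)
  define z where "z = norm b / norm a"
  have z: "0 \<le> z" "z \<le> 1" using le False by (auto simp: z_def)
  have "(p - q) * norm b \<le> 2 * p * norm (a - b)"
  proof (cases "b = 0")
    case True
    then show ?thesis using pq by simp
  next
    case b: False
    then have z0: "0 < z" using False by (simp add: z_def)
    have qz: "q = p * z powr (r - 1)"
      using False b by (simp add: p_def q_def z_def powr_divide)
    have "z powr 2 \<le> z powr (r - 1)" using z0 z r by (intro powr_mono') auto
    then have z2: "z\<^sup>2 \<le> z powr (r - 1)" using z by (simp add: powr_two)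
    have "(p - q) * norm b = p * (1 - z powr (r - 1)) * norm b" by (simp add: qz algebra_simps)
    also have "\<dots> \<le> p * (1 - z\<^sup>2) * norm b"
      using z2 pq by (intro mult_right_mono mult_left_mono) auto
    also have "\<dots> \<le> p * (2 * (1 - z)) * norm a"
    proof (intro mult_mono mult_left_mono)
      have "1 - z\<^sup>2 = (1 - z) * (1 + z)" by (simp add: power2_eq_square algebra_simps)
      also have "\<dots> \<le> (1 - z) * 2" using z by (intro mult_left_mono) auto
      finally show "1 - z\<^sup>2 \<le> 2 * (1 - z)" by simp
    qed (use pq z le power_le_one[of z 2] in auto)
    also have "\<dots> = 2 * p * (norm a - norm b)" using False by (simp add: z_def field_simps)
    also have "\<dots> \<le> 2 * p * norm (a - b)"
      using pq norm_triangle_ineq2[of a b] by (intro mult_left_mono) auto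
    finally show ?thesis .
  qed
  moreover have "absorb r a - absorb r b = p *\<^sub>R (a - b) + (p - q) *\<^sub>R b"
    by (simp add: absorb_def p_def q_def algebra_simps)
  then have "norm (absorb r a - absorb r b) \<le> p * norm (a - b) + (p - q) * norm b"
    using norm_triangle_ineq[of "p *\<^sub>R (a - b)" "(p - q) *\<^sub>R b"] pq by simp
  ultimately show ?thesis unfolding p_def[symmetric] by simp
qed

lemma absorb_lipschitz:
  assumes r: "1 \<le> r" "r \<le> 3"
  shows "norm (absorb r a - absorb r b) \<le> 3 * (max (norm a) (norm b)) powr (r - 1) * norm (a - b)"
proof (cases "norm b \<le> norm a")
  case True
  then show ?thesis using absorb_lipschitz_ordered[OF r True] by (simp add: max_def)
next
  case False
  then show ?thesis using absorb_lipschitz_ordered[OF r, of a b]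
    by (simp add: max_def norm_minus_commute)
qed

lemma continuous_absorb:
  assumes r: "1 \<le> r" "r \<le> 3" shows "continuous_on UNIV (absorb r)"
  unfolding continuous_on_eq_continuous_at[OF open_UNIV] continuous_at
proof
  fix a :: "real^3"
  have "((\<lambda>b. 3 * (max (norm b) (norm a)) powr (r - 1) * norm (b - a)) \<longlongrightarrow> 0) (at a)"
  proof (rule Lim_null_comparison)
    have "\<forall>\<^sub>F b in at a. norm (b - a) < 1" unfolding eventually_at by (intro exI[of _ 1]) (simp add: dist_norm)
    then show "\<forall>\<^sub>F b in at a. norm (3 * (max (norm b) (norm a)) powr (r - 1) * norm (b - a)) \<le>
        3 * (norm a + 1) powr (r - 1) * norm (b - a)"
    proof eventually_elim
      case (elim b)
      have "norm b \<le> norm a + 1" using elim norm_triangle_ineq2[of b a] by simp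
      then have "(max (norm b) (norm a)) powr (r - 1) \<le> (norm a + 1) powr (r - 1)"
        using r by (intro powr_mono2) (auto simp: le_max_iff_disj)
      then show ?case by (simp add: abs_mult mult_right_mono)
    qed
    have "((\<lambda>b. 3 * (norm a + 1) powr (r - 1) * norm (b - a)) \<longlongrightarrow> 3 * (norm a + 1) powr (r - 1) * norm (a - a)) (at a)"
      by (intro tendsto_intros)
    then show "((\<lambda>b. 3 * (norm a + 1) powr (r - 1) * norm (b - a)) \<longlongrightarrow> 0) (at a)" by simp
  qed
  then have "((\<lambda>b. absorb r b - absorb r a) \<longlongrightarrow> 0) (at a)"
    by (rule Lim_null_comparison[rotated]) (use absorb_lipschitz[OF r] in simp)
  then show "(absorb r \<longlongrightarrow> absorb r a) (at a)" by (rule LIM_zero_cancel)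
qed

lemma absorption_measurable:
  assumes r: "1 \<le> r" "r \<le> 3" and f: "f \<in> borel_measurable N"
  shows "(\<lambda>x. absorb r (f x)) \<in> borel_measurable N"
  by (rule measurable_compose[OF f borel_measurable_continuous_onI[OF continuous_absorb[OF r]]])

lemma powr_le_one_plus_sq: "0 \<le> x \<Longrightarrow> 0 \<le> q \<Longrightarrow> q \<le> 2 \<Longrightarrow> x powr q \<le> 1 + x\<^sup>2" for x q :: real
proof (cases "x \<le> 1")
  case True
  assume "0 \<le> x" "0 \<le> q"
  then have "x powr q \<le> 1" using True by (intro powr_le1) auto
  then show ?thesis using zero_le_power2[of x] by linarith
next
  case False
  assume "q \<le> 2"
  then have "x powr q \<le> x powr 2" using False by (intro powr_mono) auto
  then show ?thesis using False by (simp add: powr_two)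
qed

lemma absorption_sq_int:
  assumes r: "1 \<le> r" "r \<le> 3" and u: "sq_int u" and B: "AE x in TM. norm (u x) \<le> K"
  shows "sq_int (absorption r u)" and "N2 (absorption r u) \<le> (1 + K\<^sup>2) * N2 u"
proof -
  have "AE x in TM. norm (absorption r u x) \<le> norm ((1 + K\<^sup>2) *\<^sub>R u x)"
    using B
  proof eventually_elim
    case (elim x)
    have "norm (u x) powr (r - 1) \<le> 1 + (norm (u x))\<^sup>2" using r by (intro powr_le_one_plus_sq) auto
    also have "\<dots> \<le> 1 + K\<^sup>2" using elim by (simp add: power_mono)
    finally show ?case by (simp add: absorption_def mult_right_mono)
  qed
  moreover have "absorption r u \<in> borel_measurable TM"
    using absorption_measurable[OF r sq_int_measurable[OF u]] by (simp add: absorption_absorb[abs_def])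
  ultimately show "sq_int (absorption r u)" "N2 (absorption r u) \<le> (1 + K\<^sup>2) * N2 u"
    using sq_int_bound[OF sq_int_scaleR[OF u, of "1 + K\<^sup>2"]] by (auto simp: N2_scaleR)
qed

lemma powr_integrable_intermediate:
  assumes v: "v \<in> borel_measurable TM" and i: "integrable TM (\<lambda>x. norm (v x) powr p)" and q: "0 \<le> q" "q \<le> p"
  shows "integrable TM (\<lambda>x. norm (v x) powr q)"
proof (rule Bochner_Integration.integrable_bound)
  note [measurable] = v
  show "integrable TM (\<lambda>x. 1 + norm (v x) powr p)" using i by simp
  have "norm (v x) powr q \<le> 1 + norm (v x) powr p" for x
  proof (cases "norm (v x) \<le> 1")
    case True
    then have "norm (v x) powr q \<le> 1" using q by (intro powr_le1) auto
    then show ?thesis using powr_ge_zero[of "norm (v x)" p] by linarith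
  next
    case False
    then have "norm (v x) powr q \<le> norm (v x) powr p" using q by (intro powr_mono) auto
    then show ?thesis by simp
  qed
  then show "AE x in TM. norm (norm (v x) powr q) \<le> norm (1 + norm (v x) powr p)" by simp
qed (use v in measurable)

lemma absorption_test:
  assumes r: "1 \<le> r" "r \<le> 3" and v: "v \<in> Lp_space (r + 1)" and m: "\<psi> \<in> borel_measurable TM"
    and B: "AE x in TM. norm (\<psi> x) \<le> K"
  shows "integrable TM (\<lambda>x. absorption r v x \<bullet> \<psi> x)"
    and "\<bar>pairing (absorption r v) \<psi>\<bar> \<le> K * (\<integral>x. norm (v x) powr r \<partial>TM)"
proof -
  have vm: "v \<in> borel_measurable TM" and vi: "integrable TM (\<lambda>x. norm (v x) powr (r + 1))"
    using v by (auto simp: Lp_space_def)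
  have i: "integrable TM (\<lambda>x. norm (v x) powr r)"
    by (rule powr_integrable_intermediate[OF vm vi]) (use r in auto)
  have [measurable]: "absorption r v \<in> borel_measurable TM" "\<psi> \<in> borel_measurable TM"
    using absorption_measurable[OF r vm] m by (auto simp: absorption_absorb[abs_def])
  have le: "AE x in TM. \<bar>absorption r v x \<bullet> \<psi> x\<bar> \<le> K * norm (v x) powr r"
    using B
  proof eventually_elim
    case (elim x)
    have "\<bar>absorption r v x \<bullet> \<psi> x\<bar> \<le> norm (absorption r v x) * norm (\<psi> x)" by (rule Cauchy_Schwarz_ineq2)
    also have "\<dots> \<le> norm (absorption r v x) * K" using elim by (intro mult_left_mono) auto
    finally show ?case by (simp add: absorption_absorb norm_absorb mult.commute)
  qed
  have iK: "integrable TM (\<lambda>x. K * norm (v x) powr r)" using i by simp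
  show *: "integrable TM (\<lambda>x. absorption r v x \<bullet> \<psi> x)"
    by (rule Bochner_Integration.integrable_bound[OF iK]) (use le in auto)
  have "\<bar>pairing (absorption r v) \<psi>\<bar> \<le> (\<integral>x. \<bar>absorption r v x \<bullet> \<psi> x\<bar> \<partial>TM)"
    unfolding pairing_def by (rule integral_abs_bound)
  also have "\<dots> \<le> (\<integral>x. K * norm (v x) powr r \<partial>TM)"
    using le * iK by (intro integral_mono_AE) auto
  finally show "\<bar>pairing (absorption r v) \<psi>\<bar> \<le> K * (\<integral>x. norm (v x) powr r \<partial>TM)" by simp
qed

text \<open>Cauchy--Schwarz with \<open>|v|\<^sup>r = |v|\<^bsup>(r+1)/2\<^esup> |v|\<^bsup>(r-1)/2\<^esup>\<close>, where \<open>r - 1 \<le> 2\<close>.\<close>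

lemma absorption_L1_sq:
  assumes r: "1 \<le> r" "r \<le> 3" and v: "v \<in> Lp_space (r + 1)" "sq_int v"
  shows "(\<integral>x. norm (v x) powr r \<partial>TM)\<^sup>2 \<le>
    (\<integral>x. norm (v x) powr (r + 1) \<partial>TM) * ((2 * pi) ^ 3 + (N2 v)\<^sup>2)"
proof -
  have vm[measurable]: "v \<in> borel_measurable TM" and vi: "integrable TM (\<lambda>x. norm (v x) powr (r + 1))"
    using v by (auto simp: Lp_space_def)
  define f where "f x = norm (v x) powr ((r + 1) / 2)" for x
  define g where "g x = norm (v x) powr ((r - 1) / 2)" for x
  have f2: "(norm (f x))\<^sup>2 = norm (v x) powr (r + 1)" for x
  proof -
    have "(r + 1) / 2 * 2 = r + 1" by simp
    moreover have "(norm (f x))\<^sup>2 = norm (v x) powr ((r + 1) / 2 * 2)"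
      unfolding f_def by (simp only: powr_powr[symmetric] powr_two[OF powr_ge_zero] real_norm_def power2_abs)
    ultimately show ?thesis by (simp only:)
  qed
  have g2: "(norm (g x))\<^sup>2 = norm (v x) powr (r - 1)" for x
  proof -
    have "(r - 1) / 2 * 2 = r - 1" by simp
    moreover have "(norm (g x))\<^sup>2 = norm (v x) powr ((r - 1) / 2 * 2)"
      unfolding g_def by (simp only: powr_powr[symmetric] powr_two[OF powr_ge_zero] real_norm_def power2_abs)
    ultimately show ?thesis by (simp only:)
  qed
  have fg: "norm (f x) * norm (g x) = norm (v x) powr r" for x
  proof -
    have "(r + 1) / 2 + (r - 1) / 2 = r" by (simp add: field_simps)
    then show ?thesis unfolding f_def g_def by (simp flip: powr_add)
  qed
  have gi: "integrable TM (\<lambda>x. norm (v x) powr (r - 1))"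
    by (rule powr_integrable_intermediate[OF vm vi]) (use r in auto)
  have sf: "sq_int f" "sq_int g" unfolding sq_int_def f2 g2 using vi gi
    by (auto simp: f_def[abs_def] g_def[abs_def])
  have "(\<integral>x. norm (v x) powr r \<partial>TM) \<le> N2 f * N2 g"
    using integral_norm_mult_le[OF sf] by (simp only: fg)
  then have "(\<integral>x. norm (v x) powr r \<partial>TM)\<^sup>2 \<le> (N2 f * N2 g)\<^sup>2"
    by (intro power_mono) auto
  also have "\<dots> = (\<integral>x. norm (v x) powr (r + 1) \<partial>TM) * (\<integral>x. norm (v x) powr (r - 1) \<partial>TM)"
    by (simp only: power_mult_distrib N2_sq f2 g2)
  also have "\<dots> \<le> (\<integral>x. norm (v x) powr (r + 1) \<partial>TM) * (\<integral>x. 1 + (norm (v x))\<^sup>2 \<partial>TM)"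
    using gi sq_int_norm_sq[OF v(2)] r by (intro mult_left_mono integral_mono powr_le_one_plus_sq) auto
  also have "(\<integral>x. 1 + (norm (v x))\<^sup>2 \<partial>TM) = (2 * pi) ^ 3 + (N2 v)\<^sup>2"
    using sq_int_norm_sq[OF v(2)] by (simp add: N2_sq measure_TM)
  finally show ?thesis .
qed

section \<open>The cross term at a fixed time\<close>

text \<open>Regularity of a weak and of a strong solution at almost every time.\<close>

definition weak_class :: "real \<Rightarrow> vfield set" where
  "weak_class r = {v. v \<in> H_sigma \<and> v \<in> Hs_space 1 \<and> v \<in> Lp_space (r + 1)}"

definition strong_class :: "real \<Rightarrow> vfield set" where
  "strong_class r = weak_class r \<inter> Hs_space 2"

text \<open>\<open>- \<partial>\<^sub>t u\<close>, tested with \<open>\<psi>\<close>.\<close>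

definition cbf_form :: "real \<Rightarrow> vfield \<Rightarrow> vfield \<Rightarrow> real" where
  "cbf_form r u \<psi> = pairing (weak_grad u) (grad \<psi>) + tri (weak_grad u) u \<psi> + pairing (absorption r u) \<psi>"

text \<open>\<open>- d/dt \<langle>u, v\<rangle>\<close> for two solutions.\<close>

definition cross_form :: "real \<Rightarrow> vfield \<Rightarrow> vfield \<Rightarrow> real" where
  "cross_form r u v = 2 * pairing (weak_grad u) (weak_grad v) + tri (weak_grad u) u v + tri (weak_grad v) v u
     + pairing (absorption r u) v + pairing (absorption r v) u"

lemma cross_form_tendsto:
  assumes r: "1 \<le> r" "r \<le> 3" and u: "u \<in> strong_class r" and v: "v \<in> weak_class r"
  shows "(\<lambda>N. cbf_form r u (trunc N v) + cbf_form r v (trunc N u)) \<longlonglongrightarrow> cross_form r u v"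
proof -
  have u': "u \<in> H_sigma" "u \<in> Hs_space 1" "u \<in> Hs_space 2" "sq_int u"
    using u by (auto simp: strong_class_def weak_class_def intro: Hs_space_sq_int)
  have v': "v \<in> Hs_space 1" "v \<in> Lp_space (r + 1)" "sq_int v"
    using v by (auto simp: weak_class_def intro: Hs_space_sq_int)
  note ub = AE_norm_le_sup_bound[OF u'(3)]
  have const: "(\<lambda>N. N2 (\<lambda>x. f x - f x)) \<longlonglongrightarrow> 0" for f :: "real^3 \<Rightarrow> 'a::euclidean_space" by (simp add: N2_eq)
  have 1: "(\<lambda>N. pairing (weak_grad u) (grad (trunc N v))) \<longlonglongrightarrow> pairing (weak_grad u) (weak_grad v)"
    and 2: "(\<lambda>N. pairing (weak_grad v) (grad (trunc N u))) \<longlonglongrightarrow> pairing (weak_grad v) (weak_grad u)"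
    by (intro pairing_tendsto const weak_grad(2) N2_grad_trunc_le(2) grad_trunc_tendsto u' v')+
  have 3: "(\<lambda>N. tri (weak_grad u) u (trunc N v)) \<longlonglongrightarrow> tri (weak_grad u) u v"
    unfolding tri_def
    by (intro pairing_tendsto const sq_int_trunc trunc_tendsto v'
        tri_bounded_advection(1)[OF weak_grad(2)[OF u'(2)] sq_int_measurable[OF u'(4)] ub sq_int_zero])
  have 4: "(\<lambda>N. tri (weak_grad v) v (trunc N u)) \<longlonglongrightarrow> tri (weak_grad v) v u"
    by (rule tri_tendsto_smooth_test(2)[OF v'(1,3) u'(3,4)])
  have 5: "(\<lambda>N. pairing (absorption r u) (trunc N v)) \<longlonglongrightarrow> pairing (absorption r u) v"
    by (intro pairing_tendsto const sq_int_trunc trunc_tendsto v' absorption_sq_int[OF r u'(4) ub])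
  have 6: "(\<lambda>N. pairing (absorption r v) (trunc N u)) \<longlonglongrightarrow> pairing (absorption r v) u"
  proof -
    obtain \<epsilon> where e: "\<epsilon> \<longlonglongrightarrow> 0" "\<And>N. AE x in TM. norm (trunc N u x - u x) \<le> \<epsilon> N"
      using trunc_tendsto_uniform[OF u'(3)] by blast
    have tm: "trunc N u \<in> borel_measurable TM" for N using sq_int_trunc sq_int_measurable by blast
    have tb: "AE x in TM. norm (trunc N u x) \<le> sup_bound u" for N using norm_trunc_le[OF u'(3)] by simp
    have "(\<lambda>N. pairing (absorption r v) (trunc N u) - pairing (absorption r v) u) \<longlonglongrightarrow> 0"
    proof (rule Lim_null_comparison)
      have "\<bar>pairing (absorption r v) (trunc N u) - pairing (absorption r v) u\<bar> \<le> \<epsilon> N * (\<integral>x. norm (v x) powr r \<partial>TM)" for N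
      proof -
        have "pairing (absorption r v) (trunc N u) - pairing (absorption r v) u = pairing (absorption r v) (\<lambda>x. trunc N u x - u x)"
          using absorption_test(1)[OF r v'(2) tm tb] absorption_test(1)[OF r v'(2) sq_int_measurable[OF u'(4)] ub]
          by (simp add: pairing_def inner_diff_right)
        then show ?thesis
          using absorption_test(2)[OF r v'(2) _ e(2)] sq_int_measurable[OF sq_int_diff[OF sq_int_trunc u'(4)]] by simp
      qed
      then show "\<forall>\<^sub>F N in sequentially. norm (pairing (absorption r v) (trunc N u) - pairing (absorption r v) u) \<le>
          \<epsilon> N * (\<integral>x. norm (v x) powr r \<partial>TM)" by simp
      show "(\<lambda>N. \<epsilon> N * (\<integral>x. norm (v x) powr r \<partial>TM)) \<longlonglongrightarrow> 0" by (rule tendsto_mult_left_zero[OF e(1)])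
    qed
    then show ?thesis by (rule LIM_zero_cancel)
  qed
  have "(\<lambda>N. (pairing (weak_grad u) (grad (trunc N v)) + tri (weak_grad u) u (trunc N v) + pairing (absorption r u) (trunc N v))
      + (pairing (weak_grad v) (grad (trunc N u)) + tri (weak_grad v) v (trunc N u) + pairing (absorption r v) (trunc N u)))
    \<longlonglongrightarrow> (pairing (weak_grad u) (weak_grad v) + tri (weak_grad u) u v + pairing (absorption r u) v)
      + (pairing (weak_grad v) (weak_grad u) + tri (weak_grad v) v u + pairing (absorption r v) u)"
    by (intro tendsto_add 1 2 3 4 5 6)
  then show ?thesis
    using pairing_commute[of "weak_grad v" "weak_grad u"] by (simp add: cbf_form_def cross_form_def algebra_simps)
qed

text \<open>
  A majorant for the truncated forms in which Young's inequality has turned products into squares;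
  \<open>m\<close> bounds the \<open>L\<^sup>2\<close> norms of \<open>u\<close> and \<open>v\<close>, and along solutions every term is integrable in time.
\<close>

definition cross_bound :: "real \<Rightarrow> real \<Rightarrow> vfield \<Rightarrow> vfield \<Rightarrow> real" where
  "cross_bound r m u v = (Hs_norm 1 u)\<^sup>2 + (Hs_norm 1 v)\<^sup>2 + m * ((sup_bound u)\<^sup>2 + (Hs_norm 1 u)\<^sup>2)
     + m * ((sup_bound u)\<^sup>2 + (Hs_norm 1 v)\<^sup>2) + (1 + (sup_bound u)\<^sup>2) * m\<^sup>2
     + ((sup_bound u)\<^sup>2 + (\<integral>x. norm (v x) powr (r + 1) \<partial>TM) * ((2 * pi) ^ 3 + m\<^sup>2))"

lemma mult_le_sum_sq: "x * y \<le> x\<^sup>2 + y\<^sup>2" if "0 \<le> x" "0 \<le> y" for x y :: real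
proof -
  have "0 \<le> x * y" using that by simp
  then show ?thesis using sum_squares_bound[of x y] by linarith
qed

lemma cbf_form_trunc_bound:
  assumes r: "1 \<le> r" "r \<le> 3" and u: "u \<in> strong_class r" and v: "v \<in> weak_class r"
    and m: "N2 u \<le> m" "N2 v \<le> m"
  shows "\<bar>cbf_form r u (trunc N v) + cbf_form r v (trunc N u)\<bar> \<le> cross_bound r m u v"
proof -
  have u': "u \<in> H_sigma" "u \<in> Hs_space 1" "u \<in> Hs_space 2" "sq_int u"
    using u by (auto simp: strong_class_def weak_class_def intro: Hs_space_sq_int)
  have v': "v \<in> Hs_space 1" "v \<in> Lp_space (r + 1)" "sq_int v"
    using v by (auto simp: weak_class_def intro: Hs_space_sq_int)
  note ub = AE_norm_le_sup_bound[OF u'(3)]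
  have m0: "0 \<le> m" using m(1) N2_nonneg[of u] by linarith
  define s where "s = sup_bound u"
  have s0: "0 \<le> s" by (simp add: s_def)
  define a where "a = Hs_norm 1 u"
  define b where "b = Hs_norm 1 v"
  have ab: "0 \<le> a" "0 \<le> b" by (simp_all add: a_def b_def)
  have gu: "N2 (weak_grad u) \<le> a" "N2 (grad (trunc N u)) \<le> a"
    using weak_grad(3)[OF u'(2)] N2_grad_trunc_le(1)[OF u'(2), of N] by (auto simp: a_def)
  have gv: "N2 (weak_grad v) \<le> b" "N2 (grad (trunc N v)) \<le> b"
    using weak_grad(3)[OF v'(1)] N2_grad_trunc_le(1)[OF v'(1), of N] by (auto simp: b_def)
  have tu: "N2 (trunc N u) \<le> m" "N2 (trunc N v) \<le> m"
    using N2_trunc_le[OF u'(4), of N] N2_trunc_le[OF v'(3), of N] m by auto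
  have tm: "trunc N u \<in> borel_measurable TM" using sq_int_trunc sq_int_measurable by blast
  have tb: "AE x in TM. norm (trunc N u x) \<le> s" using norm_trunc_le[OF u'(3)] by (simp add: s_def)
  have 1: "\<bar>pairing (weak_grad u) (grad (trunc N v))\<bar> \<le> a * b"
    using pairing_bound[OF weak_grad(2)[OF u'(2)] N2_grad_trunc_le(2)[OF v'(1)], of N]
      mult_mono[OF gu(1) gv(2) ab(1) N2_nonneg] by linarith
  have 2: "\<bar>pairing (weak_grad v) (grad (trunc N u))\<bar> \<le> a * b"
    using pairing_bound[OF weak_grad(2)[OF v'(1)] N2_grad_trunc_le(2)[OF u'(2)], of N]
      mult_mono[OF gv(1) gu(2) ab(2) N2_nonneg] by (simp add: mult.commute)
  have 3: "\<bar>tri (weak_grad u) u (trunc N v)\<bar> \<le> m * (s\<^sup>2 + a\<^sup>2)"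
  proof -
    have "\<bar>tri (weak_grad u) u (trunc N v)\<bar> \<le> s * N2 (weak_grad u) * N2 (trunc N v)"
      unfolding s_def by (rule tri_bounded_advection(2)[OF weak_grad(2)[OF u'(2)] sq_int_measurable[OF u'(4)] ub sq_int_trunc])
    also have "\<dots> \<le> s * a * m" using s0 ab gu tu by (intro mult_mono mult_nonneg_nonneg) auto
    also have "\<dots> \<le> (s\<^sup>2 + a\<^sup>2) * m" using m0 by (intro mult_right_mono mult_le_sum_sq s0 ab)
    finally show ?thesis by (simp add: mult.commute)
  qed
  have 4: "\<bar>tri (weak_grad v) v (trunc N u)\<bar> \<le> m * (s\<^sup>2 + b\<^sup>2)"
  proof -
    have "\<bar>tri (weak_grad v) v (trunc N u)\<bar> \<le> s * N2 (weak_grad v) * N2 v"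
      by (rule tri_bounded_test(2)[OF weak_grad(2)[OF v'(1)] v'(3) tm tb])
    also have "\<dots> \<le> s * b * m" using s0 ab gv m by (intro mult_mono mult_nonneg_nonneg) auto
    also have "\<dots> \<le> (s\<^sup>2 + b\<^sup>2) * m" using m0 by (intro mult_right_mono mult_le_sum_sq s0 ab)
    finally show ?thesis by (simp add: mult.commute)
  qed
  have 5: "\<bar>pairing (absorption r u) (trunc N v)\<bar> \<le> (1 + s\<^sup>2) * m\<^sup>2"
  proof -
    note A = absorption_sq_int[OF r u'(4) ub, folded s_def]
    have "\<bar>pairing (absorption r u) (trunc N v)\<bar> \<le> N2 (absorption r u) * N2 (trunc N v)"
      by (rule pairing_bound[OF A(1) sq_int_trunc])
    also have "\<dots> \<le> ((1 + s\<^sup>2) * m) * m"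
    proof (intro mult_mono tu)
      have "(1 + s\<^sup>2) * N2 u \<le> (1 + s\<^sup>2) * m" using m by (intro mult_left_mono) auto
      then show "N2 (absorption r u) \<le> (1 + s\<^sup>2) * m" using A(2) by linarith
    qed (use m0 in auto)
    finally show ?thesis by (simp add: power2_eq_square mult.assoc)
  qed
  have 6: "\<bar>pairing (absorption r v) (trunc N u)\<bar> \<le> s\<^sup>2 + (\<integral>x. norm (v x) powr (r + 1) \<partial>TM) * ((2 * pi) ^ 3 + m\<^sup>2)"
  proof -
    have "\<bar>pairing (absorption r v) (trunc N u)\<bar> \<le> s * (\<integral>x. norm (v x) powr r \<partial>TM)"
      by (rule absorption_test(2)[OF r v'(2) tm tb])
    also have "\<dots> \<le> s\<^sup>2 + (\<integral>x. norm (v x) powr r \<partial>TM)\<^sup>2" by (intro mult_le_sum_sq s0) simp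
    also have "(\<integral>x. norm (v x) powr r \<partial>TM)\<^sup>2 \<le> (\<integral>x. norm (v x) powr (r + 1) \<partial>TM) * ((2 * pi) ^ 3 + (N2 v)\<^sup>2)"
      by (rule absorption_L1_sq[OF r v'(2,3)])
    also have "\<dots> \<le> (\<integral>x. norm (v x) powr (r + 1) \<partial>TM) * ((2 * pi) ^ 3 + m\<^sup>2)"
      using m by (intro mult_left_mono add_left_mono power_mono) auto
    finally show ?thesis by simp
  qed
  have "2 * (a * b) \<le> a\<^sup>2 + b\<^sup>2" using sum_squares_bound[of a b] by simp
  then show ?thesis
    using 1 2 3 4 5 6 unfolding cbf_form_def cross_bound_def s_def[symmetric] a_def[symmetric] b_def[symmetric]
    by linarith
qed

text \<open>
  The gradient terms are \<open>- \<parallel>\<nabla>w\<parallel>\<^sup>2\<close> for \<open>w = v - u\<close>, the absorption terms are nonpositive by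
  monotonicity, and antisymmetry reduces the convective terms to \<open>\<langle>(w \<cdot> \<nabla>) w, u\<rangle>\<close>, which
  Young's inequality bounds by \<open>\<parallel>\<nabla>w\<parallel>\<^sup>2 + (sup |u|)\<^sup>2 \<parallel>w\<parallel>\<^sup>2 / 4\<close>.
\<close>

lemma cross_form_inequality:
  assumes r: "1 \<le> r" "r \<le> 3" and u: "u \<in> strong_class r" and v: "v \<in> weak_class r"
  shows "cross_form r u v - 1/2 * cross_form r u u - (N2 (weak_grad v))\<^sup>2 - (\<integral>x. norm (v x) powr (r + 1) \<partial>TM)
    \<le> (sup_bound u)\<^sup>2 / 4 * (N2 (\<lambda>x. u x - v x))\<^sup>2"
proof -
  have u': "u \<in> H_sigma" "u \<in> Hs_space 1" "u \<in> Hs_space 2" "sq_int u" "u \<in> Lp_space (r + 1)"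
    using u by (auto simp: strong_class_def weak_class_def intro: Hs_space_sq_int)
  have v': "v \<in> Hs_space 1" "v \<in> Lp_space (r + 1)" "sq_int v" "v \<in> H_sigma"
    using v by (auto simp: weak_class_def intro: Hs_space_sq_int)
  note ub = AE_norm_le_sup_bound[OF u'(3)]
  note um = sq_int_measurable[OF u'(4)]
  note Gu = weak_grad(2)[OF u'(2)]
  note Gv = weak_grad(2)[OF v'(1)]
  define s where "s = sup_bound u"
  define g where "g = N2 (\<lambda>x. weak_grad v x - weak_grad u x)"
  define w where "w = N2 (\<lambda>x. u x - v x)"
  have G: "2 * pairing (weak_grad u) (weak_grad v) - pairing (weak_grad u) (weak_grad u) - (N2 (weak_grad v))\<^sup>2 = - g\<^sup>2"
    using N2_diff_sq[OF Gv Gu] pairing_commute[of "weak_grad u" "weak_grad v"] by (simp add: g_def pairing_self)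
  have A: "pairing (absorption r u) v + pairing (absorption r v) u - pairing (absorption r u) u
      - (\<integral>x. norm (v x) powr (r + 1) \<partial>TM) \<le> 0"
  proof -
    have iuv: "integrable TM (\<lambda>x. absorption r u x \<bullet> v x)"
      and iuu: "integrable TM (\<lambda>x. absorption r u x \<bullet> u x)"
      by (intro sq_int_inner_integrable absorption_sq_int[OF r u'(4) ub] u' v')+
    have ivu: "integrable TM (\<lambda>x. absorption r v x \<bullet> u x)"
      by (rule absorption_test(1)[OF r v'(2) um ub])
    have vv: "absorption r v x \<bullet> v x = norm (v x) powr (r + 1)" for x
      by (simp add: absorption_absorb absorb_inner_self)
    have ivv: "integrable TM (\<lambda>x. absorption r v x \<bullet> v x)"
      unfolding vv using v'(2) by (simp add: Lp_space_def)
    have "0 \<le> (\<integral>x. (absorption r u x - absorption r v x) \<bullet> (u x - v x) \<partial>TM)"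
      using absorb_monotone[OF r(1)] by (intro Bochner_Integration.integral_nonneg) (simp add: absorption_absorb)
    also have "\<dots> = pairing (absorption r u) u - pairing (absorption r u) v - pairing (absorption r v) u
        + (\<integral>x. norm (v x) powr (r + 1) \<partial>TM)"
      using iuv iuu ivu ivv by (simp add: inner_diff_left inner_diff_right pairing_def vv)
    finally show ?thesis by simp
  qed
  have B: "tri (weak_grad u) u v + tri (weak_grad v) v u - tri (weak_grad u) u u \<le> g\<^sup>2 + s\<^sup>2 / 4 * w\<^sup>2"
  proof -
    have 1: "tri (weak_grad u) u v = - tri (weak_grad v) u u"
      using tri_antisym_bounded[OF u'(1-3) v'(1)] by simp
    have 2: "tri (weak_grad u) u u = 0" "tri (weak_grad u) v u = 0"
      by (intro tri_self_zero u' v')+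
    have iv: "integrable TM (\<lambda>x. (G x *v a x) \<bullet> u x)" if "sq_int G" "sq_int a"
      for G :: "real^3 \<Rightarrow> real^3^3" and a :: vfield
      by (rule tri_bounded_test(1)[OF that(1) that(2) um ub])
    have d: "sq_int (\<lambda>x. weak_grad v x - weak_grad u x)" "sq_int (\<lambda>x. v x - u x)"
      by (intro sq_int_diff Gu Gv u' v')+
    have "tri (\<lambda>x. weak_grad v x - weak_grad u x) (\<lambda>x. v x - u x) u =
        tri (weak_grad v) v u - tri (weak_grad v) u u - tri (weak_grad u) v u + tri (weak_grad u) u u"
      using iv[OF Gv v'(3)] iv[OF Gv u'(4)] iv[OF Gu v'(3)] iv[OF Gu u'(4)]
      by (simp add: tri_def pairing_def matrix_vector_mult_diff_rdistrib matrix_vector_mult_diff_distrib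
          inner_diff_left)
    then have "tri (weak_grad u) u v + tri (weak_grad v) v u - tri (weak_grad u) u u =
        tri (\<lambda>x. weak_grad v x - weak_grad u x) (\<lambda>x. v x - u x) u" using 1 2 by simp
    also have "\<dots> \<le> s * g * w"
      using tri_bounded_test(2)[OF d um ub] N2_minus[of v u] by (simp add: s_def g_def w_def)
    also have "\<dots> \<le> g\<^sup>2 + s\<^sup>2 / 4 * w\<^sup>2"
      using zero_le_power2[of "g - s * w / 2"] by (simp add: power2_diff power_mult_distrib power_divide algebra_simps)
    finally show ?thesis .
  qed
  show ?thesis
    using G A B unfolding cross_form_def s_def[symmetric] w_def[symmetric] by (simp add: field_simps)
qed

section \<open>Integration in time\<close>

lemma AE_lebesgue_on_iff:
  "S \<in> sets lebesgue \<Longrightarrow> (AE x in lebesgue_on S. P x) \<longleftrightarrow> (AE x in lebesgue. x \<in> S \<longrightarrow> P x)"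
  by (subst AE_restrict_space_iff) auto

lemma AE_open_interval_imp_closed:
  fixes T :: real
  assumes P: "AE s in lebesgue_on {0<..<T}. P s" and "t \<le> T"
  shows "AE s in lebesgue_on {0..t}. P s"
proof -
  have "{0, T} \<in> null_sets lebesgue" by (simp add: negligible_iff_null_sets[symmetric])
  then have "AE s in lebesgue. s \<notin> {0, T}" by (rule AE_not_in)
  moreover have "AE s in lebesgue. s \<in> {0<..<T} \<longrightarrow> P s" using P by (simp add: AE_lebesgue_on_iff)
  ultimately have "AE s in lebesgue. s \<in> {0..t} \<longrightarrow> P s"
    by eventually_elim (use \<open>t \<le> T\<close> in auto)
  then show ?thesis by (simp add: AE_lebesgue_on_iff)
qed

lemma measurable_closed_interval:
  fixes f :: "real \<Rightarrow> real"
  assumes "f \<in> borel_measurable (lebesgue_on {0<..<T})"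
  shows "f \<in> borel_measurable (lebesgue_on {0..T})"
proof -
  have "(\<lambda>x. if x \<in> {0<..<T} then f x else 0) \<in> borel_measurable lebesgue"
    by (subst borel_measurable_if) (use assms in auto)
  moreover have "{0, T} \<in> null_sets lebesgue" by (simp add: negligible_iff_null_sets[symmetric])
  then have "AE s in lebesgue. s \<notin> {0, T}" by (rule AE_not_in)
  then have "AE s in lebesgue. (if s \<in> {0<..<T} then f s else 0) = (if s \<in> {0..T} then f s else 0)"
    by eventually_elim auto
  ultimately have "(\<lambda>x. if x \<in> {0..T} then f x else 0) \<in> borel_measurable lebesgue"
    by (rule borel_measurable_AE)
  then show ?thesis by (subst (asm) borel_measurable_if) auto
qed

lemma integrable_closed_interval:
  fixes f :: "real \<Rightarrow> real"
  assumes "integrable (lebesgue_on {0<..<T}) f"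
  shows "integrable (lebesgue_on {0..T}) f"
proof -
  have i: "integrable lebesgue (\<lambda>x. if x \<in> {0<..<T} then f x else 0)"
    using assms by (subst Lebesgue_Measure.integrable_restrict_UNIV) auto
  have m: "(\<lambda>x. if x \<in> {0..T} then f x else 0) \<in> borel_measurable lebesgue"
    by (subst borel_measurable_if) (use measurable_closed_interval[of f T] assms in auto)
  have "{0, T} \<in> null_sets lebesgue" by (simp add: negligible_iff_null_sets[symmetric])
  then have "AE s in lebesgue. s \<notin> {0, T}" by (rule AE_not_in)
  then have "AE s in lebesgue. (if s \<in> {0<..<T} then f s else 0) = (if s \<in> {0..T} then f s else 0)"
    by eventually_elim auto
  then have "integrable lebesgue (\<lambda>x. if x \<in> {0..T} then f x else 0)"
    using i m by (subst integrable_cong_AE[symmetric, where f="\<lambda>x. if x \<in> {0<..<T} then f x else 0"]) auto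
  then show ?thesis by (subst (asm) Lebesgue_Measure.integrable_restrict_UNIV) auto
qed

text \<open>The limit need only exist almost everywhere, by completeness of Lebesgue measure.\<close>

lemma AE_limit_measurable:
  fixes F :: "nat \<Rightarrow> real \<Rightarrow> real"
  assumes S: "S \<in> sets lebesgue" and F: "\<And>n. F n \<in> borel_measurable (lebesgue_on S)"
    and lim: "AE x in lebesgue_on S. (\<lambda>n. F n x) \<longlonglongrightarrow> f x"
  shows "f \<in> borel_measurable (lebesgue_on S)"
proof -
  define g where "g x = lim (\<lambda>n. F n x)" for x
  have "g \<in> borel_measurable (lebesgue_on S)" unfolding g_def using F by measurable
  then have m: "(\<lambda>x. if x \<in> S then g x else 0) \<in> borel_measurable lebesgue"
    using S by (simp add: borel_measurable_if)
  have "AE x in lebesgue. x \<in> S \<longrightarrow> (\<lambda>n. F n x) \<longlonglongrightarrow> f x" using lim S by (simp add: AE_lebesgue_on_iff)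
  then have "AE x in lebesgue. (if x \<in> S then g x else 0) = (if x \<in> S then f x else 0)"
    by eventually_elim (auto simp: g_def limI)
  from borel_measurable_AE[OF m this] show ?thesis using S by (simp add: borel_measurable_if)
qed

lemma continuous_AE_eq:
  fixes f g :: "real \<Rightarrow> real"
  assumes "0 < T" and f: "continuous_on {0..T} f" and g: "continuous_on {0..T} g"
    and ae: "AE t in lebesgue_on {0<..<T}. f t = g t" and t: "t \<in> {0..T}"
  shows "f t = g t"
proof -
  define h where "h t = f t - g t" for t
  have h: "continuous_on {0..T} h" unfolding h_def by (intro continuous_intros f g)
  define U where "U = {t \<in> {0<..<T}. h t \<noteq> 0}"
  have "open U"
  proof -
    have "continuous_on {0<..<T} h" using h by (rule continuous_on_subset) auto
    then have "open ({0<..<T} \<inter> h -` (- {0}))"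
      by (intro continuous_open_preimage) auto
    moreover have "U = {0<..<T} \<inter> h -` (- {0})" by (auto simp: U_def)
    ultimately show ?thesis by simp
  qed
  have "AE t in lebesgue. t \<notin> U"
    using ae by (simp add: AE_lebesgue_on_iff U_def h_def) (auto elim: eventually_mono)
  then have "negligible U"
    using \<open>open U\<close> by (subst negligible_iff_null_sets) (auto simp: AE_iff_null_sets)
  then have "U = {}" using \<open>open U\<close> open_not_negligible by blast
  then have "h t = 0" if "t \<in> {0<..<T}" for t using that by (auto simp: U_def)
  moreover have "closure {0<..<T} = {0..T}" using \<open>0 < T\<close> by simp
  ultimately have "h t = 0"
    using continuous_constant_on_closure[of "{0<..<T}" h 0 t] h t by simp
  then show ?thesis by (simp add: h_def)
qed

lemma integrable_mult_continuous:
  fixes h \<Phi> :: "real \<Rightarrow> real"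
  assumes h: "integrable (lebesgue_on {a..b}) h" and c: "continuous_on {a..b} \<Phi>"
  shows "integrable (lebesgue_on {a..b}) (\<lambda>s. h s * \<Phi> s)"
proof -
  have "compact (\<Phi> ` {a..b})" by (intro compact_continuous_image c compact_Icc)
  then obtain B where B: "\<And>s. s \<in> {a..b} \<Longrightarrow> \<bar>\<Phi> s\<bar> \<le> B"
    using compact_imp_bounded bounded_iff by (metis imageI real_norm_def)
  have [measurable]: "\<Phi> \<in> borel_measurable (lebesgue_on {a..b})" "h \<in> borel_measurable (lebesgue_on {a..b})"
    using h c by (auto intro: continuous_imp_measurable_on_sets_lebesgue)
  show ?thesis
  proof (rule Bochner_Integration.integrable_bound)
    show "integrable (lebesgue_on {a..b}) (\<lambda>s. B * h s)" using h by simp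
    show "AE s in lebesgue_on {a..b}. norm (h s * \<Phi> s) \<le> norm (B * h s)"
    proof (rule AE_I2)
      fix s assume "s \<in> space (lebesgue_on {a..b})"
      then have "\<bar>\<Phi> s\<bar> \<le> \<bar>B\<bar>" using B[of s] by simp
      then have "\<bar>h s\<bar> * \<bar>\<Phi> s\<bar> \<le> \<bar>h s\<bar> * \<bar>B\<bar>" by (intro mult_left_mono) auto
      then show "norm (h s * \<Phi> s) \<le> norm (B * h s)" by (simp add: abs_mult mult.commute)
    qed
  qed measurable
qed

text \<open>The product rule for two absolutely continuous functions, from Fubini on the square \<open>[0,t]\<^sup>2\<close> cut along its diagonal.\<close>

lemma integral_product_rule:
  fixes F G :: "real \<Rightarrow> real"
  assumes F: "integrable (lebesgue_on {0..t}) F" and G: "integrable (lebesgue_on {0..t}) G"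
  shows "integral\<^sup>L (lebesgue_on {0..t}) F * integral\<^sup>L (lebesgue_on {0..t}) G =
    (\<integral>s. F s * (\<integral>x. G x \<partial>lebesgue_on {0..s}) + (\<integral>x. F x \<partial>lebesgue_on {0..s}) * G s \<partial>lebesgue_on {0..t})"
    and "integrable (lebesgue_on {0..t}) (\<lambda>s. F s * (\<integral>x. G x \<partial>lebesgue_on {0..s}))"
    and "integrable (lebesgue_on {0..t}) (\<lambda>s. (\<integral>x. F x \<partial>lebesgue_on {0..s}) * G s)"
proof -
  define M where "M = lebesgue_on {0..t}"
  have fin: "finite_measure M" unfolding M_def by (rule finite_measure_lebesgue_on) simp
  interpret M: finite_measure M by (rule fin)
  interpret P: pair_sigma_finite M M ..
  have cF: "continuous_on {0..t} (\<lambda>s. \<integral>x. F x \<partial>lebesgue_on {0..s})" by (rule indefinite_integral_continuous_real[OF F])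
  have cG: "continuous_on {0..t} (\<lambda>s. \<integral>x. G x \<partial>lebesgue_on {0..s})" by (rule indefinite_integral_continuous_real[OF G])
  have FM: "integrable M F" and GM: "integrable M G" using F G by (auto simp: M_def)
  show 1: "integrable (lebesgue_on {0..t}) (\<lambda>s. F s * (\<integral>x. G x \<partial>lebesgue_on {0..s}))"
    by (rule integrable_mult_continuous[OF F cG])
  show 2: "integrable (lebesgue_on {0..t}) (\<lambda>s. (\<integral>x. F x \<partial>lebesgue_on {0..s}) * G s)"
    using integrable_mult_continuous[OF G cF] by (simp add: mult.commute)
  have sub: "(\<integral>x. (if x \<le> s then h x else 0) \<partial>M) = (\<integral>x. h x \<partial>lebesgue_on {0..s})"
    if "s \<in> {0..t}" for h :: "real \<Rightarrow> real" and s
  proof -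
    have "(\<integral>x. (if x \<in> {0..s} then h x else 0) \<partial>lebesgue_on {0..t}) = (\<integral>x. h x \<partial>lebesgue_on ({0..s} \<inter> {0..t}))"
      by (rule Lebesgue_Measure.integral_restrict_Int) auto
    moreover have "{0..s} \<inter> {0..t} = {0..s}" using that by auto
    moreover have "(\<integral>x. (if x \<in> {0..s} then h x else 0) \<partial>lebesgue_on {0..t}) = (\<integral>x. (if x \<le> s then h x else 0) \<partial>M)"
      unfolding M_def by (intro Bochner_Integration.integral_cong refl) auto
    ultimately show ?thesis by (simp only:)
  qed
  have sub': "(\<integral>x. (if x < s then h x else 0) \<partial>M) = (\<integral>x. h x \<partial>lebesgue_on {0..s})"
    if "s \<in> {0..t}" "integrable M h" for h :: "real \<Rightarrow> real" and s
  proof -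
    have [measurable]: "h \<in> borel_measurable M" "(\<lambda>x. x) \<in> borel_measurable M"
      using that unfolding M_def by (auto intro: continuous_imp_measurable_on_sets_lebesgue)
    have "{s} \<in> null_sets lebesgue" by (simp add: negligible_iff_null_sets[symmetric])
    then have "AE x in lebesgue. x \<notin> {s}" by (rule AE_not_in)
    then have "AE x in M. x \<notin> {s}" unfolding M_def by (simp add: AE_lebesgue_on_iff) (auto elim: eventually_mono)
    then have "AE x in M. (if x < s then h x else 0) = (if x \<le> s then h x else 0)"
      by eventually_elim auto
    then have "(\<integral>x. (if x < s then h x else 0) \<partial>M) = (\<integral>x. (if x \<le> s then h x else 0) \<partial>M)"
      by (intro integral_cong_AE) measurable
    then show ?thesis using sub[OF that(1)] by simp
  qed
  \<comment> \<open>The part of the square above the diagonal, where the order of integration is exchanged.\<close>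
  define K where "K s x = (if s < x then F s * G x else 0)" for s x
  have [measurable]: "(\<lambda>x. x) \<in> borel_measurable M" "F \<in> borel_measurable M" "G \<in> borel_measurable M"
    using FM GM unfolding M_def by (auto intro: continuous_imp_measurable_on_sets_lebesgue)
  have ltm: "Measurable.pred (M \<Otimes>\<^sub>M M) (\<lambda>p. fst p < snd p)"
  proof -
    have "(\<lambda>p. fst p) \<in> borel_measurable (M \<Otimes>\<^sub>M M)"
      using measurable_compose[OF measurable_fst, of "\<lambda>x. x" M borel M] by simp
    moreover have "(\<lambda>p. snd p) \<in> borel_measurable (M \<Otimes>\<^sub>M M)"
      using measurable_compose[OF measurable_snd, of "\<lambda>x. x" M borel M] by simp
    ultimately show ?thesis by (rule borel_measurable_pred_less)
  qed
  have KI: "integrable (M \<Otimes>\<^sub>M M) (case_prod K)"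
  proof (rule P.Fubini_integrable)
    note [measurable] = ltm
    show Km: "case_prod K \<in> borel_measurable (M \<Otimes>\<^sub>M M)"
      unfolding K_def case_prod_unfold by measurable
    have Ki: "integrable M (\<lambda>x. K s x)" for s
      by (rule Bochner_Integration.integrable_bound[of _ "\<lambda>x. F s * G x"]) (use GM in \<open>auto simp: K_def\<close>)
    then show "AE s in M. integrable M (\<lambda>x. case_prod K (s, x))" by simp
    show "integrable M (\<lambda>s. \<integral>x. norm (case_prod K (s, x)) \<partial>M)"
    proof (rule Bochner_Integration.integrable_bound)
      show "integrable M (\<lambda>s. F s * (\<integral>x. \<bar>G x\<bar> \<partial>M))" using FM by simp
      show "(\<lambda>s. \<integral>x. norm (case_prod K (s, x)) \<partial>M) \<in> borel_measurable M"
        using Km by measurable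
      show "AE s in M. norm (\<integral>x. norm (case_prod K (s, x)) \<partial>M) \<le> norm (F s * (\<integral>x. \<bar>G x\<bar> \<partial>M))"
      proof (rule AE_I2)
        fix s
        have "(\<integral>x. norm (K s x) \<partial>M) \<le> (\<integral>x. \<bar>F s\<bar> * \<bar>G x\<bar> \<partial>M)"
          using Ki GM by (intro integral_mono) (auto simp: K_def abs_mult)
        then show "norm (\<integral>x. norm (case_prod K (s, x)) \<partial>M) \<le> norm (F s * (\<integral>x. \<bar>G x\<bar> \<partial>M))"
          by (simp add: abs_mult)
      qed
    qed
  qed
  have sp: "s \<in> space M \<longleftrightarrow> s \<in> {0..t}" for s by (simp add: M_def)
  have "integral\<^sup>L M F * integral\<^sup>L M G = (\<integral>s. F s * integral\<^sup>L M G \<partial>M)" by simp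
  also have "\<dots> = (\<integral>s. F s * (\<integral>x. G x \<partial>lebesgue_on {0..s}) + (\<integral>x. K s x \<partial>M) \<partial>M)"
  proof (rule Bochner_Integration.integral_cong[OF refl])
    fix s assume "s \<in> space M"
    then have s: "s \<in> {0..t}" by (simp add: sp)
    have i: "integrable M (\<lambda>x. if x \<le> s then G x else 0)" "integrable M (\<lambda>x. if s < x then G x else 0)"
      by (rule Bochner_Integration.integrable_bound[OF GM]; auto)+
    have "integral\<^sup>L M G = (\<integral>x. (if x \<le> s then G x else 0) + (if s < x then G x else 0) \<partial>M)"
      by (intro Bochner_Integration.integral_cong refl) auto
    also have "\<dots> = (\<integral>x. G x \<partial>lebesgue_on {0..s}) + (\<integral>x. (if s < x then G x else 0) \<partial>M)"
      using i by (simp add: sub[OF s])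
    finally have "F s * integral\<^sup>L M G = F s * (\<integral>x. G x \<partial>lebesgue_on {0..s}) + (\<integral>x. F s * (if s < x then G x else 0) \<partial>M)"
      by (simp add: distrib_left)
    also have "(\<lambda>x. F s * (if s < x then G x else 0)) = K s" by (auto simp: K_def)
    finally show "F s * integral\<^sup>L M G = F s * (\<integral>x. G x \<partial>lebesgue_on {0..s}) + (\<integral>x. K s x \<partial>M)" .
  qed
  also have "\<dots> = (\<integral>s. F s * (\<integral>x. G x \<partial>lebesgue_on {0..s}) \<partial>M) + (\<integral>s. (\<integral>x. K s x \<partial>M) \<partial>M)"
    using 1 P.integrable_fst'[OF KI] by (simp add: M_def)
  also have "(\<integral>s. (\<integral>x. K s x \<partial>M) \<partial>M) = (\<integral>x. (\<integral>s. K s x \<partial>M) \<partial>M)"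
    by (rule P.Fubini_integral[OF KI, symmetric])
  also have "\<dots> = (\<integral>x. (\<integral>s. F s \<partial>lebesgue_on {0..x}) * G x \<partial>M)"
  proof (rule Bochner_Integration.integral_cong[OF refl])
    fix x assume "x \<in> space M"
    then have x: "x \<in> {0..t}" by (simp add: sp)
    have "(\<lambda>s. K s x) = (\<lambda>s. (if s < x then F s else 0) * G x)" by (auto simp: K_def)
    then show "(\<integral>s. K s x \<partial>M) = (\<integral>s. F s \<partial>lebesgue_on {0..x}) * G x"
      using sub'[OF x FM] by simp
  qed
  finally show "integral\<^sup>L (lebesgue_on {0..t}) F * integral\<^sup>L (lebesgue_on {0..t}) G =
    (\<integral>s. F s * (\<integral>x. G x \<partial>lebesgue_on {0..s}) + (\<integral>x. F x \<partial>lebesgue_on {0..s}) * G s \<partial>lebesgue_on {0..t})"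
    using 1 2 by (simp add: M_def)
qed

lemma product_rule:
  fixes F G f g :: "real \<Rightarrow> real"
  assumes F: "integrable (lebesgue_on {0..t}) F" and G: "integrable (lebesgue_on {0..t}) G" and "0 \<le> t"
    and f: "\<And>s. s \<in> {0..t} \<Longrightarrow> f s = f0 + (\<integral>x. F x \<partial>lebesgue_on {0..s})"
    and g: "\<And>s. s \<in> {0..t} \<Longrightarrow> g s = g0 + (\<integral>x. G x \<partial>lebesgue_on {0..s})"
  shows "f t * g t = f0 * g0 + (\<integral>s. F s * g s + f s * G s \<partial>lebesgue_on {0..t})"
    and "integrable (lebesgue_on {0..t}) (\<lambda>s. F s * g s + f s * G s)"
proof -
  note I = integral_product_rule[OF F G]
  let ?h = "\<lambda>s. g0 * F s + f0 * G s + (F s * (\<integral>x. G x \<partial>lebesgue_on {0..s}) + (\<integral>x. F x \<partial>lebesgue_on {0..s}) * G s)"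
  have e: "F s * g s + f s * G s = ?h s" if "s \<in> space (lebesgue_on {0..t})" for s
    using that f[of s] g[of s] by (simp add: algebra_simps)
  have i: "integrable (lebesgue_on {0..t}) ?h"
    using I(2,3) F G by (intro Bochner_Integration.integrable_add) auto
  then show "integrable (lebesgue_on {0..t}) (\<lambda>s. F s * g s + f s * G s)"
    using e by (subst Bochner_Integration.integrable_cong[OF refl, of _ _ ?h]) auto
  have "(\<integral>s. F s * g s + f s * G s \<partial>lebesgue_on {0..t}) = integral\<^sup>L (lebesgue_on {0..t}) ?h"
    by (rule Bochner_Integration.integral_cong[OF refl e])
  also have "\<dots> = g0 * integral\<^sup>L (lebesgue_on {0..t}) F + f0 * integral\<^sup>L (lebesgue_on {0..t}) G +
      integral\<^sup>L (lebesgue_on {0..t}) F * integral\<^sup>L (lebesgue_on {0..t}) G"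
    unfolding I(1) using F G I(2,3) by (simp add: Bochner_Integration.integral_add)
  finally show "f t * g t = f0 * g0 + (\<integral>s. F s * g s + f s * G s \<partial>lebesgue_on {0..t})"
    using f[of t] g[of t] \<open>0 \<le> t\<close> by (simp add: algebra_simps)
qed

text \<open>
  Gronwall's inequality, on steps so short that the integral of \<open>g\<close> over each is at most \<open>1/2\<close>:
  there the maximum of \<open>Y\<close> is at most half of itself.
\<close>

lemma gronwall_zero:
  fixes g Y :: "real \<Rightarrow> real"
  assumes g: "integrable (lebesgue_on {0..T}) g" and g0: "\<And>s. 0 \<le> g s"
    and Y: "continuous_on {0..T} Y" and Y0: "\<And>s. s \<in> {0..T} \<Longrightarrow> 0 \<le> Y s"
    and le: "\<And>t. t \<in> {0..T} \<Longrightarrow> Y t \<le> (\<integral>s. g s * Y s \<partial>lebesgue_on {0..t})"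
    and t: "t \<in> {0..T}"
  shows "Y t = 0"
proof -
  have T: "0 \<le> T" using t by simp
  define G where "G t = integral {0..t} g" for t
  have gi: "g integrable_on {0..T}" by (simp add: g integrable_on_lebesgue_on)
  have "continuous_on {0..T} G"
    unfolding G_def using indefinite_integral_continuous_1[OF gi] by simp
  then have "uniformly_continuous_on {0..T} G" by (rule compact_uniformly_continuous) simp
  then obtain \<delta> where d: "0 < \<delta>" "\<And>x y. x \<in> {0..T} \<Longrightarrow> y \<in> {0..T} \<Longrightarrow> dist y x < \<delta> \<Longrightarrow> dist (G y) (G x) < 1/2"
    unfolding uniformly_continuous_on_def by (metis half_gt_zero zero_less_one)
  have gYi: "integrable (lebesgue_on {0..t}) (\<lambda>s. g s * Y s)" if "t \<in> {0..T}" for t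
    by (rule integrable_subinterval[OF integrable_mult_continuous[OF g Y]]) (use that in auto)
  have step: "\<forall>s\<in>{0..b}. Y s = 0"
    if a: "a \<in> {0..T}" "\<forall>s\<in>{0..a}. Y s = 0" and b: "b \<in> {a..T}" "b - a < \<delta>" for a b
  proof -
    have ne: "{a..b} \<noteq> {}" using b by auto
    have "continuous_on {a..b} Y" using Y by (rule continuous_on_subset) (use a b in auto)
    then obtain m where m: "m \<in> {a..b}" "\<And>s. s \<in> {a..b} \<Longrightarrow> Y s \<le> Y m"
      using continuous_attains_sup[of "{a..b}" Y] ne by auto
    have mT: "m \<in> {0..T}" using m a b by auto
    have gYm: "(\<lambda>s. g s * Y s) integrable_on {0..m}" by (simp add: gYi[OF mT] integrable_on_lebesgue_on)
    have "Y m \<le> integral {0..m} (\<lambda>s. g s * Y s)"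
      using le[OF mT] lebesgue_integral_eq_integral[OF gYi[OF mT]] by simp
    also have "\<dots> = integral {0..a} (\<lambda>s. g s * Y s) + integral {a..m} (\<lambda>s. g s * Y s)"
      by (rule Henstock_Kurzweil_Integration.integral_combine[symmetric]) (use a m gYm in auto)
    also have "integral {0..a} (\<lambda>s. g s * Y s) = integral {0..a} (\<lambda>s. 0)"
      by (intro Henstock_Kurzweil_Integration.integral_cong) (use a in auto)
    also have "integral {a..m} (\<lambda>s. g s * Y s) \<le> integral {a..m} (\<lambda>s. g s * Y m)"
    proof (rule integral_le)
      show "(\<lambda>s. g s * Y s) integrable_on {a..m}"
        by (rule integrable_on_subinterval[OF gYm]) (use a in auto)
      show "(\<lambda>s. g s * Y m) integrable_on {a..m}"
        by (intro integrable_on_mult_left integrable_on_subinterval[OF gi]) (use a mT in auto)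
      show "g s * Y s \<le> g s * Y m" if "s \<in> {a..m}" for s
        using that m g0 by (intro mult_left_mono) auto
    qed
    also have "integral {a..m} (\<lambda>s. g s * Y m) = (G m - G a) * Y m"
    proof -
      have "G m = G a + integral {a..m} g"
        unfolding G_def
        by (rule Henstock_Kurzweil_Integration.integral_combine[symmetric])
          (use a m integrable_on_subinterval[OF gi, of 0 m] mT in auto)
      then show ?thesis by (simp add: mult.commute)
    qed
    also have "(G m - G a) * Y m \<le> 1/2 * Y m"
    proof (rule mult_right_mono)
      have "dist m a < \<delta>" using m b by (auto simp: dist_real_def)
      then have "\<bar>G m - G a\<bar> < 1/2" using d(2)[OF a(1) mT] by (simp add: dist_real_def)
      then show "G m - G a \<le> 1/2" by linarith
    qed (rule Y0[OF mT])
    finally have "Y m \<le> 0" by simp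
    then have "Y s = 0" if "s \<in> {a..b}" for s
      using m(2)[OF that] Y0[of s] that a b by force
    then show ?thesis using a(2) by fastforce
  qed
  \<comment> \<open>Steps of length \<open>\<delta>/2\<close>, since \<open>step\<close> needs a length strictly below \<open>\<delta>\<close>.\<close>
  have "\<forall>s\<in>{0..min T (real n * (\<delta> / 2))}. Y s = 0" for n
  proof (induction n)
    case 0
    have "integral\<^sup>L (lebesgue_on {0..0}) (\<lambda>s. g s * Y s) = 0"
      using lebesgue_integral_eq_integral[OF gYi[of 0]] T by simp
    then have "Y 0 = 0" using le[of 0] Y0[of 0] T by simp
    then show ?case using T by simp
  next
    case (Suc n)
    show ?case
      by (rule step[OF _ Suc.IH]) (use T d(1) in \<open>auto simp: min_def algebra_simps\<close>)
  qed
  moreover obtain n where "T \<le> real n * (\<delta> / 2)"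
    using reals_Archimedean3[of "\<delta> / 2"] d(1) by (metis half_gt_zero less_imp_le)
  ultimately have "\<forall>s\<in>{0..T}. Y s = 0" by (metis min.absorb1)
  then show ?thesis using t by blast
qed

section \<open>A smooth cutoff in time\<close>

text \<open>The derivative of \<open>1/f\<close> is \<open>- f' / f\<^sup>2\<close>, again a product of \<open>1/f\<close> and smooth functions.\<close>

lemma smooth_inverse:
  fixes f :: "'a::euclidean_space \<Rightarrow> real"
  assumes f: "smooth f" and nz: "\<And>x. f x \<noteq> 0"
  shows "smooth (\<lambda>x. inverse (f x))"
proof -
  have "C_diff k (\<lambda>x. inverse (f x))" for k
  proof (induction k)
    case 0
    then show ?case using smooth_frechet(3)[OF f] nz by (auto intro: continuous_on_inverse)
  next
    case (Suc k)
    have der: "((\<lambda>x. inverse (f x)) has_derivative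
        (\<lambda>v. (- 1) *\<^sub>R (inverse (f x) *\<^sub>R (inverse (f x) *\<^sub>R frechet_derivative f (at x) v)))) (at x)" for x
      using Deriv.has_derivative_inverse[OF nz smooth_frechet(1)[OF f], of x] by (simp add: mult_ac)
    have C: "C_diff k (\<lambda>x. frechet_derivative f (at x) v)" for v
      using f by (metis C_diff.simps(2) smooth_def)
    have "C_diff k (\<lambda>x :: 'a. - 1 :: real)" using smooth_const[where 'a='a and c="- 1 :: real"] unfolding smooth_def by blast
    then have "C_diff k (\<lambda>x. (- 1) *\<^sub>R (inverse (f x) *\<^sub>R (inverse (f x) *\<^sub>R frechet_derivative f (at x) v)))" for v
      by (intro C_diff_scaleR Suc C)
    then show ?case
      using has_derivative_imp_differentiable[OF der] by (simp add: frechet_derivative_at[OF der, symmetric])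
  qed
  then show ?thesis by (simp add: smooth_def)
qed

text \<open>\<open>exp_flat 0 x = exp (-1/x)\<close> for \<open>x > 0\<close>, and \<open>exp_flat n\<close> is its \<open>n\<close>-th derivative.\<close>

fun flat_poly :: "nat \<Rightarrow> real poly" where
  "flat_poly 0 = 1"
| "flat_poly (Suc n) = [:0, 0, 1:] * (flat_poly n - pderiv (flat_poly n))"

definition exp_flat :: "nat \<Rightarrow> real \<Rightarrow> real" where
  "exp_flat n x = (if x \<le> 0 then 0 else poly (flat_poly n) (1 / x) * exp (- (1 / x)))"

lemma poly_times_exp_minus_tendsto: "((\<lambda>y. poly p y * exp (- y)) \<longlongrightarrow> 0) at_top" for p :: "real poly"
proof -
  have "((\<lambda>y. \<Sum>i\<le>degree p. coeff p i * (y ^ i / exp y)) \<longlongrightarrow> (\<Sum>i\<le>degree p. coeff p i * 0)) at_top"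
    by (intro tendsto_sum tendsto_mult tendsto_const tendsto_power_div_exp_0)
  then show ?thesis
    by (simp add: poly_altdef sum_distrib_right exp_minus divide_inverse mult.assoc)
qed

lemma exp_flat_deriv: "(exp_flat n has_real_derivative exp_flat (Suc n) x) (at x)"
proof -
  consider "x < 0" | "x = 0" | "0 < x" by linarith
  then show ?thesis
  proof cases
    case 1
    have "((\<lambda>x. 0) has_real_derivative exp_flat (Suc n) x) (at x)"
      using 1 by (simp add: exp_flat_def)
    then show ?thesis
    proof (rule has_field_derivative_transform_within_open[where S="{..<0}"])
    qed (use 1 in \<open>auto simp: exp_flat_def\<close>)
  next
    case 2
    have "((\<lambda>h. exp_flat n h / h) \<longlongrightarrow> 0) (at_right 0)"
    proof -
      have "((\<lambda>h. poly ([:0, 1:] * flat_poly n) (inverse h) * exp (- inverse h)) \<longlongrightarrow> 0) (at_right (0 :: real))"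
        by (rule filterlim_compose[OF poly_times_exp_minus_tendsto filterlim_inverse_at_top_right])
      moreover have "\<forall>\<^sub>F h in at_right 0. poly ([:0, 1:] * flat_poly n) (inverse h) * exp (- inverse h) = exp_flat n h / h"
        using eventually_at_right_less[of 0] by eventually_elim (auto simp: exp_flat_def field_simps)
      ultimately show ?thesis by (simp add: filterlim_cong)
    qed
    moreover have "((\<lambda>h. exp_flat n h / h) \<longlongrightarrow> 0) (at_left 0)"
    proof (rule tendsto_eventually)
      show "\<forall>\<^sub>F h in at_left 0. exp_flat n h / h = 0"
        unfolding eventually_at_left_field by (intro exI[of _ "- 1"]) (auto simp: exp_flat_def)
    qed
    ultimately have "((\<lambda>h. exp_flat n h / h) \<longlongrightarrow> 0) (at 0)"
      by (simp add: filterlim_at_split)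
    then show ?thesis using 2 by (simp add: has_field_derivative_iff exp_flat_def)
  next
    case 3
    have "((\<lambda>x. poly (flat_poly n) (1 / x) * exp (- (1 / x))) has_real_derivative exp_flat (Suc n) x) (at x)"
      using 3 by (auto intro!: derivative_eq_intros simp: exp_flat_def power2_eq_square field_simps)
    then show ?thesis
      by (rule has_field_derivative_transform_within_open[where S="{0<..}"])
        (use 3 in \<open>auto simp: exp_flat_def\<close>)
  qed
qed

text \<open>
  The usual quotient of translates of \<open>exp (-1/x)\<close>; its denominator is positive because every \<open>s\<close> is to
  the left of \<open>b\<close> or to the right of \<open>a\<close>.
\<close>

lemma smooth_time_cutoff:
  assumes "a < b"
  shows "\<exists>\<eta> :: real \<Rightarrow> real. smooth \<eta> \<and> (\<forall>s\<le>a. \<eta> s = 1) \<and> (\<forall>s\<ge>b. \<eta> s = 0)"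
proof -
  have s: "smooth (\<lambda>s. exp_flat 0 (c * s + d))" for c d
    using smooth_linear_compose[of exp_flat "\<lambda>s. c * s" d "1 :: real"] exp_flat_deriv
    by (simp add: bounded_linear_mult_right)
  define \<eta> where "\<eta> s = exp_flat 0 (- 1 * s + b) *\<^sub>R inverse (exp_flat 0 (- 1 * s + b) + exp_flat 0 (1 * s + (- a)))" for s
  have pos: "exp_flat 0 x > 0 \<longleftrightarrow> x > 0" "0 \<le> exp_flat 0 x" "x \<le> 0 \<Longrightarrow> exp_flat 0 x = 0" for x
    by (auto simp: exp_flat_def)
  have nz: "exp_flat 0 (- 1 * s + b) + exp_flat 0 (1 * s + (- a)) \<noteq> 0" for s
  proof -
    have "0 < - 1 * s + b \<or> 0 < 1 * s + (- a)" using assms by linarith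
    then have "0 < exp_flat 0 (- 1 * s + b) \<or> 0 < exp_flat 0 (1 * s + (- a))" using pos(1) by blast
    then show ?thesis using pos(2)[of "- 1 * s + b"] pos(2)[of "1 * s + (- a)"] by linarith
  qed
  have "smooth \<eta>" unfolding \<eta>_def by (intro smooth_scaleR smooth_inverse smooth_add s nz)
  moreover have "\<eta> s = 1" if "s \<le> a" for s
    using nz[of s] pos(3)[of "s - a"] that by (simp add: \<eta>_def)
  moreover have "\<eta> s = 0" if "s \<ge> b" for s
    using pos(3)[of "b - s"] that by (simp add: \<eta>_def)
  ultimately show ?thesis by blast
qed

section \<open>Measurability in time\<close>

text \<open>
  Along simple functions of time the functional is a simple function, and it converges to the functional
  along \<open>f\<close>.
\<close>

lemma Bochner_functional_measurable:
  assumes f: "Bochner_measurable T X N f"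
    and F: "\<And>g h. (\<And>n. g n \<in> X) \<Longrightarrow> h \<in> X \<Longrightarrow> (\<lambda>n. N (\<lambda>x. g n x - h x)) \<longlonglongrightarrow> 0 \<Longrightarrow> (\<lambda>n. F (g n)) \<longlonglongrightarrow> F h"
  shows "(\<lambda>t. F (f t) :: real) \<in> borel_measurable (lebesgue_on {0..T})"
proof (rule measurable_closed_interval)
  obtain S where S: "\<And>n. simple_function (lebesgue_on {0<..<T}) (S n)" "\<And>n t. t \<in> {0<..<T} \<Longrightarrow> S n t \<in> X"
    and lim: "AE t in lebesgue_on {0<..<T}. (\<lambda>n::nat. N (\<lambda>x. S n t x - f t x)) \<longlonglongrightarrow> 0"
    using f unfolding Bochner_measurable_def by blast
  have fX: "AE t in lebesgue_on {0<..<T}. f t \<in> X" using f by (simp add: Bochner_measurable_def)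
  show "(\<lambda>t. F (f t)) \<in> borel_measurable (lebesgue_on {0<..<T})"
  proof (rule AE_limit_measurable[where F="\<lambda>n t. F (S n t)"])
    show "(\<lambda>t. F (S n t)) \<in> borel_measurable (lebesgue_on {0<..<T})" for n
      using simple_function_compose[OF S(1), of F n] by (simp add: o_def borel_measurable_simple_function)
    have "AE t in lebesgue_on {0<..<T}. t \<in> {0<..<T}" by (simp add: AE_lebesgue_on_iff)
    then show "AE t in lebesgue_on {0<..<T}. (\<lambda>n. F (S n t)) \<longlonglongrightarrow> F (f t)"
      using lim fX by eventually_elim (rule F, auto intro: S)
  qed simp
qed

lemma V_space_Hs: "f \<in> V_space s \<Longrightarrow> f \<in> Hs_space s"
  by (simp add: V_space_def)

lemma Hs_norm_tendsto_weak_grad: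
  assumes g: "\<And>n. g n \<in> Hs_space 1" and h: "h \<in> Hs_space 1" and lim: "(\<lambda>n. Hs_norm 1 (\<lambda>x. g n x - h x)) \<longlonglongrightarrow> 0"
  shows "(\<lambda>n. N2 (\<lambda>x. g n x - h x)) \<longlonglongrightarrow> 0"
    and "(\<lambda>n. N2 (\<lambda>x. weak_grad (g n) x - weak_grad h x)) \<longlonglongrightarrow> 0"
proof -
  have d: "(\<lambda>x. g n x - h x) \<in> Hs_space 1" for n by (intro Hs_space_diff g h)
  show "(\<lambda>n. N2 (\<lambda>x. g n x - h x)) \<longlonglongrightarrow> 0"
    by (rule Lim_null_comparison[OF _ lim]) (use N2_le_Hs_norm[OF d] in simp)
  have "N2 (\<lambda>x. weak_grad (g n) x - weak_grad h x) = N2 (weak_grad (\<lambda>x. g n x - h x))" for n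
  proof (rule N2_cong_AE)
    show "AE x in TM. weak_grad (g n) x - weak_grad h x = weak_grad (\<lambda>x. g n x - h x) x"
      using weak_grad_diff[OF g[of n] h] by eventually_elim simp
  qed (use sq_int_measurable[OF sq_int_diff[OF weak_grad(2)[OF g] weak_grad(2)[OF h]]]
      sq_int_measurable[OF weak_grad(2)[OF d]] in auto)
  then show "(\<lambda>n. N2 (\<lambda>x. weak_grad (g n) x - weak_grad h x)) \<longlonglongrightarrow> 0"
    by (intro Lim_null_comparison[OF _ lim]) (use weak_grad(3)[OF d] in simp)
qed

lemma frame_bounded: "\<exists>B. \<forall>x. norm (frame j x) \<le> B"
proof -
  obtain k \<theta> i where j: "j = (k, \<theta>, i)" by (cases j)
  have "norm (frame j x) \<le> norm (freq_proj k (axis i 1))" for x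
    using mult_right_mono[OF abs_wave_le norm_ge_zero] by (simp add: frame_def j)
  then show ?thesis by blast
qed

lemma frame_regular: "smooth (frame j)" "periodic (frame j)" "divergence (frame j) x = 0" "sq_int (frame j)"
    "sq_int (grad (frame j))" "frame j \<in> borel_measurable TM"
proof -
  show s: "smooth (frame j)" "periodic (frame j)" "divergence (frame j) x = 0" "sq_int (frame j)"
    using frame_D_sigma[of j] by (auto simp: D_sigma_def intro: sq_int_continuous smooth_frechet(3))
  show "sq_int (grad (frame j))"
    by (rule sq_int_continuous) (use continuous_grad[OF s(1)] in simp)
  show "frame j \<in> borel_measurable TM" using s(4) by (rule sq_int_measurable)
qed

lemma tri_tendsto_Hs:
  assumes g: "\<And>n. g n \<in> Hs_space 1" and h: "h \<in> Hs_space 1" and lim: "(\<lambda>n. Hs_norm 1 (\<lambda>x. g n x - h x)) \<longlonglongrightarrow> 0"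
  shows "(\<lambda>n. tri (weak_grad (g n)) (g n) (frame j)) \<longlonglongrightarrow> tri (weak_grad h) h (frame j)"
proof -
  obtain B where B: "\<And>x. norm (frame j x) \<le> B" using frame_bounded by blast
  then have ae: "AE x in TM. norm (frame j x) \<le> B" by simp
  note t = tri_bounded_test[OF _ _ frame_regular(6) ae]
  note G = weak_grad(2)[OF g] and H = weak_grad(2)[OF h]
  have s: "sq_int (g n)" "sq_int h" for n using g h by (auto intro: Hs_space_sq_int)
  have "\<bar>tri (weak_grad (g n)) (g n) (frame j) - tri (weak_grad h) h (frame j)\<bar> \<le>
      B * N2 (\<lambda>x. weak_grad (g n) x - weak_grad h x) * N2 (g n) + B * N2 (weak_grad h) * N2 (\<lambda>x. g n x - h x)" for n
  proof -
    have "tri (weak_grad (g n)) (g n) (frame j) - tri (weak_grad h) h (frame j) =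
        tri (\<lambda>x. weak_grad (g n) x - weak_grad h x) (g n) (frame j) + tri (weak_grad h) (\<lambda>x. g n x - h x) (frame j)"
      using t(1)[OF G s(1)] t(1)[OF H s(1)] t(1)[OF H s(2)]
      by (simp add: tri_def pairing_def matrix_vector_mult_diff_rdistrib matrix_vector_mult_diff_distrib inner_diff_left)
    then show ?thesis
      using t(2)[OF sq_int_diff[OF G H] s(1), of n n] t(2)[OF H sq_int_diff[OF s(1) s(2)], of n] by linarith
  qed
  then have ev: "\<forall>\<^sub>F n in sequentially. norm (tri (weak_grad (g n)) (g n) (frame j) - tri (weak_grad h) h (frame j)) \<le>
      B * N2 (\<lambda>x. weak_grad (g n) x - weak_grad h x) * N2 (g n) + B * N2 (weak_grad h) * N2 (\<lambda>x. g n x - h x)" by simp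
  note L = Hs_norm_tendsto_weak_grad[OF g h lim]
  have "(\<lambda>n. B * N2 (\<lambda>x. weak_grad (g n) x - weak_grad h x) * N2 (g n) + B * N2 (weak_grad h) * N2 (\<lambda>x. g n x - h x))
      \<longlonglongrightarrow> B * 0 * N2 h + B * N2 (weak_grad h) * 0"
    by (intro tendsto_intros L N2_tendsto s)
  then show ?thesis
    by (intro LIM_zero_cancel[OF Lim_null_comparison[OF ev]]) simp
qed

subsection \<open>Continuity of the absorption term from $L^{r+1}$ to $L^1$\<close>

text \<open>
  Either \<open>|a - b|\<close> is at most \<open>\<epsilon>\<close> times \<open>max 1 |a| |a - b|\<close>, or that maximum is at most
  \<open>|a - b|/\<epsilon>\<close>.
\<close>

lemma absorb_diff_epsilon:
  assumes r: "1 \<le> r" "r \<le> 3" and e: "0 < \<epsilon>" "\<epsilon> \<le> 1"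
  shows "norm (absorb r a - absorb r b) \<le>
    12 * \<epsilon> * (1 + norm b powr (r + 1) + norm (a - b) powr (r + 1)) + 12 * (1 / \<epsilon>) powr (r + 1) * norm (a - b) powr (r + 1)"
proof -
  define d where "d = norm (a - b)"
  define m where "m = max 1 (max (norm b) d)"
  have m: "1 \<le> m" "norm b \<le> m" "d \<le> m" and d0: "0 \<le> d" by (auto simp: m_def d_def)
  have "norm a \<le> norm b + d" using norm_triangle_ineq2[of a b] by (simp add: d_def)
  then have mx: "max (norm a) (norm b) \<le> 2 * m" using m by linarith
  have "max (norm a) (norm b) powr (r - 1) \<le> (2 * m) powr (r - 1)"
    using mx r by (intro powr_mono2) (auto simp: le_max_iff_disj)
  also have "\<dots> = 2 powr (r - 1) * m powr (r - 1)" using m by (simp add: powr_mult)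
  also have "\<dots> \<le> 4 * m powr (r - 1)"
  proof (rule mult_right_mono)
    have "(2::real) powr (r - 1) \<le> 2 powr 2" using r by (intro powr_mono) auto
    then show "(2::real) powr (r - 1) \<le> 4" by simp
  qed simp
  finally have "3 * max (norm a) (norm b) powr (r - 1) * d \<le> 3 * (4 * m powr (r - 1)) * d"
    using d0 by (intro mult_right_mono mult_left_mono) auto
  then have le: "norm (absorb r a - absorb r b) \<le> 12 * (m powr (r - 1) * d)"
    using absorb_lipschitz[OF r, of a b] unfolding d_def[symmetric] by linarith
  show ?thesis
  proof (cases "d \<le> \<epsilon> * m")
    case True
    have "m powr (r - 1) * d \<le> m powr (r - 1) * (\<epsilon> * m)" using True by (intro mult_left_mono) auto
    also have "\<dots> = \<epsilon> * m powr r" using powr_minus_one_mult[of m r] m by (simp add: algebra_simps)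
    also have "\<dots> \<le> \<epsilon> * m powr (r + 1)" using e m by (intro mult_left_mono powr_mono) auto
    also have "\<dots> \<le> \<epsilon> * (1 + norm b powr (r + 1) + d powr (r + 1))"
    proof (rule mult_left_mono)
      have "m = 1 \<or> m = norm b \<or> m = d" by (auto simp: m_def max_def)
      then show "m powr (r + 1) \<le> 1 + norm b powr (r + 1) + d powr (r + 1)"
        using powr_ge_zero[of "norm b" "r + 1"] powr_ge_zero[of d "r + 1"] by auto
    qed (use e in simp)
    finally have "12 * (m powr (r - 1) * d) \<le> 12 * \<epsilon> * (1 + norm b powr (r + 1) + d powr (r + 1))" by simp
    moreover have "0 \<le> 12 * (1 / \<epsilon>) powr (r + 1) * d powr (r + 1)" by simp
    ultimately show ?thesis using le unfolding d_def[symmetric] by linarith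
  next
    case False
    define z where "z = d / \<epsilon>"
    have z: "m \<le> z" "d \<le> z" using False e d0 by (auto simp: z_def field_simps mult_left_le mult_left_le_one_le)
    have z1: "1 \<le> z" using z m by linarith
    have "m powr (r - 1) * d \<le> z powr (r - 1) * z"
      using z m d0 r by (intro mult_mono powr_mono2) auto
    also have "\<dots> = z powr r" using z1 by (simp add: powr_minus_one_mult)
    also have "\<dots> \<le> z powr (r + 1)" using z1 by (intro powr_mono) auto
    also have "\<dots> = (1 / \<epsilon>) powr (r + 1) * d powr (r + 1)"
      using powr_mult[of "1 / \<epsilon>" d "r + 1"] e d0 by (simp add: z_def)
    finally have "12 * (m powr (r - 1) * d) \<le> 12 * (1 / \<epsilon>) powr (r + 1) * d powr (r + 1)" by simp
    moreover have "0 \<le> 12 * \<epsilon> * (1 + norm b powr (r + 1) + d powr (r + 1))"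
      using e by (intro mult_nonneg_nonneg add_nonneg_nonneg) auto
    ultimately show ?thesis using le unfolding d_def[symmetric] by linarith
  qed
qed

lemma Lp_space_diff:
  assumes f: "f \<in> Lp_space p" and g: "g \<in> Lp_space p" and p: "0 \<le> p"
  shows "integrable TM (\<lambda>x. norm (f x - g x) powr p)"
proof (rule Bochner_Integration.integrable_bound)
  have [measurable]: "f \<in> borel_measurable TM" "g \<in> borel_measurable TM" using f g by (auto simp: Lp_space_def)
  show "integrable TM (\<lambda>x. 2 powr p * (norm (f x) powr p + norm (g x) powr p))"
    using f g by (simp add: Lp_space_def)
  have "norm (f x - g x) powr p \<le> 2 powr p * (norm (f x) powr p + norm (g x) powr p)" for x
  proof -
    define m where "m = max (norm (f x)) (norm (g x))"
    have "norm (f x - g x) \<le> 2 * m" using norm_triangle_ineq4[of "f x" "g x"] by (simp add: m_def)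
    then have "norm (f x - g x) powr p \<le> (2 * m) powr p" using p by (intro powr_mono2) auto
    also have "\<dots> = 2 powr p * m powr p" by (simp add: powr_mult m_def le_max_iff_disj)
    also have "\<dots> \<le> 2 powr p * (norm (f x) powr p + norm (g x) powr p)"
      by (intro mult_left_mono) (auto simp: m_def max_def)
    finally show ?thesis .
  qed
  then show "AE x in TM. norm (norm (f x - g x) powr p) \<le> norm (2 powr p * (norm (f x) powr p + norm (g x) powr p))"
    by simp
  show "(\<lambda>x. norm (f x - g x) powr p) \<in> borel_measurable TM" by measurable
qed

lemma Lp_norm_powr: "0 < p \<Longrightarrow> Lp_norm p f powr p = (\<integral>x. norm (f x) powr p \<partial>TM)"
  by (simp add: Lp_norm_def powr_powr)

text \<open>
  Given \<open>\<epsilon>\<close>, the bound of \<open>absorb_diff_epsilon\<close> integrates to a multiple of \<open>\<epsilon>\<close> plus a term that tends to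
  \<open>0\<close>; \<open>\<epsilon>\<close> is then sent to \<open>0\<close>.
\<close>

lemma absorption_tendsto_Lp:
  assumes r: "1 \<le> r" "r \<le> 3" and g: "\<And>n. g n \<in> Lp_space (r + 1)" and h: "h \<in> Lp_space (r + 1)"
    and lim: "(\<lambda>n. Lp_norm (r + 1) (\<lambda>x. g n x - h x)) \<longlonglongrightarrow> 0"
  shows "(\<lambda>n. pairing (absorption r (g n)) (frame j)) \<longlonglongrightarrow> pairing (absorption r h) (frame j)"
proof -
  obtain B where B: "\<And>x. norm (frame j x) \<le> B" using frame_bounded by blast
  then have ae: "AE x in TM. norm (frame j x) \<le> B" by simp
  have B0: "0 \<le> B" using B[of 0] norm_ge_zero order_trans by blast
  define P where "P = (2 * pi) ^ 3 + (\<integral>x. norm (h x) powr (r + 1) \<partial>TM)"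
  have P0: "0 \<le> P" unfolding P_def by (intro add_nonneg_nonneg Bochner_Integration.integral_nonneg) auto
  define \<delta> where "\<delta> n = (\<integral>x. norm (g n x - h x) powr (r + 1) \<partial>TM)" for n
  have d0: "0 \<le> \<delta> n" for n unfolding \<delta>_def by (intro Bochner_Integration.integral_nonneg) auto
  have "(\<lambda>n. Lp_norm (r + 1) (\<lambda>x. g n x - h x) powr (r + 1)) \<longlonglongrightarrow> 0 powr (r + 1)"
    by (rule tendsto_powr2[OF lim tendsto_const]) (use r in \<open>auto simp: Lp_norm_def\<close>)
  then have dlim: "\<delta> \<longlonglongrightarrow> 0" using r by (simp add: Lp_norm_powr \<delta>_def[abs_def])
  have est: "\<bar>pairing (absorption r (g n)) (frame j) - pairing (absorption r h) (frame j)\<bar> \<le>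
      B * (12 * \<epsilon> * (P + \<delta> n) + 12 * (1 / \<epsilon>) powr (r + 1) * \<delta> n)" if e: "0 < \<epsilon>" "\<epsilon> \<le> 1" for n \<epsilon>
  proof -
    have i: "integrable TM (\<lambda>x. absorption r (g n) x \<bullet> frame j x)" "integrable TM (\<lambda>x. absorption r h x \<bullet> frame j x)"
      by (rule absorption_test(1)[OF r _ frame_regular(6) ae]; fact g h)+
    have di: "integrable TM (\<lambda>x. norm (g n x - h x) powr (r + 1))" by (rule Lp_space_diff[OF g h]) (use r in simp)
    have hi: "integrable TM (\<lambda>x. norm (h x) powr (r + 1))" using h by (simp add: Lp_space_def)
    have "pairing (absorption r (g n)) (frame j) - pairing (absorption r h) (frame j) =
        (\<integral>x. (absorption r (g n) x - absorption r h x) \<bullet> frame j x \<partial>TM)"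
      using i by (simp add: pairing_def inner_diff_left)
    also have "\<bar>\<dots>\<bar> \<le> (\<integral>x. \<bar>(absorption r (g n) x - absorption r h x) \<bullet> frame j x\<bar> \<partial>TM)"
      by (rule integral_abs_bound)
    also have "\<dots> \<le> (\<integral>x. B * (12 * \<epsilon> * (1 + norm (h x) powr (r + 1) + norm (g n x - h x) powr (r + 1))
        + 12 * (1 / \<epsilon>) powr (r + 1) * norm (g n x - h x) powr (r + 1)) \<partial>TM)"
    proof (rule integral_mono)
      show "integrable TM (\<lambda>x. \<bar>(absorption r (g n) x - absorption r h x) \<bullet> frame j x\<bar>)"
        using i by (simp add: inner_diff_left)
      show "integrable TM (\<lambda>x. B * (12 * \<epsilon> * (1 + norm (h x) powr (r + 1) + norm (g n x - h x) powr (r + 1))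
        + 12 * (1 / \<epsilon>) powr (r + 1) * norm (g n x - h x) powr (r + 1)))"
        by (intro integrable_mult_right Bochner_Integration.integrable_add di hi) simp_all
      fix x
      have "\<bar>(absorption r (g n) x - absorption r h x) \<bullet> frame j x\<bar> \<le> norm (absorption r (g n) x - absorption r h x) * norm (frame j x)"
        by (rule Cauchy_Schwarz_ineq2)
      also have "\<dots> \<le> (12 * \<epsilon> * (1 + norm (h x) powr (r + 1) + norm (g n x - h x) powr (r + 1))
        + 12 * (1 / \<epsilon>) powr (r + 1) * norm (g n x - h x) powr (r + 1)) * B"
        using absorb_diff_epsilon[OF r e, of "g n x" "h x"] B[of x]
        by (intro mult_mono) (auto simp: absorption_absorb intro: order_trans[OF norm_ge_zero])
      finally show "\<bar>(absorption r (g n) x - absorption r h x) \<bullet> frame j x\<bar> \<le> B * (12 * \<epsilon> * (1 + norm (h x) powr (r + 1) + norm (g n x - h x) powr (r + 1))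
        + 12 * (1 / \<epsilon>) powr (r + 1) * norm (g n x - h x) powr (r + 1))" by (simp add: mult.commute)
    qed
    also have "\<dots> = B * (12 * \<epsilon> * (P + \<delta> n) + 12 * (1 / \<epsilon>) powr (r + 1) * \<delta> n)"
      using di hi by (simp add: P_def \<delta>_def measure_TM Bochner_Integration.integral_add)
    finally show ?thesis .
  qed
  have "(\<lambda>n. pairing (absorption r (g n)) (frame j) - pairing (absorption r h) (frame j)) \<longlonglongrightarrow> 0"
  proof (rule LIMSEQ_I)
    fix e :: real assume "0 < e"
    define C where "C = B * 12 * P + 1"
    have C: "0 < C" using B0 P0 by (simp add: C_def add_nonneg_pos)
    define \<epsilon> where "\<epsilon> = min 1 (e / (2 * C))"
    have e: "0 < \<epsilon>" "\<epsilon> \<le> 1" using C \<open>0 < e\<close> by (auto simp: \<epsilon>_def)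
    have "B * (12 * \<epsilon> * P) \<le> \<epsilon> * C" using e by (simp add: C_def algebra_simps)
    also have "\<dots> \<le> (e / (2 * C)) * C" using C by (intro mult_right_mono) (auto simp: \<epsilon>_def)
    finally have 1: "B * (12 * \<epsilon> * P) \<le> e / 2" using C by simp
    have "(\<lambda>n. B * (12 * \<epsilon> * (P + \<delta> n) + 12 * (1 / \<epsilon>) powr (r + 1) * \<delta> n)) \<longlonglongrightarrow>
        B * (12 * \<epsilon> * (P + 0) + 12 * (1 / \<epsilon>) powr (r + 1) * 0)"
      by (intro tendsto_intros dlim)
    then have "\<forall>\<^sub>F n in sequentially. B * (12 * \<epsilon> * (P + \<delta> n) + 12 * (1 / \<epsilon>) powr (r + 1) * \<delta> n) < e"
      by (rule order_tendstoD(2)) (use 1 \<open>0 < e\<close> in simp)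
    then obtain n0 where "\<And>n. n \<ge> n0 \<Longrightarrow> B * (12 * \<epsilon> * (P + \<delta> n) + 12 * (1 / \<epsilon>) powr (r + 1) * \<delta> n) < e"
      by (auto simp: eventually_sequentially)
    then show "\<exists>no. \<forall>n\<ge>no. norm (pairing (absorption r (g n)) (frame j) - pairing (absorption r h) (frame j) - 0) < e"
      using est[OF e] by (intro exI[of _ n0]) (auto intro: order_le_less_trans)
  qed
  then show ?thesis by (rule LIM_zero_cancel)
qed

section \<open>Properties of weak solutions\<close>

lemma weak_solution_regularity:
  assumes r: "1 \<le> r" and u: "weak_solution r T u0 u"
  shows "AE t in lebesgue_on {0..T}. u t \<in> weak_class r"
    and "\<exists>m. AE t in lebesgue_on {0..T}. N2 (u t) \<le> m"
    and "integrable (lebesgue_on {0..T}) (\<lambda>t. (Hs_norm 1 (u t))\<^sup>2)"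
    and "integrable (lebesgue_on {0..T}) (\<lambda>t. \<integral>x. norm (u t x) powr (r + 1) \<partial>TM)"
proof -
  have b: "u \<in> Bochner_Linf T H_sigma N2" "u \<in> Bochner_Lq (r + 1) T (Lp_sigma (r + 1)) (Lp_norm (r + 1))"
    "u \<in> Bochner_Lq 2 T (V_space 1) (Hs_norm 1)"
    using u by (auto simp: weak_solution_def)
  have "AE t in lebesgue_on {0<..<T}. u t \<in> H_sigma" "AE t in lebesgue_on {0<..<T}. u t \<in> Lp_sigma (r + 1)"
    "AE t in lebesgue_on {0<..<T}. u t \<in> V_space 1"
    using b by (auto simp: Bochner_Linf_def Bochner_Lq_def Bochner_measurable_def)
  then have "AE t in lebesgue_on {0<..<T}. u t \<in> weak_class r"
    by eventually_elim (auto simp: weak_class_def V_space_def Lp_sigma_def)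
  then show "AE t in lebesgue_on {0..T}. u t \<in> weak_class r" by (rule AE_open_interval_imp_closed) simp
  obtain m where "AE t in lebesgue_on {0<..<T}. N2 (u t) \<le> m" using b(1) by (auto simp: Bochner_Linf_def)
  then show "\<exists>m. AE t in lebesgue_on {0..T}. N2 (u t) \<le> m" using AE_open_interval_imp_closed by blast
  have "integrable (lebesgue_on {0<..<T}) (\<lambda>t. (Hs_norm 1 (u t))\<^sup>2)"
    using b(3) by (simp add: Bochner_Lq_def powr_two)
  then show "integrable (lebesgue_on {0..T}) (\<lambda>t. (Hs_norm 1 (u t))\<^sup>2)" by (rule integrable_closed_interval)
  have "integrable (lebesgue_on {0<..<T}) (\<lambda>t. \<integral>x. norm (u t x) powr (r + 1) \<partial>TM)"
    using b(2) r by (simp add: Bochner_Lq_def Lp_norm_powr)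
  then show "integrable (lebesgue_on {0..T}) (\<lambda>t. \<integral>x. norm (u t x) powr (r + 1) \<partial>TM)" by (rule integrable_closed_interval)
qed

lemma integrable_lebesgue_on_bound:
  fixes f d :: "real \<Rightarrow> real"
  assumes "f \<in> borel_measurable (lebesgue_on S)" "integrable (lebesgue_on S) d" "AE t in lebesgue_on S. \<bar>f t\<bar> \<le> d t"
  shows "integrable (lebesgue_on S) f"
  by (rule Bochner_Integration.integrable_bound[OF assms(2,1)]) (use assms(3) in \<open>auto elim: eventually_mono\<close>)

text \<open>
  In the weak formulation each term is a separate integral, with value \<open>0\<close> if its integrand is not
  integrable.  Integrability of every term is what allows them to be combined, here and in the
  energy inequality.
\<close>

lemma weak_solution_terms_integrable:
  assumes r: "1 \<le> r" "r \<le> 3" and u: "weak_solution r T u0 u"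
  shows "integrable (lebesgue_on {0..T}) (\<lambda>t. pairing (weak_grad (u t)) (grad (frame j)))"
    and "integrable (lebesgue_on {0..T}) (\<lambda>t. tri (weak_grad (u t)) (u t) (frame j))"
    and "integrable (lebesgue_on {0..T}) (\<lambda>t. pairing (absorption r (u t)) (frame j))"
    and "integrable (lebesgue_on {0..T}) (\<lambda>t. (N2 (weak_grad (u t)))\<^sup>2)"
proof -
  have bm: "Bochner_measurable T (Lp_sigma (r + 1)) (Lp_norm (r + 1)) u" "Bochner_measurable T (V_space 1) (Hs_norm 1) u"
    using u by (auto simp: weak_solution_def Bochner_Lq_def)
  note R = weak_solution_regularity[OF r(1) u]
  obtain m where m: "AE t in lebesgue_on {0..T}. N2 (u t) \<le> m" using R(2) by blast
  obtain B where B: "\<And>x. norm (frame j x) \<le> B" using frame_bounded by blast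
  then have ae: "AE x in TM. norm (frame j x) \<le> B" by simp
  have B0: "0 \<le> B" using B[of 0] norm_ge_zero order_trans by blast
  have c: "integrable (lebesgue_on {0..T}) (\<lambda>t. c)" for c :: real by simp
  show "integrable (lebesgue_on {0..T}) (\<lambda>t. pairing (weak_grad (u t)) (grad (frame j)))"
  proof (rule integrable_lebesgue_on_bound)
    show "(\<lambda>t. pairing (weak_grad (u t)) (grad (frame j))) \<in> borel_measurable (lebesgue_on {0..T})"
    proof (rule Bochner_functional_measurable[OF bm(2)])
      fix g :: "nat \<Rightarrow> vfield" and h
      assume g: "\<And>n. g n \<in> V_space 1" and h: "h \<in> V_space 1" and l: "(\<lambda>n. Hs_norm 1 (\<lambda>x. g n x - h x)) \<longlonglongrightarrow> 0"
      note L = Hs_norm_tendsto_weak_grad[OF V_space_Hs[OF g] V_space_Hs[OF h] l]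
      have z: "(\<lambda>n. N2 (\<lambda>x. grad (frame j) x - grad (frame j) x)) \<longlonglongrightarrow> 0" by (simp add: N2_eq)
      show "(\<lambda>n. pairing (weak_grad (g n)) (grad (frame j))) \<longlonglongrightarrow> pairing (weak_grad h) (grad (frame j))"
        by (rule pairing_tendsto[OF weak_grad(2)[OF V_space_Hs[OF g]] weak_grad(2)[OF V_space_Hs[OF h]] L(2)
            frame_regular(5) frame_regular(5) z])
    qed
    show "integrable (lebesgue_on {0..T}) (\<lambda>t. (Hs_norm 1 (u t))\<^sup>2 + (N2 (grad (frame j)))\<^sup>2)"
      by (intro Bochner_Integration.integrable_add R c)
    show "AE t in lebesgue_on {0..T}. \<bar>pairing (weak_grad (u t)) (grad (frame j))\<bar> \<le> (Hs_norm 1 (u t))\<^sup>2 + (N2 (grad (frame j)))\<^sup>2"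
      using R(1)
    proof eventually_elim
      case (elim t)
      then have h: "u t \<in> Hs_space 1" by (simp add: weak_class_def)
      have "\<bar>pairing (weak_grad (u t)) (grad (frame j))\<bar> \<le> N2 (weak_grad (u t)) * N2 (grad (frame j))"
        by (rule pairing_bound[OF weak_grad(2)[OF h] frame_regular(5)])
      also have "\<dots> \<le> Hs_norm 1 (u t) * N2 (grad (frame j))" by (intro mult_right_mono weak_grad(3)[OF h]) simp
      also have "\<dots> \<le> (Hs_norm 1 (u t))\<^sup>2 + (N2 (grad (frame j)))\<^sup>2" by (rule mult_le_sum_sq) auto
      finally show ?case .
    qed
  qed
  show "integrable (lebesgue_on {0..T}) (\<lambda>t. tri (weak_grad (u t)) (u t) (frame j))"
  proof (rule integrable_lebesgue_on_bound)
    show "(\<lambda>t. tri (weak_grad (u t)) (u t) (frame j)) \<in> borel_measurable (lebesgue_on {0..T})"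
      by (rule Bochner_functional_measurable[OF bm(2)]) (intro tri_tendsto_Hs V_space_Hs, auto)
    show "integrable (lebesgue_on {0..T}) (\<lambda>t. B * ((Hs_norm 1 (u t))\<^sup>2 + (Hs_norm 1 (u t))\<^sup>2))"
      by (intro Bochner_Integration.integrable_add integrable_mult_right R)
    show "AE t in lebesgue_on {0..T}. \<bar>tri (weak_grad (u t)) (u t) (frame j)\<bar> \<le> B * ((Hs_norm 1 (u t))\<^sup>2 + (Hs_norm 1 (u t))\<^sup>2)"
      using R(1)
    proof eventually_elim
      case (elim t)
      then have h: "u t \<in> Hs_space 1" by (simp add: weak_class_def)
      have "\<bar>tri (weak_grad (u t)) (u t) (frame j)\<bar> \<le> B * N2 (weak_grad (u t)) * N2 (u t)"
        by (rule tri_bounded_test(2)[OF weak_grad(2)[OF h] Hs_space_sq_int(1)[OF h] frame_regular(6) ae])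
      also have "\<dots> \<le> B * Hs_norm 1 (u t) * Hs_norm 1 (u t)"
        using B0 weak_grad(3)[OF h] N2_le_Hs_norm[OF h] by (intro mult_mono mult_nonneg_nonneg) auto
      also have "\<dots> \<le> B * ((Hs_norm 1 (u t))\<^sup>2 + (Hs_norm 1 (u t))\<^sup>2)"
        using B0 unfolding mult.assoc by (intro mult_left_mono mult_le_sum_sq) auto
      finally show ?case .
    qed
  qed
  show "integrable (lebesgue_on {0..T}) (\<lambda>t. pairing (absorption r (u t)) (frame j))"
  proof (rule integrable_lebesgue_on_bound)
    show "(\<lambda>t. pairing (absorption r (u t)) (frame j)) \<in> borel_measurable (lebesgue_on {0..T})"
      by (rule Bochner_functional_measurable[OF bm(1)], rule absorption_tendsto_Lp[OF r]) (auto simp: Lp_sigma_def)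
    show "integrable (lebesgue_on {0..T}) (\<lambda>t. B * ((2 * pi) ^ 3 + (\<integral>x. norm (u t x) powr (r + 1) \<partial>TM)))"
      by (intro integrable_mult_right Bochner_Integration.integrable_add R c)
    show "AE t in lebesgue_on {0..T}. \<bar>pairing (absorption r (u t)) (frame j)\<bar> \<le> B * ((2 * pi) ^ 3 + (\<integral>x. norm (u t x) powr (r + 1) \<partial>TM))"
      using R(1)
    proof eventually_elim
      case (elim t)
      then have p: "u t \<in> Lp_space (r + 1)" by (simp add: weak_class_def)
      then have pi: "u t \<in> borel_measurable TM" "integrable TM (\<lambda>x. norm (u t x) powr (r + 1))" by (auto simp: Lp_space_def)
      have "\<bar>pairing (absorption r (u t)) (frame j)\<bar> \<le> B * (\<integral>x. norm (u t x) powr r \<partial>TM)"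
        by (rule absorption_test(2)[OF r p frame_regular(6) ae])
      also have "(\<integral>x. norm (u t x) powr r \<partial>TM) \<le> (\<integral>x. 1 + norm (u t x) powr (r + 1) \<partial>TM)"
      proof (rule integral_mono)
        show "integrable TM (\<lambda>x. norm (u t x) powr r)" by (rule powr_integrable_intermediate[OF pi]) (use r in auto)
        show "integrable TM (\<lambda>x. 1 + norm (u t x) powr (r + 1))" using pi by simp
        show "norm (u t x) powr r \<le> 1 + norm (u t x) powr (r + 1)" for x
        proof (cases "norm (u t x) \<le> 1")
          case True
          then have "norm (u t x) powr r \<le> 1" using r by (intro powr_le1) auto
          then show ?thesis using powr_ge_zero[of "norm (u t x)" "r + 1"] by linarith
        next
          case False
          then have "norm (u t x) powr r \<le> norm (u t x) powr (r + 1)" by (intro powr_mono) auto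
          then show ?thesis by linarith
        qed
      qed
      also have "(\<integral>x. 1 + norm (u t x) powr (r + 1) \<partial>TM) = (2 * pi) ^ 3 + (\<integral>x. norm (u t x) powr (r + 1) \<partial>TM)"
        using pi by (simp add: measure_TM)
      finally show ?case using B0 by (simp add: mult_left_mono)
    qed
  qed
  show "integrable (lebesgue_on {0..T}) (\<lambda>t. (N2 (weak_grad (u t)))\<^sup>2)"
  proof (rule integrable_lebesgue_on_bound[OF _ R(3)])
    show "(\<lambda>t. (N2 (weak_grad (u t)))\<^sup>2) \<in> borel_measurable (lebesgue_on {0..T})"
    proof (rule Bochner_functional_measurable[OF bm(2)])
      fix g :: "nat \<Rightarrow> vfield" and h
      assume g: "\<And>n. g n \<in> V_space 1" and h: "h \<in> V_space 1" and l: "(\<lambda>n. Hs_norm 1 (\<lambda>x. g n x - h x)) \<longlonglongrightarrow> 0"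
      note L = Hs_norm_tendsto_weak_grad[OF V_space_Hs[OF g] V_space_Hs[OF h] l]
      show "(\<lambda>n. (N2 (weak_grad (g n)))\<^sup>2) \<longlonglongrightarrow> (N2 (weak_grad h))\<^sup>2"
        by (intro tendsto_power N2_tendsto L weak_grad(2) V_space_Hs g h)
    qed
    show "AE t in lebesgue_on {0..T}. \<bar>(N2 (weak_grad (u t)))\<^sup>2\<bar> \<le> (Hs_norm 1 (u t))\<^sup>2"
      using R(1) by eventually_elim (auto simp: weak_class_def intro!: power_mono weak_grad)
  qed
qed

lemma cbf_form_frame_integrable:
  assumes r: "1 \<le> r" "r \<le> 3" and u: "weak_solution r T u0 u"
  shows "integrable (lebesgue_on {0..T}) (\<lambda>t. cbf_form r (u t) (frame j))"
  unfolding cbf_form_def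
  by (intro Bochner_Integration.integrable_add weak_solution_terms_integrable[OF r u])

subsection \<open>Testing with a fixed wave\<close>

lemma smooth_compose_fst:
  assumes "smooth (\<eta> :: real \<Rightarrow> real)"
  shows "smooth (\<lambda>p :: real \<times> 'a::euclidean_space. \<eta> (fst p))"
proof -
  have "C_diff k \<eta> \<Longrightarrow> C_diff k (\<lambda>p :: real \<times> 'a. \<eta> (fst p))" for k and \<eta> :: "real \<Rightarrow> real"
  proof (induction k arbitrary: \<eta>)
    case 0
    then have "continuous_on UNIV \<eta>" by simp
    from continuous_on_compose2[OF this continuous_on_fst[OF continuous_on_id], of UNIV]
    show ?case by simp
  next
    case (Suc k)
    have d: "((\<lambda>p :: real \<times> 'a. \<eta> (fst p)) has_derivative (\<lambda>v. frechet_derivative \<eta> (at (fst p)) (fst v))) (at p)" for p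
    proof (rule has_derivative_compose[of fst fst])
      show "(fst has_derivative fst) (at p)" by (rule bounded_linear_imp_has_derivative[OF bounded_linear_fst])
      show "(\<eta> has_derivative frechet_derivative \<eta> (at (fst p))) (at (fst p))"
        using Suc.prems by (simp add: frechet_derivative_works)
    qed
    have "C_diff k (\<lambda>p :: real \<times> 'a. frechet_derivative \<eta> (at (fst p)) w)" for w
      using Suc.IH[of "\<lambda>x. frechet_derivative \<eta> (at x) w"] Suc.prems by simp
    then show ?case
      using has_derivative_imp_differentiable[OF d]
      by (simp add: frechet_derivative_at[OF d, symmetric])
  qed
  then show ?thesis using assms by (simp add: smooth_def)
qed

lemma test_function_frame:
  assumes eta: "smooth \<eta>" "\<And>s. s \<ge> b \<Longrightarrow> \<eta> s = 0" and "b < T"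
  shows "test_function T (\<lambda>s x. \<eta> s *\<^sub>R frame j x)"
  unfolding test_function_def
proof (intro conjI)
  obtain k \<theta> i where j: "j = (k, \<theta>, i)" by (cases j)
  have "smooth (\<lambda>p :: real \<times> (real^3). \<eta> (fst p) *\<^sub>R (cos (freq k \<bullet> snd p + \<theta>) *\<^sub>R freq_proj k (axis i 1)))"
    by (intro smooth_scaleR smooth_compose_fst eta smooth_cos_linear bounded_linear_compose[OF bounded_linear_inner_right bounded_linear_snd])
  then show "smooth (\<lambda>(t, x). \<eta> t *\<^sub>R frame j x)"
    by (simp add: case_prod_unfold frame_def j wave_def)
  show "\<forall>t. periodic (\<lambda>x. \<eta> t *\<^sub>R frame j x)"
    using frame_regular(2)[of j] by (simp add: periodic_def)
  show "\<forall>t\<in>{0..<T}. \<forall>x. divergence (\<lambda>x. \<eta> t *\<^sub>R frame j x) x = 0"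
  proof (intro ballI allI)
    fix t x
    have "((\<lambda>x. \<eta> t *\<^sub>R frame j x) has_derivative (\<lambda>v. \<eta> t *\<^sub>R frechet_derivative (frame j) (at x) v)) (at x)"
      by (intro has_derivative_scaleR_right smooth_frechet(1) frame_regular)
    from frechet_derivative_at[OF this, symmetric]
    have "divergence (\<lambda>x. \<eta> t *\<^sub>R frame j x) x = \<eta> t * divergence (frame j) x"
      by (simp add: divergence_def trace_def grad_nth sum_distrib_left)
    then show "divergence (\<lambda>x. \<eta> t *\<^sub>R frame j x) x = 0" by (simp add: frame_regular)
  qed
  show "\<exists>T'<T. \<forall>t\<ge>T'. \<forall>x. \<eta> t *\<^sub>R frame j x = 0"
    using eta(2) \<open>b < T\<close> by auto
qed

text \<open>
  For almost every \<open>t\<close> the weak formulation is tested with \<open>\<eta> e\<^sub>j\<close>, where the cutoff \<open>\<eta>\<close> is \<open>1\<close> on \<open>[0,t]\<close>, so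
  that the term with the time derivative vanishes.  Both sides are continuous in \<open>t\<close>, the left one
  by weak continuity, hence they agree for every \<open>t\<close>.
\<close>

lemma pairing_frame_equation:
  assumes r: "1 \<le> r" "r \<le> 3" and T: "0 < T" and u: "weak_solution r T u0 u" and wc: "weakly_continuous T u"
    and t: "t \<in> {0..T}"
  shows "pairing (u t) (frame j) = pairing u0 (frame j) + (\<integral>s. - cbf_form r (u s) (frame j) \<partial>lebesgue_on {0..t})"
proof (rule continuous_AE_eq[OF T _ _ _ t])
  have "frame j \<in> H_sigma"
  proof -
    have "frame j \<in> Lp_space 2" using frame_regular[of j] by (simp add: Lp_space_2)
    moreover have "(\<lambda>n::nat. N2 (\<lambda>x. frame j x - frame j x)) \<longlonglongrightarrow> 0" by (simp add: N2_eq)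
    ultimately show ?thesis using frame_D_sigma[of j] unfolding Lp_sigma_def by (auto intro!: exI[of _ "\<lambda>_. frame j"])
  qed
  then show "continuous_on {0..T} (\<lambda>t. pairing (u t) (frame j))" using wc by (simp add: weakly_continuous_def)
  note I = weak_solution_terms_integrable(1-3)[OF r u, of j]
  show "continuous_on {0..T} (\<lambda>t. pairing u0 (frame j) + (\<integral>s. - cbf_form r (u s) (frame j) \<partial>lebesgue_on {0..t}))"
    by (intro continuous_intros indefinite_integral_continuous_real Bochner_Integration.integrable_minus cbf_form_frame_integrable[OF r u])
  have "AE t in lebesgue_on {0<..<T}. t \<in> {0<..<T}" by (simp add: AE_lebesgue_on_iff)
  moreover have "AE t in lebesgue_on {0<..<T}. \<forall>\<phi>. test_function T \<phi> \<longrightarrow>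
        - (\<integral>s. pairing (u s) (time_deriv \<phi> s) \<partial>lebesgue_on {0..t})
        + (\<integral>s. pairing (weak_grad (u s)) (grad (\<phi> s)) \<partial>lebesgue_on {0..t})
        + (\<integral>s. pairing (convection (u s) (u s)) (\<phi> s) \<partial>lebesgue_on {0..t})
        + (\<integral>s. pairing (absorption r (u s)) (\<phi> s) \<partial>lebesgue_on {0..t})
        = - pairing (u t) (\<phi> t) + pairing u0 (\<phi> 0)"
    using u by (simp add: weak_solution_def)
  ultimately show "AE t in lebesgue_on {0<..<T}. pairing (u t) (frame j) =
      pairing u0 (frame j) + (\<integral>s. - cbf_form r (u s) (frame j) \<partial>lebesgue_on {0..t})"
  proof eventually_elim
    case (elim t)
    \<comment> \<open>Two times between \<open>t\<close> and \<open>T\<close>: the cutoff decreases from \<open>1\<close> to \<open>0\<close> on \<open>[a,b]\<close>.\<close>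
    define a b where "a = (2 * t + T) / 3" and "b = (t + 2 * T) / 3"
    have ab: "t < a" "a < b" "b < T" using elim(1) by (auto simp: a_def b_def)
    obtain \<eta> :: "real \<Rightarrow> real" where eta: "smooth \<eta>" "\<And>s. s \<le> a \<Longrightarrow> \<eta> s = 1" "\<And>s. s \<ge> b \<Longrightarrow> \<eta> s = 0"
      using smooth_time_cutoff[OF ab(2)] by blast
    define \<phi> where "\<phi> s x = \<eta> s *\<^sub>R frame j x" for s x
    have tf: "test_function T \<phi>"
      unfolding \<phi>_def[abs_def] by (rule test_function_frame[OF eta(1,3) ab(3)])
    have ph: "\<phi> s = frame j" if "s \<le> a" for s using eta(2)[OF that] by (simp add: \<phi>_def fun_eq_iff)
    have td: "time_deriv \<phi> s = (\<lambda>x. 0)" if "s < a" for s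
    proof
      fix x
      have "((\<lambda>s. frame j x) has_vector_derivative 0) (at s)" by simp
      then have "((\<lambda>s. \<phi> s x) has_vector_derivative 0) (at s)"
        by (rule has_vector_derivative_transform_within_open[where S="{..<a}"]) (use that ph in auto)
      then show "time_deriv \<phi> s x = 0" by (simp add: time_deriv_def vector_derivative_at)
    qed
    have sp: "s \<le> a" "s < a" if "s \<in> space (lebesgue_on {0..t})" for s using that ab by auto
    have eq: "- (\<integral>s. pairing (u s) (time_deriv \<phi> s) \<partial>lebesgue_on {0..t})
        + (\<integral>s. pairing (weak_grad (u s)) (grad (\<phi> s)) \<partial>lebesgue_on {0..t})
        + (\<integral>s. pairing (convection (u s) (u s)) (\<phi> s) \<partial>lebesgue_on {0..t})
        + (\<integral>s. pairing (absorption r (u s)) (\<phi> s) \<partial>lebesgue_on {0..t})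
        = - pairing (u t) (\<phi> t) + pairing u0 (\<phi> 0)"
      using elim(2) tf by blast
    have e1: "(\<integral>s. pairing (u s) (time_deriv \<phi> s) \<partial>lebesgue_on {0..t}) = (\<integral>s. 0 \<partial>lebesgue_on {0..t})"
      using td sp by (intro Bochner_Integration.integral_cong refl) (simp add: pairing_def)
    have e2: "(\<integral>s. pairing (weak_grad (u s)) (grad (\<phi> s)) \<partial>lebesgue_on {0..t}) = (\<integral>s. pairing (weak_grad (u s)) (grad (frame j)) \<partial>lebesgue_on {0..t})"
      using ph sp by (intro Bochner_Integration.integral_cong refl) simp
    have e3: "(\<integral>s. pairing (convection (u s) (u s)) (\<phi> s) \<partial>lebesgue_on {0..t}) = (\<integral>s. tri (weak_grad (u s)) (u s) (frame j) \<partial>lebesgue_on {0..t})"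
      using ph sp by (intro Bochner_Integration.integral_cong refl) (simp add: tri_def convection_def[abs_def])
    have e4: "(\<integral>s. pairing (absorption r (u s)) (\<phi> s) \<partial>lebesgue_on {0..t}) = (\<integral>s. pairing (absorption r (u s)) (frame j) \<partial>lebesgue_on {0..t})"
      using ph sp by (intro Bochner_Integration.integral_cong refl) simp
    have sub: "{0..t} \<subseteq> {0..T}" using elim(1) by auto
    have "(\<integral>s. cbf_form r (u s) (frame j) \<partial>lebesgue_on {0..t}) =
        (\<integral>s. pairing (weak_grad (u s)) (grad (frame j)) \<partial>lebesgue_on {0..t})
        + (\<integral>s. tri (weak_grad (u s)) (u s) (frame j) \<partial>lebesgue_on {0..t})
        + (\<integral>s. pairing (absorption r (u s)) (frame j) \<partial>lebesgue_on {0..t})"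
      unfolding cbf_form_def using integrable_subinterval[OF I(1) sub] integrable_subinterval[OF I(2) sub]
        integrable_subinterval[OF I(3) sub] by simp
    then show ?case
      using eq ph[of t] ph[of 0] ab elim(1) unfolding e1 e2 e3 e4 by simp
  qed
qed

section \<open>The evolution of the inner product of two solutions\<close>

lemma cbf_form_trunc:
  assumes r: "1 \<le> r" "r \<le> 3" and u: "u \<in> weak_class r" and v: "v \<in> H_sigma"
  shows "cbf_form r u (trunc N v) =
    (\<Sum>j\<in>frame_index N. ((1 / (2 * pi) ^ 3) * pairing v (frame j)) * cbf_form r u (frame j))"
proof -
  define c where "c j = (1 / (2 * pi) ^ 3) * pairing v (frame j)" for j
  have tv: "trunc N v = (\<lambda>x. \<Sum>j\<in>frame_index N. c j *\<^sub>R frame j x)"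
    using trunc_frame[OF v, of N] by (simp add: c_def fun_eq_iff)
  have gr: "grad (trunc N v) x = (\<Sum>j\<in>frame_index N. c j *\<^sub>R grad (frame j) x)" for x
  proof -
    have "(trunc N v has_derivative (\<lambda>w. \<Sum>j\<in>frame_index N. c j *\<^sub>R frechet_derivative (frame j) (at x) w)) (at x)"
      unfolding tv by (intro has_derivative_sum has_derivative_scaleR_right smooth_frechet(1) frame_regular)
    from frechet_derivative_at[OF this, symmetric]
    show ?thesis by (simp add: vec_eq_iff grad_nth)
  qed
  have u': "u \<in> Hs_space 1" "u \<in> Lp_space (r + 1)" "sq_int u"
    using u by (auto simp: weak_class_def intro: Hs_space_sq_int)
  note G = weak_grad(2)[OF u'(1)]
  have i1: "integrable TM (\<lambda>x. weak_grad u x \<bullet> grad (frame j) x)" for j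
    by (rule sq_int_inner_integrable[OF G frame_regular(5)])
  have i2: "integrable TM (\<lambda>x. (weak_grad u x *v u x) \<bullet> frame j x)" for j
  proof -
    obtain B where "\<And>x. norm (frame j x) \<le> B" using frame_bounded by blast
    then show ?thesis by (intro tri_bounded_test(1)[OF G u'(3) frame_regular(6), of _ B]) simp
  qed
  have i3: "integrable TM (\<lambda>x. absorption r u x \<bullet> frame j x)" for j
  proof -
    obtain B where "\<And>x. norm (frame j x) \<le> B" using frame_bounded by blast
    then show ?thesis by (intro absorption_test(1)[OF r u'(2) frame_regular(6), of _ B]) simp
  qed
  have "pairing (weak_grad u) (grad (trunc N v)) = (\<Sum>j\<in>frame_index N. c j * pairing (weak_grad u) (grad (frame j)))"
    using i1 by (simp add: pairing_def gr inner_sum_right Bochner_Integration.integral_sum)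
  moreover have "tri (weak_grad u) u (trunc N v) = (\<Sum>j\<in>frame_index N. c j * tri (weak_grad u) u (frame j))"
    using i2 by (simp add: tri_def pairing_def tv inner_sum_right Bochner_Integration.integral_sum)
  moreover have "pairing (absorption r u) (trunc N v) = (\<Sum>j\<in>frame_index N. c j * pairing (absorption r u) (frame j))"
    using i3 by (simp add: pairing_def tv inner_sum_right Bochner_Integration.integral_sum)
  ultimately show ?thesis
    unfolding c_def[symmetric] by (simp add: cbf_form_def distrib_left sum.distrib)
qed

lemma pairing_trunc_frame:
  assumes u: "u \<in> H_sigma" and v: "sq_int v"
  shows "pairing (trunc N u) v = (\<Sum>j\<in>frame_index N. (1 / (2 * pi) ^ 3) * (pairing u (frame j) * pairing v (frame j)))"
proof -
  have i: "integrable TM (\<lambda>x. frame j x \<bullet> v x)" for j by (rule sq_int_inner_integrable[OF frame_regular(4) v])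
  have "pairing (trunc N u) v = (\<Sum>j\<in>frame_index N. ((1 / (2 * pi) ^ 3) * pairing u (frame j)) * pairing (frame j) v)"
    using i unfolding pairing_def[of _ v] trunc_frame[OF u]
    by (simp add: inner_sum_left Bochner_Integration.integral_sum)
  then show ?thesis using pairing_commute[of v] by (simp add: mult.assoc)
qed

lemma pairing_trunc_tendsto:
  assumes "sq_int u" "sq_int v"
  shows "(\<lambda>N. pairing (trunc N u) v) \<longlonglongrightarrow> pairing u v"
proof (rule pairing_tendsto)
  show "(\<lambda>N. N2 (\<lambda>x. v x - v x)) \<longlonglongrightarrow> 0" by (simp add: N2_eq)
qed (use assms in \<open>auto intro: trunc_tendsto\<close>)

text \<open>
  For the truncation \<open>trunc N (u t)\<close> the identity is a finite sum of products of absolutely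
  continuous functions of time; dominated convergence then removes the truncation.
\<close>

lemma inner_product_evolution:
  assumes r: "1 \<le> r" "r \<le> 3" and T: "0 < T"
    and u: "weak_solution r T u0 u" "weakly_continuous T u"
    and us: "AE s in lebesgue_on {0..T}. u s \<in> strong_class r"
    and ui: "integrable (lebesgue_on {0..T}) (\<lambda>s. (sup_bound (u s))\<^sup>2)"
    and v: "weak_solution r T u0 v" "weakly_continuous T v"
  shows "integrable (lebesgue_on {0..T}) (\<lambda>s. cross_form r (u s) (v s))"
    and "t \<in> {0..T} \<Longrightarrow> pairing (u t) (v t) = (N2 u0)\<^sup>2 - (\<integral>s. cross_form r (u s) (v s) \<partial>lebesgue_on {0..t})"
proof -
  let ?c = "1 / (2 * pi) ^ 3 :: real"
  note Ru = weak_solution_regularity[OF r(1) u(1)]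
  note Rv = weak_solution_regularity[OF r(1) v(1)]
  have u0: "u0 \<in> H_sigma" using u(1) by (simp add: weak_solution_def)
  have Hu: "u s \<in> H_sigma" and Hv: "v s \<in> H_sigma" if "s \<in> {0..T}" for s
    using u(2) v(2) that by (auto simp: weakly_continuous_def)
  obtain mu mv where mu: "AE s in lebesgue_on {0..T}. N2 (u s) \<le> mu" and mv: "AE s in lebesgue_on {0..T}. N2 (v s) \<le> mv"
    using Ru(2) Rv(2) by blast
  define m where "m = max mu mv"
  have AEsp: "AE s in lebesgue_on {0..T}. s \<in> {0..T}" by (simp add: AE_lebesgue_on_iff)
  define F where "F j s = - cbf_form r (u s) (frame j)" for j s
  define G where "G j s = - cbf_form r (v s) (frame j)" for j s
  have Fi: "integrable (lebesgue_on {0..T}) (F j)" and Gi: "integrable (lebesgue_on {0..T}) (G j)" for j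
    unfolding F_def G_def
    by (intro Bochner_Integration.integrable_minus cbf_form_frame_integrable[OF r u(1)],
        intro Bochner_Integration.integrable_minus cbf_form_frame_integrable[OF r v(1)])
  define P where "P j s = F j s * pairing (v s) (frame j) + pairing (u s) (frame j) * G j s" for j s
  have prod: "pairing (u t) (frame j) * pairing (v t) (frame j) =
      pairing u0 (frame j) * pairing u0 (frame j) + (\<integral>s. P j s \<partial>lebesgue_on {0..t})"
    and Pi: "integrable (lebesgue_on {0..t}) (P j)" if "t \<in> {0..T}" for t j
  proof -
    have sub: "{0..t} \<subseteq> {0..T}" using that by auto
    have eu: "pairing (u s) (frame j) = pairing u0 (frame j) + (\<integral>x. F j x \<partial>lebesgue_on {0..s})"
      and ev: "pairing (v s) (frame j) = pairing u0 (frame j) + (\<integral>x. G j x \<partial>lebesgue_on {0..s})" if "s \<in> {0..t}" for s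
      unfolding F_def G_def using that sub
      by (intro pairing_frame_equation[OF r T u] pairing_frame_equation[OF r T v]; auto)+
    have t0: "0 \<le> t" using that by simp
    note pr = product_rule[OF integrable_subinterval[OF Fi sub] integrable_subinterval[OF Gi sub] t0, of
        "\<lambda>s. pairing (u s) (frame j)" "pairing u0 (frame j)" j "\<lambda>s. pairing (v s) (frame j)" "pairing u0 (frame j)" j, OF eu ev]
    show "pairing (u t) (frame j) * pairing (v t) (frame j) =
      pairing u0 (frame j) * pairing u0 (frame j) + (\<integral>s. P j s \<partial>lebesgue_on {0..t})"
      using pr(1) by (simp add: P_def)
    show "integrable (lebesgue_on {0..t}) (P j)" using pr(2) by (simp add: P_def[abs_def])
  qed
  define I where "I N s = (\<Sum>j\<in>frame_index N. ?c * P j s)" for N s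
  have Ii: "integrable (lebesgue_on {0..t}) (I N)" if "t \<in> {0..T}" for t N
    unfolding I_def[abs_def] using Pi[OF that] by simp
  have I_eq: "AE s in lebesgue_on {0..T}. \<forall>N. I N s = - (cbf_form r (u s) (trunc N (v s)) + cbf_form r (v s) (trunc N (u s)))"
    using Ru(1) Rv(1) AEsp
  proof eventually_elim
    case (elim s)
    have "cbf_form r (u s) (trunc N (v s)) + cbf_form r (v s) (trunc N (u s)) = - I N s" for N
      unfolding cbf_form_trunc[OF r elim(1) Hv[OF elim(3)]] cbf_form_trunc[OF r elim(2) Hu[OF elim(3)]]
        I_def P_def F_def G_def sum.distrib[symmetric] sum_negf[symmetric]
      by (intro sum.cong refl) (simp add: algebra_simps)
    then show ?case by simp
  qed
  have lim: "AE s in lebesgue_on {0..T}. (\<lambda>N. I N s) \<longlonglongrightarrow> - cross_form r (u s) (v s)"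
    using I_eq us Rv(1)
  proof eventually_elim
    case (elim s)
    then show ?case using tendsto_minus[OF cross_form_tendsto[OF r elim(2,3)]] by simp
  qed
  have bound: "AE s in lebesgue_on {0..T}. \<forall>N. \<bar>I N s\<bar> \<le> cross_bound r m (u s) (v s)"
    using I_eq us Rv(1) mu mv
  proof eventually_elim
    case (elim s)
    have "N2 (u s) \<le> m" "N2 (v s) \<le> m" using elim(4,5) by (auto simp: m_def)
    from cbf_form_trunc_bound[OF r elim(2,3) this] show ?case
      using elim(1) by (simp only: abs_minus_cancel) blast
  qed
  have Di: "integrable (lebesgue_on {0..T}) (\<lambda>s. cross_bound r m (u s) (v s))"
    unfolding cross_bound_def
    by (intro Bochner_Integration.integrable_add integrable_mult_right integrable_mult_left ui Ru(3) Rv(3,4)) simp_all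
  have meas: "(\<lambda>s. - cross_form r (u s) (v s)) \<in> borel_measurable (lebesgue_on {0..T})"
    by (rule AE_limit_measurable[OF _ _ lim]) (use Ii[of T] T in auto)
  have ci: "integrable (lebesgue_on {0..T}) (\<lambda>s. - cross_form r (u s) (v s))"
  proof (rule integrable_lebesgue_on_bound[OF meas Di])
    show "AE s in lebesgue_on {0..T}. \<bar>- cross_form r (u s) (v s)\<bar> \<le> cross_bound r m (u s) (v s)"
      using lim bound
    proof eventually_elim
      case (elim s)
      show ?case using LIMSEQ_le_const2[OF tendsto_rabs[OF elim(1)]] elim(2) by blast
    qed
  qed
  then show "integrable (lebesgue_on {0..T}) (\<lambda>s. cross_form r (u s) (v s))" by simp
  assume t: "t \<in> {0..T}"
  then have sub: "{0..t} \<subseteq> {0..T}" and tT: "t \<le> T" by auto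
  have AEsub: "AE s in lebesgue_on {0..t}. P s" if "AE s in lebesgue_on {0..T}. P s" for P
    using that sub by (simp add: AE_lebesgue_on_iff) (auto elim: eventually_mono)
  have "(\<lambda>N. \<integral>s. I N s \<partial>lebesgue_on {0..t}) \<longlonglongrightarrow> (\<integral>s. - cross_form r (u s) (v s) \<partial>lebesgue_on {0..t})"
  proof (rule integral_dominated_convergence)
    show "(\<lambda>s. - cross_form r (u s) (v s)) \<in> borel_measurable (lebesgue_on {0..t})"
      using integrable_subinterval[OF ci sub] by (rule borel_measurable_integrable)
    show "I N \<in> borel_measurable (lebesgue_on {0..t})" for N using Ii[OF t] by (rule borel_measurable_integrable)
    show "integrable (lebesgue_on {0..t}) (\<lambda>s. cross_bound r m (u s) (v s))" by (rule integrable_subinterval[OF Di sub])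
    show "AE s in lebesgue_on {0..t}. (\<lambda>N. I N s) \<longlonglongrightarrow> - cross_form r (u s) (v s)" by (rule AEsub[OF lim])
    show "AE s in lebesgue_on {0..t}. norm (I N s) \<le> cross_bound r m (u s) (v s)" for N
      using AEsub[OF bound] by eventually_elim simp
  qed
  moreover have "(\<lambda>N. pairing (trunc N u0) u0) \<longlonglongrightarrow> pairing u0 u0"
    by (intro pairing_trunc_tendsto H_sigma_sq_int u0)
  ultimately have "(\<lambda>N. pairing (trunc N u0) u0 + (\<integral>s. I N s \<partial>lebesgue_on {0..t})) \<longlonglongrightarrow>
      pairing u0 u0 + (\<integral>s. - cross_form r (u s) (v s) \<partial>lebesgue_on {0..t})"
    by (intro tendsto_add)
  moreover have "pairing (trunc N (u t)) (v t) = pairing (trunc N u0) u0 + (\<integral>s. I N s \<partial>lebesgue_on {0..t})" for N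
  proof -
    have "(\<integral>s. I N s \<partial>lebesgue_on {0..t}) = (\<Sum>j\<in>frame_index N. ?c * (\<integral>s. P j s \<partial>lebesgue_on {0..t}))"
      unfolding I_def using Pi[OF t] by (simp add: Bochner_Integration.integral_sum)
    then show ?thesis
      unfolding pairing_trunc_frame[OF Hu[OF t] H_sigma_sq_int(1)[OF Hv[OF t]]]
        pairing_trunc_frame[OF u0 H_sigma_sq_int(1)[OF u0]] prod[OF t]
      by (simp only: distrib_left sum.distrib)
  qed
  moreover have "(\<lambda>N. pairing (trunc N (u t)) (v t)) \<longlonglongrightarrow> pairing (u t) (v t)"
    by (intro pairing_trunc_tendsto H_sigma_sq_int Hu Hv t)
  ultimately show "pairing (u t) (v t) = (N2 u0)\<^sup>2 - (\<integral>s. cross_form r (u s) (v s) \<partial>lebesgue_on {0..t})"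
    using LIMSEQ_unique by (fastforce simp: pairing_self)
qed

text \<open>At \<open>t = 0\<close> the equations for the frame say that \<open>v 0\<close> and \<open>u0\<close> have the same truncations.\<close>

lemma initial_norm:
  assumes r: "1 \<le> r" "r \<le> 3" and T: "0 < T" and v: "weak_solution r T u0 v" "weakly_continuous T v"
  shows "N2 (v 0) = N2 u0"
proof -
  have H: "u0 \<in> H_sigma" "v 0 \<in> H_sigma" using v T by (auto simp: weak_solution_def weakly_continuous_def)
  have i: "integrable (lebesgue_on {0..0}) (\<lambda>s. - cbf_form r (v s) (frame j))" for j
    by (rule integrable_subinterval[of 0 T]) (use cbf_form_frame_integrable[OF r v(1)] T in auto)
  have "pairing (v 0) (frame j) = pairing u0 (frame j)" for j
    using pairing_frame_equation[OF r T v, of 0 j] T lebesgue_integral_eq_integral[OF i] by simp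
  then have "trunc N (v 0) x = trunc N u0 x" for N x by (simp add: trunc_frame H)
  then have e: "trunc N (v 0) = trunc N u0" for N by blast
  have l: "(\<lambda>N. N2 (trunc N f)) \<longlonglongrightarrow> N2 f" if "f \<in> H_sigma" for f
    by (intro N2_tendsto trunc_tendsto H_sigma_sq_int that sq_int_trunc)
  show ?thesis using LIMSEQ_unique[OF l[OF H(2)]] l[OF H(1)] e by simp
qed

section \<open>Weak-strong uniqueness\<close>

theorem theorem4p4:
  fixes r T :: real and u0 :: vfield and u v :: "real \<Rightarrow> vfield"
  assumes "1 \<le> r" and "r \<le> 3" and "0 < T"
    and "strong_solution r T u0 u" and "weakly_continuous T u"
    and "weak_solution r T u0 v" and "weakly_continuous T v"
    and "energy_inequality r T v"
  shows "\<forall>t\<in>{0..T}. AE x in torus_measure. u t x = v t x"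
proof
  note r = assms(1,2) and T = assms(3) and v = assms(6,7) and energy = assms(8)
  have u: "weak_solution r T u0 u" "weakly_continuous T u" using assms(4,5) by (auto simp: strong_solution_def)
  have b2: "u \<in> Bochner_Lq 2 T (V_space 2) (Hs_norm 2)" using assms(4) by (simp add: strong_solution_def)
  have "AE s in lebesgue_on {0<..<T}. u s \<in> V_space 2"
    using b2 by (simp add: Bochner_Lq_def Bochner_measurable_def)
  then have "AE s in lebesgue_on {0..T}. u s \<in> V_space 2" by (rule AE_open_interval_imp_closed) simp
  then have us: "AE s in lebesgue_on {0..T}. u s \<in> strong_class r"
    using weak_solution_regularity(1)[OF r(1) u(1)]
    by eventually_elim (simp add: strong_class_def V_space_Hs)
  have "integrable (lebesgue_on {0<..<T}) (\<lambda>s. (Hs_norm 2 (u s))\<^sup>2)"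
    using b2 by (simp add: Bochner_Lq_def powr_two)
  then have "integrable (lebesgue_on {0..T}) (\<lambda>s. sup_const\<^sup>2 * (Hs_norm 2 (u s))\<^sup>2)"
    by (intro integrable_mult_right integrable_closed_interval)
  then have ui: "integrable (lebesgue_on {0..T}) (\<lambda>s. (sup_bound (u s))\<^sup>2)"
    by (simp add: sup_bound_def power_mult_distrib)
  note uv = inner_product_evolution[OF r T u us ui v]
  note uu = inner_product_evolution[OF r T u us ui u]
  note vR = weak_solution_regularity[OF r(1) v(1)]
  define Q where "Q s = cross_form r (u s) (v s) - 1/2 * cross_form r (u s) (u s) - (N2 (weak_grad (v s)))\<^sup>2
      - (\<integral>x. norm (v s x) powr (r + 1) \<partial>TM)" for s
  define w where "w t = (N2 (\<lambda>x. u t x - v t x))\<^sup>2" for t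
  define Y where "Y t = (\<integral>s. Q s \<partial>lebesgue_on {0..t})" for t
  \<comment> \<open>\<open>Y\<close> replaces \<open>w\<close> in the Gronwall argument: it dominates \<open>1/2 w\<close> and is continuous.\<close>
  note Q_parts = uv(1) uu(1) weak_solution_terms_integrable(4)[OF r v(1)] vR(4)
  have Qi: "integrable (lebesgue_on {0..T}) Q"
    unfolding Q_def[abs_def] by (intro Bochner_Integration.integrable_diff integrable_mult_right Q_parts)
  have wY: "1/2 * w t \<le> Y t" if t: "t \<in> {0..T}" for t
  proof -
    have sub: "{0..t} \<subseteq> {0..T}" using t by auto
    note i = Q_parts[THEN integrable_subinterval[OF _ sub]]
    have H: "sq_int (u t)" "sq_int (v t)" using u(2) v(2) t by (auto simp: weakly_continuous_def intro: H_sigma_sq_int)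
    have "1/2 * (N2 (v t))\<^sup>2 + (\<integral>s. (N2 (weak_grad (v s)))\<^sup>2 \<partial>lebesgue_on {0..t})
        + (\<integral>s. (\<integral>x. norm (v s x) powr (r + 1) \<partial>TM) \<partial>lebesgue_on {0..t}) \<le> 1/2 * (N2 u0)\<^sup>2"
      using energy t r initial_norm[OF r T v] by (simp add: energy_inequality_def Lp_norm_powr)
    moreover have "Y t = (\<integral>s. cross_form r (u s) (v s) \<partial>lebesgue_on {0..t}) - 1/2 * (\<integral>s. cross_form r (u s) (u s) \<partial>lebesgue_on {0..t})
        - (\<integral>s. (N2 (weak_grad (v s)))\<^sup>2 \<partial>lebesgue_on {0..t}) - (\<integral>s. (\<integral>x. norm (v s x) powr (r + 1) \<partial>TM) \<partial>lebesgue_on {0..t})"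
      unfolding Y_def Q_def using i by simp
    moreover have "w t = (N2 (u t))\<^sup>2 - 2 * pairing (u t) (v t) + (N2 (v t))\<^sup>2"
      unfolding w_def by (rule N2_diff_sq[OF H])
    ultimately show ?thesis using uv(2)[OF t] uu(2)[OF t] by (simp add: pairing_self)
  qed
  have Yc: "continuous_on {0..T} Y" unfolding Y_def by (rule indefinite_integral_continuous_real[OF Qi])
  have Y0: "0 \<le> Y s" if "s \<in> {0..T}" for s
    using wY[OF that] zero_le_power2[of "N2 (\<lambda>x. u s x - v s x)"] unfolding w_def by linarith
  define g where "g s = (sup_bound (u s))\<^sup>2 / 2" for s
  have gi: "integrable (lebesgue_on {0..T}) g" unfolding g_def[abs_def] using ui by simp
  have QY: "AE s in lebesgue_on {0..T}. Q s \<le> g s * Y s"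
  proof -
    have "AE s in lebesgue_on {0..T}. s \<in> {0..T}" by (simp add: AE_lebesgue_on_iff)
    then show ?thesis using us vR(1)
    proof eventually_elim
      case (elim s)
      have "Q s \<le> (sup_bound (u s))\<^sup>2 / 4 * w s"
        unfolding Q_def w_def by (rule cross_form_inequality[OF r elim(2,3)])
      also have "\<dots> = g s * (1/2 * w s)" by (simp add: g_def)
      also have "\<dots> \<le> g s * Y s" using wY[OF elim(1)] by (intro mult_left_mono) (auto simp: g_def)
      finally show ?case .
    qed
  qed
  fix t assume t: "t \<in> {0..T}"
  have "Y t = 0"
  proof (rule gronwall_zero[OF gi _ Yc Y0 _ t])
    show "0 \<le> g s" for s by (simp add: g_def)
    fix t assume t: "t \<in> {0..T}"
    then have sub: "{0..t} \<subseteq> {0..T}" by auto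
    have "integrable (lebesgue_on {0..T}) (\<lambda>s. g s * Y s)" by (rule integrable_mult_continuous[OF gi Yc])
    then have "integrable (lebesgue_on {0..t}) (\<lambda>s. g s * Y s)" using sub by (rule integrable_subinterval)
    moreover have "AE s in lebesgue_on {0..t}. Q s \<le> g s * Y s"
      using QY sub by (simp add: AE_lebesgue_on_iff) (auto elim: eventually_mono)
    ultimately show "Y t \<le> (\<integral>s. g s * Y s \<partial>lebesgue_on {0..t})"
      unfolding Y_def[of t] using integrable_subinterval[OF Qi sub] by (intro integral_mono_AE)
  qed
  then have "w t = 0" using wY[OF t] by (simp add: w_def)
  then have "N2 (\<lambda>x. u t x - v t x) = 0" by (simp add: w_def)
  moreover have "sq_int (\<lambda>x. u t x - v t x)"
    by (intro sq_int_diff H_sigma_sq_int(1)) (use u(2) v(2) t in \<open>auto simp: weakly_continuous_def\<close>)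
  ultimately have "AE x in TM. u t x - v t x = 0" by (intro N2_zero_imp_AE)
  then show "AE x in torus_measure. u t x = v t x" by eventually_elim simp
qed

end
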